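(* Let $s\in\mathbb{R}$ and $k>s$, and assume also that $k$ is nonnegative. (1) Let $\phi\in W_2^s(\mathbb{R}^d)$. The stationary PSI ladder $(S^h)_{h>0}$ with $S^h=\{g(\cdot/h): g\in S_\phi(W_2^s)\}$ provides approximation order $k$ in $W_2^s(\mathbb{R}^d)$ if and only if there exists a neighborhood $\Omega$ of $0$ such that $$\frac{[\widehat\phi,\widehat\phi]^0_s}{[\widehat\phi,\widehat\phi]_s}\,\frac{1}{|\cdot|^{2k-2s}}\in L_\infty(\Omega).$$ (2) Let $\phi_h\in W_2^s(\mathbb{R}^d)$ for each $h>0$. The nonstationary PSI ladder $(S^h)_{h>0}$ with $S^h=\{g(\cdot/h): g\in S_{\phi_h}(W_2^s)\}$ provides approximation order $k$ in $W_2^s(\mathbb{R}^d)$ if and only if, for some $h_0>0$ and some neighborhood $\Omega$ of $0$, the collection of functions $$\frac{[\widehat\phi_h,\widehat\phi_h]^0_s}{[\widehat\phi_h,\widehat\phi_h]_{s,h}}\,\frac{1}{(|\cdot|^2+h^2)^{k-s}},\qquad 0<h<h_0,$$ lies in $L_\infty(\Omega)$ and is bounded there.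
   Context: $|\cdot|$ is the Euclidean norm on $\mathbb{R}^d$; $\widehat f(\omega)=\int f(x)e^{-i\omega\cdot x}dx$. For $s\in\mathbb{R}$, $W_2^s=W_2^s(\mathbb{R}^d)$ is the space of tempered distributions $f$ with $\widehat f$ locally in $L_2(\mathbb{R}^d)$ and $\|f\|_{W_2^s}^2=\int_{\mathbb{R}^d}(1+|\omega|)^{2s}|\widehat f(\omega)|^2d\omega<\infty$. For $\phi\in W_2^s$, $S_\phi(W_2^s)$ is the smallest closed subspace of $W_2^s$ that contains $\phi$ and is invariant under all integer translations $f\mapsto f(\cdot+\alpha)$, $\alpha\in\mathbb{Z}^d$ (a principal shift-invariant, PSI, space). Approximation order: for $k>s$, a family (ladder) $(S^h)_{h>0}$ of closed subspaces of $W_2^s$, with $S^h$ invariant under translations by $h\mathbb{Z}^d$, provides approximation order $k$ in $W_2^s$ if there is a constant $C$ such that $\inf_{g\in S^h}\|f-g\|_{W_2^s}\le C h^{k-s}\|f\|_{W_2^k}$ for every $f\in W_2^k(\mathbb{R}^d)$ and every $h>0$. Bracket products: $[\widehat\phi,\widehat\phi]_s=\sum_{\alpha\in2\pi\mathbb{Z}^d}|\widehat\phi(\cdot+\alpha)|^2|\cdot+\alpha|^{2s}$; $[\widehat\phi,\widehat\phi]^0_s=\sum_{\alpha\in2\pi\mathbb{Z}^d\setminus\{0\}}|\widehat\phi(\cdot+\alpha)|^2|\cdot+\alpha|^{2s}$; and $[\widehat\phi_h,\widehat\phi_h]_{s,h}=[\widehat\phi_h,\widehat\phi_h]^0_s+|\widehat\phi_h|^2(|\cdot|^2+h^2)^s$.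 *)

theory Defs
  imports "HOL-Analysis.Analysis" "HOL-Probability.Essential_Supremum"
begin

section \<open>Schwartz functions and tempered distributions on \<open>\<real>\<^sup>d\<close>\<close>

definition partial :: "'d::finite \<Rightarrow> (real^'d \<Rightarrow> complex) \<Rightarrow> real^'d \<Rightarrow> complex" where
  "partial i f x = frechet_derivative f (at x) (axis i 1)"

text \<open>Multi-indices are lists of coordinates: \<open>partials [i, j, \<dots>] f\<close> is
  \<open>\<partial>\<^sub>i \<partial>\<^sub>j \<dots> f\<close>. It is meaningful only for smooth \<open>f\<close>, which
  \<open>schwartz\<close> below requires.\<close>

definition partials :: "'d::finite list \<Rightarrow> (real^'d \<Rightarrow> complex) \<Rightarrow> real^'d \<Rightarrow> complex" where
  "partials ds f = foldr partial ds f"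

definition schwartz :: "(real^'d::finite \<Rightarrow> complex) set" where
  "schwartz = {\<psi>. \<forall>ds. (\<forall>x. partials ds \<psi> differentiable (at x)) \<and>
     (\<forall>N::nat. bounded (range (\<lambda>x. (1 + norm x) ^ N *\<^sub>R partials ds \<psi> x)))}"

definition schwartz_seminorm :: "nat \<Rightarrow> (real^'d::finite \<Rightarrow> complex) \<Rightarrow> real" where
  "schwartz_seminorm N \<psi> =
     (SUP (x, ds) \<in> UNIV \<times> {ds. length ds \<le> N}. (1 + norm x) ^ N * cmod (partials ds \<psi> x))"

text \<open>Continuity on the Schwartz space is boundedness by one of the increasing seminorms
  \<open>schwartz_seminorm N\<close>. Functionals are extended by \<open>0\<close> outside the Schwartz space, so that
  equality of distributions is equality in HOL.\<close>

type_synonym 'd dist = "(real^'d \<Rightarrow> complex) \<Rightarrow> complex"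

definition tempered :: "'d::finite dist set" where
  "tempered = {T.
     (\<forall>\<psi>. \<psi> \<notin> schwartz \<longrightarrow> T \<psi> = 0) \<and>
     (\<forall>\<psi>\<in>schwartz. \<forall>\<eta>\<in>schwartz. \<forall>a b. T (\<lambda>x. a * \<psi> x + b * \<eta> x) = a * T \<psi> + b * T \<eta>) \<and>
     (\<exists>N C. \<forall>\<psi>\<in>schwartz. cmod (T \<psi>) \<le> C * schwartz_seminorm N \<psi>)}"

text \<open>The operations on distributions are the transposes of those on test functions:
  \<open>translate \<alpha> f\<close> is \<open>f(\<cdot> + \<alpha>)\<close> and \<open>dilate h f\<close> is \<open>f(\<cdot>/h)\<close>, for \<open>h > 0\<close>.\<close>

definition fourier :: "(real^'d::finite \<Rightarrow> complex) \<Rightarrow> real^'d \<Rightarrow> complex" where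
  "fourier \<psi> \<omega> = (LINT x|lborel. \<psi> x * exp (- (\<i> * complex_of_real (\<omega> \<bullet> x))))"

definition dist_fourier :: "'d::finite dist \<Rightarrow> 'd dist" where
  "dist_fourier f = (\<lambda>\<psi>. if \<psi> \<in> schwartz then f (fourier \<psi>) else 0)"

definition translate :: "real^'d::finite \<Rightarrow> 'd dist \<Rightarrow> 'd dist" where
  "translate \<alpha> f = (\<lambda>\<psi>. f (\<lambda>x. \<psi> (x - \<alpha>)))"

definition dilate :: "real \<Rightarrow> 'd::finite dist \<Rightarrow> 'd dist" where
  "dilate h f = (\<lambda>\<psi>. complex_of_real h ^ CARD('d) * f (\<lambda>x. \<psi> (h *\<^sub>R x)))"


section \<open>The spaces \<open>W\<^sub>2\<^sup>s\<close>\<close>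

definition locally_L2 :: "(real^'d::finite \<Rightarrow> complex) \<Rightarrow> bool" where
  "locally_L2 u \<longleftrightarrow> u \<in> borel_measurable borel \<and>
     (\<forall>K. compact K \<longrightarrow> (\<integral>\<^sup>+\<omega>\<in>K. ennreal ((cmod (u \<omega>))\<^sup>2) \<partial>lborel) < \<infinity>)"

definition represents :: "(real^'d::finite \<Rightarrow> complex) \<Rightarrow> 'd dist \<Rightarrow> bool" where
  "represents u T \<longleftrightarrow>
     (\<forall>\<psi>\<in>schwartz. integrable lborel (\<lambda>\<omega>. u \<omega> * \<psi> \<omega>) \<and> T \<psi> = (LINT \<omega>|lborel. u \<omega> * \<psi> \<omega>))"

text \<open>The function representing the Fourier transform is unique only up to null sets; \<open>hat f\<close>
  picks one representative, and it is only used where null sets are irrelevant.\<close>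

definition has_hat :: "'d::finite dist \<Rightarrow> (real^'d \<Rightarrow> complex) \<Rightarrow> bool" where
  "has_hat f u \<longleftrightarrow> locally_L2 u \<and> represents u (dist_fourier f)"

definition hat :: "'d::finite dist \<Rightarrow> real^'d \<Rightarrow> complex" where
  "hat f = (SOME u. has_hat f u)"

definition sobolev_energy :: "real \<Rightarrow> 'd::finite dist \<Rightarrow> ennreal" where
  "sobolev_energy s f =
     (\<integral>\<^sup>+\<omega>. ennreal ((1 + norm \<omega>) powr (2 * s) * (cmod (hat f \<omega>))\<^sup>2) \<partial>lborel)"

definition sobolev :: "real \<Rightarrow> 'd::finite dist set" where
  "sobolev s = {f \<in> tempered. (\<exists>u. has_hat f u) \<and> sobolev_energy s f < \<infinity>}"

definition sobolev_norm :: "real \<Rightarrow> 'd::finite dist \<Rightarrow> real" where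
  "sobolev_norm s f = sqrt (enn2real (sobolev_energy s f))"

definition sobolev_dist :: "real \<Rightarrow> 'd::finite dist \<Rightarrow> 'd dist \<Rightarrow> real" where
  "sobolev_dist s f g = sobolev_norm s (\<lambda>\<psi>. f \<psi> - g \<psi>)"


section \<open>Shift-invariant spaces and approximation order\<close>

definition closed_subspace :: "real \<Rightarrow> 'd::finite dist set \<Rightarrow> bool" where
  "closed_subspace s V \<longleftrightarrow> V \<subseteq> sobolev s \<and> (\<lambda>_. 0) \<in> V \<and>
     (\<forall>f\<in>V. \<forall>g\<in>V. \<forall>a b. (\<lambda>\<psi>. a * f \<psi> + b * g \<psi>) \<in> V) \<and>
     (\<forall>F f. (\<forall>n. F n \<in> V) \<and> f \<in> sobolev s \<and> (\<lambda>n. sobolev_dist s (F n) f) \<longlonglongrightarrow> 0 \<longrightarrow> f \<in> V)"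

definition shift_invariant :: "real \<Rightarrow> 'd::finite dist set \<Rightarrow> bool" where
  "shift_invariant h V \<longleftrightarrow> (\<forall>f\<in>V. \<forall>\<alpha>. (\<forall>i. \<alpha> $ i \<in> \<int>) \<longrightarrow> translate (h *\<^sub>R \<alpha>) f \<in> V)"

definition psi_space :: "real \<Rightarrow> 'd::finite dist \<Rightarrow> 'd dist set" where
  "psi_space s \<phi> = \<Inter>{V. closed_subspace s V \<and> shift_invariant 1 V \<and> \<phi> \<in> V}"

definition ladder :: "real \<Rightarrow> (real \<Rightarrow> 'd::finite dist set) \<Rightarrow> bool" where
  "ladder s S \<longleftrightarrow> (\<forall>h>0. closed_subspace s (S h) \<and> shift_invariant h (S h))"

definition provides_approx_order :: "real \<Rightarrow> real \<Rightarrow> (real \<Rightarrow> 'd::finite dist set) \<Rightarrow> bool" where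
  "provides_approx_order s k S \<longleftrightarrow> ladder s S \<and>
     (\<exists>C. \<forall>f\<in>sobolev k. \<forall>h>0.
        (INF g\<in>S h. sobolev_dist s f g) \<le> C * h powr (k - s) * sobolev_norm k f)"


section \<open>Bracket products\<close>

definition dual_lattice :: "(real^'d::finite) set" where
  "dual_lattice = {\<alpha>. \<forall>i. \<exists>n::int. \<alpha> $ i = 2 * pi * of_int n}"

definition bracket :: "real \<Rightarrow> 'd::finite dist \<Rightarrow> real^'d \<Rightarrow> ennreal" where
  "bracket s \<phi> \<omega> =
     (\<Sum>\<^sub>\<infinity>\<alpha>\<in>dual_lattice. ennreal ((cmod (hat \<phi> (\<omega> + \<alpha>)))\<^sup>2 * norm (\<omega> + \<alpha>) powr (2 * s)))"

definition bracket0 :: "real \<Rightarrow> 'd::finite dist \<Rightarrow> real^'d \<Rightarrow> ennreal" where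
  "bracket0 s \<phi> \<omega> =
     (\<Sum>\<^sub>\<infinity>\<alpha>\<in>dual_lattice - {0}. ennreal ((cmod (hat \<phi> (\<omega> + \<alpha>)))\<^sup>2 * norm (\<omega> + \<alpha>) powr (2 * s)))"

definition bracket_h :: "real \<Rightarrow> real \<Rightarrow> 'd::finite dist \<Rightarrow> real^'d \<Rightarrow> ennreal" where
  "bracket_h s h \<phi> \<omega> =
     bracket0 s \<phi> \<omega> + ennreal ((cmod (hat \<phi> \<omega>))\<^sup>2 * ((norm \<omega>)\<^sup>2 + h\<^sup>2) powr s)"

text \<open>In \<^typ>\<open>ennreal\<close> one has \<open>0 / 0 = 0\<close> and \<open>x / \<infinity> = 0\<close>, under which the zero function would
  pass as a generator. A quotient that is undefined is therefore given the value \<open>\<infinity>\<close>, so a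
  quotient with finite essential supremum is defined almost everywhere.\<close>

definition bracket_ratio :: "ennreal \<Rightarrow> ennreal \<Rightarrow> ennreal" where
  "bracket_ratio a b = (if b = 0 \<or> b = \<infinity> then \<infinity> else a / b)"

text \<open>For nonnegative functions. The library's \<open>esssup\<close> is \<open>\<infinity>\<close> for non-measurable functions,
  so finiteness of this value is membership in \<open>L\<^sub>\<infinity>(\<Omega>)\<close>.\<close>

definition Linfty_norm :: "(real^'d::finite) set \<Rightarrow> (real^'d \<Rightarrow> ennreal) \<Rightarrow> ennreal" where
  "Linfty_norm \<Omega> F = esssup (lebesgue_on \<Omega>) F"

end

theory Submission
  imports Defs "HOL-Probability.Characteristic_Functions" "HOL-Probability.Sinc_Integral"
begin

text \<open>
  On the Fourier side the theorem is a statement about weighted \<open>L\<^sub>2\<close> norms. After the dilation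
  \<open>\<xi> = h \<omega>\<close> the norm of \<open>W\<^sub>2\<^sup>s\<close> becomes \<open>L\<^sub>2\<close> with the weight \<open>(h + |\<xi>|)^(2 s)\<close>, up to a power of
  \<open>h\<close>, and the dilated space becomes the fixed space \<open>psi_space s \<phi>\<close>. The Fourier transform of an
  element of that space is a periodic multiple of \<open>hat \<phi>\<close>: its values on each fibre
  \<open>\<xi> + dual_lattice\<close> are proportional to those of \<open>hat \<phi>\<close>. If a target function lives at
  frequencies near the origin, only the entry at the lattice point \<open>0\<close> of its fibres is nonzero,
  so on each fibre the best approximation to it misses a proportion of its energy, namely the
  proportion of the energy of \<open>hat \<phi>\<close> that sits at the other lattice points. This proportion is
  the bracket quotient. High frequencies
  may be dropped altogether: there the \<open>W\<^sub>2\<^sup>s\<close> norm is already smaller than the \<open>W\<^sub>2\<^sup>k\<close> norm by a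
  factor \<open>h powr (k - s)\<close>. Hence order \<open>k\<close> means that the quotient is bounded by a multiple of
  \<open>(|\<xi>|\<^sup>2 + h\<^sup>2)^(k - s)\<close> near the origin.

  Close to the origin such a bound makes the quotient smaller than \<open>1/2\<close>, and it can then be
  multiplied out to \<open>bracket0 \<le> M |hat \<phi>|\<^sup>2 (|\<xi>|\<^sup>2 + h\<^sup>2)^k\<close> together with \<open>hat \<phi> \<noteq> 0\<close>. This is
  \<open>low_frequency_bound\<close>, and both directions are proved for it.

  Sufficiency (\<open>order_of_low_frequency_bound\<close>) needs no projection: dividing the low-frequency part
  of the target by \<open>hat \<phi>\<close> and continuing the result periodically gives a multiplier that
  reproduces the target near the origin and leaves exactly the error controlled by \<open>bracket0\<close>
  (\<open>periodic_error_le\<close>). Trigonometric polynomials, that is, finite combinations of translates of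
  \<open>\<phi>\<close>, approximate this multiplier (\<open>trig_L2_dense\<close>).

  Necessity (\<open>low_frequency_bound_of_order\<close>) tests the approximation order on functions whose
  Fourier transform is the indicator of the set where the bound fails. The proportionality of fibres
  (\<open>psi_space_fibre\<close>) passes to the closed space because it is preserved by limits, and it forces
  an error too large for order \<open>k\<close> (\<open>energy_psi_lower_bound\<close>) unless this set is null.

  In the stationary case the bounds for all small \<open>h\<close> are equivalent to the bound at \<open>h = 0\<close>: let
  \<open>h \<rightarrow> 0\<close> in one direction, and use that \<open>(|\<xi>|\<^sup>2 + h\<^sup>2)^k\<close> increases with \<open>h\<close>, as \<open>k \<ge> 0\<close>, in the
  other.

  Two facts about tempered distributions support this: the function representing a Fourier
  transform is determined almost everywhere (\<open>schwartz_separates\<close>), and Fourier inversion on the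
  Schwartz space provides distributions with prescribed Fourier transform (\<open>has_hat_surj\<close>).
\<close>

section \<open>Schwartz functions\<close>

lemma partials_Nil [simp]: "partials [] f = f"
  and partials_Cons [simp]: "partials (i # ds) f = partial i (partials ds f)"
  and partials_snoc: "partials (ds @ [i]) f = partials ds (partial i f)"
  by (simp_all add: partials_def)

lemma partial_eq:
  assumes "(f has_derivative f') (at x)"
  shows "partial i f x = f' (axis i 1)"
  unfolding partial_def frechet_derivative_at[OF assms, symmetric] ..

text \<open>The bound is stated for all \<open>N\<close> at once, so that membership in \<open>schwartz\<close> reads:
  every iterated partial derivative is differentiable and rapidly decreasing.\<close>

definition rapid :: "(real^'d::finite \<Rightarrow> complex) \<Rightarrow> bool" where
  "rapid f \<longleftrightarrow> (\<forall>N. \<exists>C. \<forall>x. (1 + norm x) ^ N * cmod (f x) \<le> C)"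

lemma rapid_iff_bounded:
  "rapid f \<longleftrightarrow> (\<forall>N::nat. bounded (range (\<lambda>x. (1 + norm x) ^ N *\<^sub>R f x)))"
  by (auto simp: rapid_def bounded_iff)

lemma schwartz_iff: "f \<in> schwartz \<longleftrightarrow>
    (\<forall>ds. (\<forall>x. partials ds f differentiable (at x)) \<and> rapid (partials ds f))"
  unfolding schwartz_def rapid_iff_bounded by simp

text \<open>A set of rapidly decreasing differentiable functions that is closed under the partial
  derivatives contains all iterated partial derivatives of its members. All closure properties of
  the Schwartz space below come from a suitable choice of \<open>X\<close>, which replaces product rules for
  multi-indices.\<close>

lemma schwartz_coinduct:
  assumes "f \<in> X"
    and "\<And>f. f \<in> X \<Longrightarrow> (\<forall>x. f differentiable (at x)) \<and> rapid f \<and> (\<forall>i. partial i f \<in> X)"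
  shows "f \<in> schwartz"
proof -
  have "partials ds f \<in> X" for ds
    by (induction ds) (use assms in auto)
  then show ?thesis using assms(2) by (auto simp: schwartz_iff)
qed

lemma schwartz_differentiable: "f \<in> schwartz \<Longrightarrow> f differentiable (at x)"
  and schwartz_rapid: "f \<in> schwartz \<Longrightarrow> rapid f"
  unfolding schwartz_iff by (metis partials_Nil)+

lemma schwartz_partial: "f \<in> schwartz \<Longrightarrow> partial i f \<in> schwartz"
  unfolding schwartz_iff by (metis partials_snoc)

lemma schwartz_partials: "f \<in> schwartz \<Longrightarrow> partials ds f \<in> schwartz"
  by (induction ds) (auto intro: schwartz_partial)

lemma rapidD:
  fixes f :: "real^'d::finite \<Rightarrow> complex"
  assumes "rapid f"
  obtains C where "C \<ge> 0" "\<And>x. (1 + norm x) ^ N * cmod (f x) \<le> C"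
proof -
  obtain C where C: "\<And>x. (1 + norm x) ^ N * cmod (f x) \<le> C"
    using assms by (auto simp: rapid_def)
  have "0 \<le> (1 + norm (0 :: real^'d)) ^ N * cmod (f 0)" by simp
  then have "C \<ge> 0" using C[of 0] by linarith
  then show ?thesis using C that by blast
qed

lemma rapid_lin:
  assumes "rapid f" "rapid g"
  shows "rapid (\<lambda>x. a * f x + b * g x)"
  unfolding rapid_def
proof
  fix N
  obtain C where C: "C \<ge> 0" "\<And>x. (1 + norm x) ^ N * cmod (f x) \<le> C" using assms(1) rapidD by metis
  obtain D where D: "D \<ge> 0" "\<And>x. (1 + norm x) ^ N * cmod (g x) \<le> D" using assms(2) rapidD by metis
  have "(1 + norm x) ^ N * cmod (a * f x + b * g x) \<le> cmod a * C + cmod b * D" for x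
  proof -
    have "(1 + norm x) ^ N * cmod (a * f x + b * g x)
        \<le> (1 + norm x) ^ N * (cmod a * cmod (f x) + cmod b * cmod (g x))"
      by (intro mult_left_mono) (auto intro: order_trans[OF norm_triangle_ineq] simp: norm_mult)
    also have "\<dots> = cmod a * ((1 + norm x) ^ N * cmod (f x)) + cmod b * ((1 + norm x) ^ N * cmod (g x))"
      by (simp add: algebra_simps)
    also have "\<dots> \<le> cmod a * C + cmod b * D"
      using C D by (intro add_mono mult_left_mono) auto
    finally show ?thesis .
  qed
  then show "\<exists>C. \<forall>x. (1 + norm x) ^ N * cmod (a * f x + b * g x) \<le> C" by blast
qed

lemma rapid_dominated:
  assumes "rapid f" "\<And>x. cmod (g x) \<le> C * (1 + norm x) ^ m * cmod (f x)"
  shows "rapid g"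
  unfolding rapid_def
proof
  fix N
  obtain D where D: "D \<ge> 0" "\<And>x. (1 + norm x) ^ (N + m) * cmod (f x) \<le> D"
    using assms(1) rapidD by metis
  have "(1 + norm x) ^ N * cmod (g x) \<le> \<bar>C\<bar> * D" for x
  proof -
    have "(1 + norm x) ^ N * cmod (g x) \<le> (1 + norm x) ^ N * (\<bar>C\<bar> * ((1 + norm x) ^ m * cmod (f x)))"
    proof (intro mult_left_mono)
      have "C * ((1 + norm x) ^ m * cmod (f x)) \<le> \<bar>C\<bar> * ((1 + norm x) ^ m * cmod (f x))"
        by (intro mult_right_mono) auto
      then show "cmod (g x) \<le> \<bar>C\<bar> * ((1 + norm x) ^ m * cmod (f x))"
        using assms(2)[of x] by (simp add: mult.assoc)
    qed simp
    also have "\<dots> = \<bar>C\<bar> * ((1 + norm x) ^ (N + m) * cmod (f x))"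
      by (simp add: power_add)
    also have "\<dots> \<le> \<bar>C\<bar> * D" using D by (intro mult_left_mono) auto
    finally show ?thesis .
  qed
  then show "\<exists>C. \<forall>x. (1 + norm x) ^ N * cmod (g x) \<le> C" by blast
qed

lemma partial_lin:
  assumes "f differentiable (at x)" "g differentiable (at x)"
  shows "(\<lambda>x. a * f x + b * g x) differentiable (at x)"
    and "partial i (\<lambda>x. a * f x + b * g x) x = a * partial i f x + b * partial i g x"
proof -
  have f: "(f has_derivative frechet_derivative f (at x)) (at x)"
    and g: "(g has_derivative frechet_derivative g (at x)) (at x)"
    using assms frechet_derivative_works by auto
  have *: "((\<lambda>x. a * f x + b * g x) has_derivative
      (\<lambda>h. a * frechet_derivative f (at x) h + b * frechet_derivative g (at x) h)) (at x)"
    by (auto intro!: derivative_eq_intros f g)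
  show "(\<lambda>x. a * f x + b * g x) differentiable (at x)" using * differentiableI by blast
  show "partial i (\<lambda>x. a * f x + b * g x) x = a * partial i f x + b * partial i g x"
    by (subst partial_eq[OF *]) (simp add: partial_def)
qed

lemma schwartz_lin:
  assumes "f \<in> schwartz" "g \<in> schwartz"
  shows "(\<lambda>x. a * f x + b * g x) \<in> schwartz"
proof (rule schwartz_coinduct)
  show "(\<lambda>x. a * f x + b * g x) \<in> {\<lambda>x. a * f x + b * g x | f g. f \<in> schwartz \<and> g \<in> schwartz}"
    using assms by auto
next
  fix F assume "F \<in> {\<lambda>x. a * f x + b * g x | f g. f \<in> schwartz \<and> g \<in> schwartz}"
  then obtain f g where F: "F = (\<lambda>x. a * f x + b * g x)" and fg: "f \<in> schwartz" "g \<in> schwartz"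
    by auto
  have "partial i F = (\<lambda>x. a * partial i f x + b * partial i g x)" for i
    unfolding F by (rule ext, rule partial_lin) (auto intro: schwartz_differentiable fg)
  then show "(\<forall>x. F differentiable (at x)) \<and> rapid F \<and>
      (\<forall>i. partial i F \<in> {\<lambda>x. a * f x + b * g x | f g. f \<in> schwartz \<and> g \<in> schwartz})"
    using fg schwartz_partial unfolding F
    by (intro conjI allI partial_lin(1) rapid_lin schwartz_differentiable schwartz_rapid) blast+
qed

lemma schwartz_cmult: "f \<in> schwartz \<Longrightarrow> (\<lambda>x. a * f x) \<in> schwartz"
  and schwartz_add: "f \<in> schwartz \<Longrightarrow> g \<in> schwartz \<Longrightarrow> (\<lambda>x. f x + g x) \<in> schwartz"
  using schwartz_lin[of f f a 0] schwartz_lin[of f g 1 1] by simp_all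

lemma partial_coord:
  assumes "f differentiable (at x)"
  shows "(\<lambda>x. complex_of_real (x $ j) * f x) differentiable (at x)"
    and "partial i (\<lambda>x. complex_of_real (x $ j) * f x) x =
      (if i = j then 1 else 0) * f x + complex_of_real (x $ j) * partial i f x"
proof -
  have f: "(f has_derivative frechet_derivative f (at x)) (at x)"
    using assms frechet_derivative_works by auto
  have c: "((\<lambda>x. complex_of_real (x $ j)) has_derivative (\<lambda>h. complex_of_real (h $ j))) (at x)"
    by (intro bounded_linear_imp_has_derivative bounded_linear_compose[OF bounded_linear_of_real]
        bounded_linear_vec_nth)
  have *: "((\<lambda>x. complex_of_real (x $ j) * f x) has_derivative
      (\<lambda>h. complex_of_real (x $ j) * frechet_derivative f (at x) h + complex_of_real (h $ j) * f x)) (at x)"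
    by (rule has_derivative_mult[OF c f])
  show "(\<lambda>x. complex_of_real (x $ j) * f x) differentiable (at x)" using * differentiableI by blast
  show "partial i (\<lambda>x. complex_of_real (x $ j) * f x) x =
      (if i = j then 1 else 0) * f x + complex_of_real (x $ j) * partial i f x"
    by (subst partial_eq[OF *]) (simp add: partial_def, simp add: axis_def)
qed

text \<open>A derivative of \<open>x\<^sub>j f\<close> produces the extra term \<open>f\<close>; the set of all \<open>x\<^sub>j f + g\<close> absorbs it.\<close>

lemma schwartz_coord:
  assumes "f \<in> schwartz"
  shows "(\<lambda>x. complex_of_real (x $ j) * f x) \<in> schwartz"
proof -
  let ?X = "{\<lambda>x. complex_of_real (x $ j) * f x + g x | f g. f \<in> schwartz \<and> g \<in> schwartz}"
  have "(\<lambda>x. complex_of_real (x $ j) * f x + 0 * f x) \<in> schwartz"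
  proof (rule schwartz_coinduct[where X = ?X])
    have "(\<lambda>x. 0 * f x) \<in> schwartz" using assms by (rule schwartz_cmult)
    then show "(\<lambda>x. complex_of_real (x $ j) * f x + 0 * f x) \<in> ?X"
      using assms unfolding mem_Collect_eq by (intro exI[of _ f] exI[of _ "\<lambda>x. 0 * f x"]) simp
  next
    fix F assume "F \<in> ?X"
    then obtain f g where F: "F = (\<lambda>x. complex_of_real (x $ j) * f x + g x)"
      and fg: "f \<in> schwartz" "g \<in> schwartz" by auto
    have D: "(\<lambda>x. complex_of_real (x $ j) * f x) differentiable (at x)" for x
      by (rule partial_coord) (auto intro: schwartz_differentiable fg)
    have "partial i F = (\<lambda>x. complex_of_real (x $ j) * partial i f x +
        ((if i = j then 1 else 0) * f x + partial i g x))" for i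
      unfolding F using partial_lin(2)[OF D, of g, where a = 1 and b = 1]
      by (auto simp: schwartz_differentiable fg partial_coord intro!: ext)
    moreover have "(\<lambda>x. ((if i = j then 1 else 0) * f x + partial i g x)) \<in> schwartz" for i
      using schwartz_lin[OF fg(1) schwartz_partial[OF fg(2)], of "if i = j then 1 else 0" 1 i] by simp
    ultimately have "partial i F \<in> ?X" for i
      unfolding mem_Collect_eq using schwartz_partial[OF fg(1), of i]
      by (intro exI[of _ "partial i f"] exI conjI) assumption
    moreover have "F differentiable (at x)" for x
      unfolding F by (intro differentiable_add D schwartz_differentiable fg)
    moreover have "rapid F"
    proof -
      have "rapid (\<lambda>x. complex_of_real (x $ j) * f x)"
      proof (rule rapid_dominated[OF schwartz_rapid[OF fg(1)], of _ 1 1])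
        fix x :: "real^'a"
        have "\<bar>x $ j\<bar> \<le> 1 + norm x" using component_le_norm_cart[of x j] by linarith
        then show "cmod (complex_of_real (x $ j) * f x) \<le> 1 * (1 + norm x) ^ 1 * cmod (f x)"
          by (simp add: norm_mult mult_right_mono)
      qed
      from rapid_lin[OF this schwartz_rapid[OF fg(2)], of 1 1] show ?thesis by (simp add: F)
    qed
    ultimately show "(\<forall>x. F differentiable (at x)) \<and> rapid F \<and> (\<forall>i. partial i F \<in> ?X)" by blast
  qed
  then show ?thesis by simp
qed

lemma has_derivative_cis_inner:
  "((\<lambda>x. cis (\<alpha> \<bullet> x)) has_derivative (\<lambda>h. \<i> * complex_of_real (\<alpha> \<bullet> h) * cis (\<alpha> \<bullet> x))) (at x)"
proof -
  have "(cis has_vector_derivative \<i> * cis (\<alpha> \<bullet> x)) (at (\<alpha> \<bullet> x))"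
    unfolding cis_conv_exp
    by (rule has_vector_derivative_real_field) (auto intro!: derivative_eq_intros)
  then have "(cis has_derivative (\<lambda>h. h *\<^sub>R (\<i> * cis (\<alpha> \<bullet> x)))) (at (\<alpha> \<bullet> x))"
    by (simp add: has_vector_derivative_def)
  moreover have "((\<lambda>x. \<alpha> \<bullet> x) has_derivative (\<lambda>h. \<alpha> \<bullet> h)) (at x)"
    by (rule bounded_linear_imp_has_derivative[OF bounded_linear_inner_right])
  ultimately have "((\<lambda>x. cis (\<alpha> \<bullet> x)) has_derivative (\<lambda>h. (\<alpha> \<bullet> h) *\<^sub>R (\<i> * cis (\<alpha> \<bullet> x)))) (at x)"
    using has_derivative_compose by fast
  then show ?thesis by (simp add: scaleR_conv_of_real[where 'a=complex] mult_ac)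
qed

lemma partial_cis:
  assumes "f differentiable (at x)"
  shows "(\<lambda>x. cis (\<alpha> \<bullet> x) * f x) differentiable (at x)"
    and "partial i (\<lambda>x. cis (\<alpha> \<bullet> x) * f x) x =
      cis (\<alpha> \<bullet> x) * (\<i> * complex_of_real (\<alpha> $ i) * f x + 1 * partial i f x)"
proof -
  have f: "(f has_derivative frechet_derivative f (at x)) (at x)"
    using assms frechet_derivative_works by auto
  note * = has_derivative_mult[OF has_derivative_cis_inner[of \<alpha> x] f]
  show "(\<lambda>x. cis (\<alpha> \<bullet> x) * f x) differentiable (at x)" using * differentiableI by blast
  show "partial i (\<lambda>x. cis (\<alpha> \<bullet> x) * f x) x =
      cis (\<alpha> \<bullet> x) * (\<i> * complex_of_real (\<alpha> $ i) * f x + 1 * partial i f x)"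
    by (subst partial_eq[OF *]) (simp add: partial_def inner_axis algebra_simps)
qed

lemma schwartz_cis:
  assumes "f \<in> schwartz"
  shows "(\<lambda>x. cis (\<alpha> \<bullet> x) * f x) \<in> schwartz"
proof (rule schwartz_coinduct)
  show "(\<lambda>x. cis (\<alpha> \<bullet> x) * f x) \<in> {\<lambda>x. cis (\<alpha> \<bullet> x) * f x | f. f \<in> schwartz}"
    using assms by auto
next
  fix F assume "F \<in> {\<lambda>x. cis (\<alpha> \<bullet> x) * f x | f. f \<in> schwartz}"
  then obtain f where F: "F = (\<lambda>x. cis (\<alpha> \<bullet> x) * f x)" and f: "f \<in> schwartz" by auto
  have "partial i F = (\<lambda>x. cis (\<alpha> \<bullet> x) * (\<i> * complex_of_real (\<alpha> $ i) * f x + 1 * partial i f x))" for i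
    unfolding F by (rule ext, rule partial_cis) (rule schwartz_differentiable[OF f])
  moreover have "(\<lambda>x. \<i> * complex_of_real (\<alpha> $ i) * f x + 1 * partial i f x) \<in> schwartz" for i
    by (intro schwartz_lin f schwartz_partial)
  ultimately have "\<forall>i. partial i F \<in> {\<lambda>x. cis (\<alpha> \<bullet> x) * f x | f. f \<in> schwartz}" by auto
  moreover have "rapid F"
    unfolding F by (rule rapid_dominated[OF schwartz_rapid[OF f], of _ 1 0]) (simp add: norm_mult)
  moreover have "F differentiable (at x)" for x
    unfolding F by (rule partial_cis(1)[OF schwartz_differentiable[OF f]])
  ultimately show "(\<forall>x. F differentiable (at x)) \<and> rapid F \<and>
      (\<forall>i. partial i F \<in> {\<lambda>x. cis (\<alpha> \<bullet> x) * f x | f. f \<in> schwartz})"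
    by blast
qed

lemma partial_affine:
  assumes "\<And>x. f differentiable (at x)"
  shows "(\<lambda>x. f (h *\<^sub>R x + \<alpha>)) differentiable (at x)"
    and "partial i (\<lambda>x. f (h *\<^sub>R x + \<alpha>)) x = complex_of_real h * partial i f (h *\<^sub>R x + \<alpha>)"
proof -
  have f: "(f has_derivative frechet_derivative f (at (h *\<^sub>R x + \<alpha>))) (at (h *\<^sub>R x + \<alpha>))"
    using assms frechet_derivative_works by auto
  then interpret f: bounded_linear "frechet_derivative f (at (h *\<^sub>R x + \<alpha>))"
    by (rule has_derivative_bounded_linear)
  have "((\<lambda>x. h *\<^sub>R x + \<alpha>) has_derivative (\<lambda>v. h *\<^sub>R v)) (at x)"
    by (auto intro!: derivative_eq_intros)
  from has_derivative_compose[OF this f]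
  have *: "((\<lambda>x. f (h *\<^sub>R x + \<alpha>)) has_derivative
      (\<lambda>v. frechet_derivative f (at (h *\<^sub>R x + \<alpha>)) (h *\<^sub>R v))) (at x)" by simp
  show "(\<lambda>x. f (h *\<^sub>R x + \<alpha>)) differentiable (at x)" using * differentiableI by blast
  show "partial i (\<lambda>x. f (h *\<^sub>R x + \<alpha>)) x = complex_of_real h * partial i f (h *\<^sub>R x + \<alpha>)"
    by (subst partial_eq[OF *]) (simp add: partial_def f.scaleR, simp add: scaleR_conv_of_real)
qed

lemma partials_affine:
  assumes "f \<in> schwartz"
  shows "partials ds (\<lambda>x. f (h *\<^sub>R x + \<alpha>)) =
    (\<lambda>x. complex_of_real h ^ length ds * partials ds f (h *\<^sub>R x + \<alpha>))"
proof (induction ds)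
  case (Cons i ds)
  have D: "partials ds f differentiable (at x)" for x
    by (rule schwartz_differentiable[OF schwartz_partials[OF assms]])
  show ?case
    unfolding partials_Cons Cons
    using partial_lin(2)[OF partial_affine(1)[OF D] partial_affine(1)[OF D],
        where a = "complex_of_real h ^ length ds" and i = i and b = 0]
    by (auto simp: partial_affine(2)[OF D] intro!: ext)
qed simp

lemma one_plus_norm_affine_le:
  assumes "h \<noteq> 0"
  shows "1 + norm x \<le> (1 + 1 / \<bar>h\<bar>) * (1 + norm \<alpha>) * (1 + norm (h *\<^sub>R x + \<alpha>))"
proof -
  have "norm x = norm ((h *\<^sub>R x + \<alpha>) - \<alpha>) / \<bar>h\<bar>" using assms by simp
  also have "\<dots> \<le> (norm (h *\<^sub>R x + \<alpha>) + norm \<alpha>) / \<bar>h\<bar>"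
    by (intro divide_right_mono norm_triangle_ineq4) simp
  finally have "1 + norm x \<le> 1 + (norm (h *\<^sub>R x + \<alpha>) + norm \<alpha>) * (1 / \<bar>h\<bar>)" by simp
  also have "\<dots> \<le> 1 + (norm (h *\<^sub>R x + \<alpha>) + norm \<alpha>) * (1 / \<bar>h\<bar>) +
     (1 / \<bar>h\<bar> + norm (h *\<^sub>R x + \<alpha>) + norm \<alpha> + (1 + 1 / \<bar>h\<bar>) * (norm (h *\<^sub>R x + \<alpha>) * norm \<alpha>))"
    by simp
  also have "\<dots> = (1 + 1 / \<bar>h\<bar>) * (1 + norm \<alpha>) * (1 + norm (h *\<^sub>R x + \<alpha>))"
    by (simp add: algebra_simps add_divide_distrib)
  finally show ?thesis .
qed

lemma weighted_affine_le:
  assumes "h \<noteq> 0"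
  shows "(1 + norm x) ^ N * cmod (f (h *\<^sub>R x + \<alpha>)) \<le>
    ((1 + 1 / \<bar>h\<bar>) * (1 + norm \<alpha>)) ^ N * ((1 + norm (h *\<^sub>R x + \<alpha>)) ^ N * cmod (f (h *\<^sub>R x + \<alpha>)))"
proof -
  have "(1 + norm x) ^ N \<le> ((1 + 1 / \<bar>h\<bar>) * (1 + norm \<alpha>) * (1 + norm (h *\<^sub>R x + \<alpha>))) ^ N"
    by (intro power_mono one_plus_norm_affine_le assms) simp
  then show ?thesis unfolding power_mult_distrib mult.assoc[symmetric]
    by (rule mult_right_mono) simp
qed

text \<open>An affine substitution commutes with partial derivatives up to powers of \<open>h\<close>, and changes
  the weight \<open>1 + |x|\<close> at most by a factor.\<close>

lemma schwartz_affine: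
  assumes "f \<in> schwartz" "h \<noteq> 0"
  shows "(\<lambda>x. f (h *\<^sub>R x + \<alpha>)) \<in> schwartz"
  unfolding schwartz_iff partials_affine[OF assms(1)]
proof (intro allI conjI)
  fix ds x
  show "(\<lambda>x. complex_of_real h ^ length ds * partials ds f (h *\<^sub>R x + \<alpha>)) differentiable (at x)"
    by (intro differentiable_mult differentiable_const partial_affine(1)
        schwartz_differentiable[OF schwartz_partials[OF assms(1)]])
next
  fix ds
  have "rapid (\<lambda>x. partials ds f (h *\<^sub>R x + \<alpha>))"
    unfolding rapid_def
  proof
    fix N
    obtain C where C: "C \<ge> 0" "\<And>x. (1 + norm x) ^ N * cmod (partials ds f x) \<le> C"
      using schwartz_rapid[OF schwartz_partials[OF assms(1)]] rapidD by metis
    have "(1 + norm x) ^ N * cmod (partials ds f (h *\<^sub>R x + \<alpha>)) \<le>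
       ((1 + 1 / \<bar>h\<bar>) * (1 + norm \<alpha>)) ^ N * C" for x
      by (rule order_trans[OF weighted_affine_le[OF assms(2)]], rule mult_left_mono) (use C in auto)
    then show "\<exists>C. \<forall>x. (1 + norm x) ^ N * cmod (partials ds f (h *\<^sub>R x + \<alpha>)) \<le> C" by blast
  qed
  from rapid_lin[OF this this, of _ 0]
  show "rapid (\<lambda>x. complex_of_real h ^ length ds * partials ds f (h *\<^sub>R x + \<alpha>))" by simp
qed

lemma schwartz_affine_iff:
  assumes "h \<noteq> 0"
  shows "(\<lambda>x. f (h *\<^sub>R x + \<alpha>)) \<in> schwartz \<longleftrightarrow> f \<in> schwartz"
proof
  assume "(\<lambda>x. f (h *\<^sub>R x + \<alpha>)) \<in> schwartz"
  from schwartz_affine[OF this, of "1/h" "- (1/h) *\<^sub>R \<alpha>"] assms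
  show "f \<in> schwartz" by (simp add: algebra_simps)
qed (rule schwartz_affine[OF _ assms])

subsection \<open>Seminorms\<close>

lemma finite_lists_bounded: "finite {ds :: 'd::finite list. length ds \<le> N}"
  using finite_lists_length_le[of "UNIV :: 'd set" N] by simp

lemma bdd_above_seminorm:
  fixes f :: "real^'d::finite \<Rightarrow> complex"
  assumes "f \<in> schwartz"
  shows "bdd_above ((\<lambda>(x, ds). (1 + norm x) ^ N * cmod (partials ds f x)) ` (UNIV \<times> {ds. length ds \<le> N}))"
proof -
  have "\<exists>C. \<forall>x. (1 + norm x) ^ N * cmod (partials ds f x) \<le> C" for ds
    using schwartz_rapid[OF schwartz_partials[OF assms]] by (auto simp: rapid_def)
  then obtain C where C: "\<And>ds x. (1 + norm x) ^ N * cmod (partials ds f x) \<le> C ds" by metis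
  have "C ds \<le> Max (C ` {ds :: 'd list. length ds \<le> N})" if "length ds \<le> N" for ds
    using that by (intro Max_ge finite_imageI finite_lists_bounded) auto
  then show ?thesis
    by (intro bdd_aboveI2[where M = "Max (C ` {ds :: 'd list. length ds \<le> N})"])
      (auto intro: order_trans[OF C])
qed

lemma seminorm_upper:
  assumes "f \<in> schwartz" "length ds \<le> N"
  shows "(1 + norm x) ^ N * cmod (partials ds f x) \<le> schwartz_seminorm N f"
  unfolding schwartz_seminorm_def
  by (rule cSUP_upper2[OF bdd_above_seminorm[OF assms(1)], of "(x, ds)"]) (use assms in auto)

lemma seminorm_least:
  assumes "\<And>x ds. length ds \<le> N \<Longrightarrow> (1 + norm x) ^ N * cmod (partials ds f x) \<le> C"
  shows "schwartz_seminorm N f \<le> C"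
  unfolding schwartz_seminorm_def
  by (rule cSUP_least) (use assms in \<open>auto intro: exI[of _ "[]"]\<close>)

lemma seminorm_nonneg:
  assumes "f \<in> schwartz"
  shows "0 \<le> schwartz_seminorm N f"
  using seminorm_upper[OF assms, of "[]" N 0] by (simp add: order_trans[OF norm_ge_zero])

lemma seminorm_mono:
  fixes f :: "real^'d::finite \<Rightarrow> complex"
  assumes "f \<in> schwartz" "M \<le> N"
  shows "schwartz_seminorm M f \<le> schwartz_seminorm N f"
proof (rule seminorm_least)
  fix x :: "real^'d" and ds :: "'d list" assume "length ds \<le> M"
  then have "(1 + norm x) ^ N * cmod (partials ds f x) \<le> schwartz_seminorm N f"
    using assms by (intro seminorm_upper) auto
  moreover have "(1 + norm x) ^ M * cmod (partials ds f x) \<le> (1 + norm x) ^ N * cmod (partials ds f x)"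
    using assms by (intro mult_right_mono power_increasing) auto
  ultimately show "(1 + norm x) ^ M * cmod (partials ds f x) \<le> schwartz_seminorm N f" by linarith
qed

lemma seminorm_affine:
  fixes f :: "real^'d::finite \<Rightarrow> complex"
  assumes "f \<in> schwartz" "h \<noteq> 0"
  shows "schwartz_seminorm N (\<lambda>x. f (h *\<^sub>R x + \<alpha>)) \<le>
    (1 + \<bar>h\<bar>) ^ N * ((1 + 1 / \<bar>h\<bar>) * (1 + norm \<alpha>)) ^ N * schwartz_seminorm N f"
proof (rule seminorm_least)
  fix x :: "real^'d" and ds :: "'d list" assume ds: "length ds \<le> N"
  have "(1 + norm x) ^ N * cmod (partials ds (\<lambda>x. f (h *\<^sub>R x + \<alpha>)) x) =
      \<bar>h\<bar> ^ length ds * ((1 + norm x) ^ N * cmod (partials ds f (h *\<^sub>R x + \<alpha>)))"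
    by (simp add: partials_affine[OF assms(1)] norm_mult norm_power)
  also have "\<dots> \<le> (1 + \<bar>h\<bar>) ^ N * (((1 + 1 / \<bar>h\<bar>) * (1 + norm \<alpha>)) ^ N * schwartz_seminorm N f)"
  proof (rule mult_mono)
    have "\<bar>h\<bar> ^ length ds \<le> (1 + \<bar>h\<bar>) ^ length ds" by (intro power_mono) auto
    also have "\<dots> \<le> (1 + \<bar>h\<bar>) ^ N" using ds by (intro power_increasing) auto
    finally show "\<bar>h\<bar> ^ length ds \<le> (1 + \<bar>h\<bar>) ^ N" .
    show "(1 + norm x) ^ N * cmod (partials ds f (h *\<^sub>R x + \<alpha>)) \<le>
        ((1 + 1 / \<bar>h\<bar>) * (1 + norm \<alpha>)) ^ N * schwartz_seminorm N f"
      by (rule order_trans[OF weighted_affine_le[OF assms(2)]], rule mult_left_mono)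
        (use seminorm_upper[OF assms(1) ds] in auto)
  qed auto
  finally show "(1 + norm x) ^ N * cmod (partials ds (\<lambda>x. f (h *\<^sub>R x + \<alpha>)) x) \<le>
     (1 + \<bar>h\<bar>) ^ N * ((1 + 1 / \<bar>h\<bar>) * (1 + norm \<alpha>)) ^ N * schwartz_seminorm N f"
    by (simp add: mult.assoc)
qed

section \<open>Lebesgue measure under affine maps and on products\<close>

lemma nn_integral_lborel_affine:
  fixes f :: "'a::euclidean_space \<Rightarrow> ennreal"
  assumes [measurable]: "f \<in> borel_measurable borel" and c: "c \<noteq> 0"
  shows "(\<integral>\<^sup>+x. f x \<partial>lborel) = ennreal (\<bar>c\<bar> ^ DIM('a)) * (\<integral>\<^sup>+x. f (t + c *\<^sub>R x) \<partial>lborel)"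
  by (subst lborel_affine[OF c, of t])
     (simp add: nn_integral_density nn_integral_distr nn_integral_cmult)

lemma integrable_lborel_affine:
  fixes f :: "'a::euclidean_space \<Rightarrow> 'b::{banach, second_countable_topology}"
  assumes f: "integrable lborel f" and c: "c \<noteq> 0"
  shows "integrable lborel (\<lambda>x. f (t + c *\<^sub>R x))"
  using f f[THEN borel_measurable_integrable] c unfolding integrable_iff_bounded
  by (subst (asm) nn_integral_lborel_affine[where c=c and t=t])
    (auto simp: ennreal_mult_less_top ennreal_power[symmetric] ennreal_zero_less_mult_iff)

lemma integral_lborel_affine:
  fixes f :: "'a::euclidean_space \<Rightarrow> 'b::{banach, second_countable_topology}"
  assumes [measurable]: "f \<in> borel_measurable borel" and c: "c \<noteq> 0"
  shows "(\<integral>x. f x \<partial>lborel) = (\<bar>c\<bar> ^ DIM('a)) *\<^sub>R (\<integral>x. f (t + c *\<^sub>R x) \<partial>lborel)"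
proof -
  have "(\<integral>x. f x \<partial>lborel) =
      (\<integral>x. f x \<partial>density (distr lborel borel (\<lambda>x. t + c *\<^sub>R x)) (\<lambda>_. ennreal (\<bar>c\<bar> ^ DIM('a))))"
    by (subst lborel_affine[OF c, of t]) simp
  also have "\<dots> = (\<bar>c\<bar> ^ DIM('a)) *\<^sub>R (\<integral>x. f (t + c *\<^sub>R x) \<partial>lborel)"
    by (subst integral_density) (simp_all add: integral_distr)
  finally show ?thesis .
qed

text \<open>Relations that hold almost everywhere can be moved along the dual lattice; this is how
  statements about functions become statements about fibres.\<close>

lemma AE_lborel_affine:
  fixes t :: "'a::euclidean_space"
  assumes "AE x in lborel. P x" and c: "c \<noteq> 0"
  shows "AE x in lborel. P (t + c *\<^sub>R x)"
proof -
  obtain N where N: "{x \<in> space lborel. \<not> P x} \<subseteq> N" "N \<in> null_sets lborel"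
    using assms(1) by (auto elim!: AE_E simp: null_sets_def)
  then have [measurable]: "N \<in> sets borel" by auto
  have "0 = (\<integral>\<^sup>+x. indicator N x \<partial>(lborel :: 'a measure))" using N by (simp add: null_sets_def)
  also have "\<dots> = ennreal (\<bar>c\<bar> ^ DIM('a)) * (\<integral>\<^sup>+x. indicator N (t + c *\<^sub>R x) \<partial>(lborel :: 'a measure))"
    by (rule nn_integral_lborel_affine[OF _ c]) measurable
  finally have "(\<integral>\<^sup>+x. indicator N (t + c *\<^sub>R x) \<partial>(lborel :: 'a measure)) = (0 :: ennreal)"
    using c by simp
  then have "AE x in lborel. indicator N (t + c *\<^sub>R x) = (0 :: ennreal)"
    by (subst (asm) nn_integral_0_iff_AE) auto
  then show ?thesis using N(1) by (auto simp: indicator_def split: if_splits)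
qed

lemma
  fixes f :: "'a::euclidean_space \<Rightarrow> real \<Rightarrow> complex"
  assumes f: "\<And>b. b \<in> Basis \<Longrightarrow> integrable lborel (f b)"
  shows integrable_lborel_prod: "integrable lborel (\<lambda>x::'a. \<Prod>b\<in>Basis. f b (x \<bullet> b))"
    and integral_lborel_prod: "(LINT x|(lborel :: 'a measure). (\<Prod>b\<in>Basis. f b (x \<bullet> b))) = (\<Prod>b\<in>Basis. \<integral>t. f b t \<partial>lborel)"
proof -
  interpret product_sigma_finite "\<lambda>_::'a. lborel :: real measure" ..
  have [measurable]: "f b \<in> borel_measurable borel" if "b \<in> Basis" for b
    using borel_measurable_integrable[OF f[OF that]] by simp
  have m: "(\<lambda>x::'a. \<Prod>b\<in>Basis. f b (x \<bullet> b)) \<in> borel_measurable borel"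
    by (intro borel_measurable_prod) measurable
  have *: "(\<Prod>b\<in>Basis. f b ((\<Sum>b'\<in>Basis. g b' *\<^sub>R b') \<bullet> b)) = (\<Prod>b\<in>Basis. f b (g b))" for g
    by (intro prod.cong refl) simp
  show "integrable lborel (\<lambda>x::'a. \<Prod>b\<in>Basis. f b (x \<bullet> b))"
    using product_integrable_prod[OF finite_Basis f] m
    by (subst lborel_eq) (simp add: integrable_distr_eq)
  show "(LINT x|(lborel :: 'a measure). (\<Prod>b\<in>Basis. f b (x \<bullet> b))) = (\<Prod>b\<in>Basis. \<integral>t. f b t \<partial>lborel)"
    using product_integral_prod[OF finite_Basis f] m
    by (subst lborel_eq) (simp add: integral_distr)
qed

text \<open>The integrand is dominated by the product of the integrable functions \<open>1 / (1 + t\<^sup>2)\<close>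
  of the single coordinates.\<close>

lemma integrable_inverse_polynomial:
  "integrable lborel (\<lambda>x::'a::euclidean_space. complex_of_real (1 / (1 + norm x) ^ (2 * DIM('a))))"
proof (rule Bochner_Integration.integrable_bound)
  have "integrable lborel (\<lambda>t::real. inverse (1 + t\<^sup>2))"
    using integrable_inverse_1_plus_square by (simp add: set_integrable_def)
  then have "integrable lborel (\<lambda>t::real. complex_of_real (inverse (1 + t\<^sup>2)))"
    by (rule integrable_of_real)
  then show "integrable lborel (\<lambda>x::'a. \<Prod>b\<in>Basis. complex_of_real (inverse (1 + (x \<bullet> b)\<^sup>2)))"
    by (intro integrable_lborel_prod)
  show "AE x::'a in lborel. norm (complex_of_real (1 / (1 + norm x) ^ (2 * DIM('a)))) \<le>
       norm (\<Prod>b\<in>Basis. complex_of_real (inverse (1 + (x \<bullet> b)\<^sup>2)))"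
  proof (rule AE_I2)
    fix x :: 'a
    have "inverse ((1 + norm x)\<^sup>2) \<le> inverse (1 + (x \<bullet> b)\<^sup>2)" if "b \<in> Basis" for b
    proof (rule le_imp_inverse_le)
      have "(x \<bullet> b)\<^sup>2 \<le> (norm x)\<^sup>2"
        using Basis_le_norm[OF that, of x] by (metis abs_ge_zero power2_abs power_mono)
      also have "1 + (norm x)\<^sup>2 \<le> (1 + norm x)\<^sup>2" by (simp add: power2_sum)
      finally show "1 + (x \<bullet> b)\<^sup>2 \<le> (1 + norm x)\<^sup>2" by simp
      show "0 < 1 + (x \<bullet> b)\<^sup>2" by (simp add: add_pos_nonneg)
    qed
    then have "(\<Prod>b\<in>(Basis::'a set). inverse ((1 + norm x)\<^sup>2)) \<le> (\<Prod>b\<in>Basis. inverse (1 + (x \<bullet> b)\<^sup>2))"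
      by (intro prod_mono) auto
    also have "(\<Prod>b\<in>(Basis::'a set). inverse ((1 + norm x)\<^sup>2)) = 1 / (1 + norm x) ^ (2 * DIM('a))"
      by (simp add: power_mult[symmetric] divide_simps power_inverse)
    also have "(\<Prod>b\<in>Basis. inverse (1 + (x \<bullet> b)\<^sup>2)) = norm (\<Prod>b\<in>Basis. complex_of_real (inverse (1 + (x \<bullet> b)\<^sup>2)))"
      unfolding prod_norm[symmetric] norm_of_real
      by (intro prod.cong refl) (simp add: add_pos_nonneg abs_of_pos)
    finally show "norm (complex_of_real (1 / (1 + norm x) ^ (2 * DIM('a)))) \<le>
       norm (\<Prod>b\<in>Basis. complex_of_real (inverse (1 + (x \<bullet> b)\<^sup>2)))" unfolding norm_of_real by simp
  qed
qed measurable

lemma integrable_polynomial_decay: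
  fixes f :: "'a::euclidean_space \<Rightarrow> complex"
  assumes [measurable]: "f \<in> borel_measurable borel"
    and "\<And>x. (1 + norm x) ^ (2 * DIM('a)) * cmod (f x) \<le> C"
  shows "integrable lborel f"
    and "(\<integral>x. cmod (f x) \<partial>lborel) \<le> C * (LINT x|(lborel :: 'a measure). 1 / (1 + norm x) ^ (2 * DIM('a)))"
proof -
  have le: "cmod (f x) \<le> C * (1 / (1 + norm x) ^ (2 * DIM('a)))" for x
  proof -
    have "0 < (1 + norm x) ^ (2 * DIM('a))" by (intro zero_less_power add_pos_nonneg) auto
    then show ?thesis using assms(2)[of x] by (simp add: field_simps)
  qed
  have i: "integrable lborel (\<lambda>x::'a. C * (1 / (1 + norm x) ^ (2 * DIM('a))))"
    using integrable_Re[OF integrable_inverse_polynomial] by (intro integrable_mult_right) simp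
  show f: "integrable lborel f"
    by (rule Bochner_Integration.integrable_bound[OF i])
      (auto intro!: AE_I2 order_trans[OF le] divide_right_mono)
  show "(\<integral>x. cmod (f x) \<partial>lborel) \<le> C * (LINT x|(lborel :: 'a measure). 1 / (1 + norm x) ^ (2 * DIM('a)))"
    using integral_mono[OF integrable_norm[OF f] i le] by (subst (asm) integral_mult_right_zero)
qed

section \<open>The Fourier transform of Schwartz functions\<close>

lemma schwartz_continuous: "f \<in> schwartz \<Longrightarrow> continuous_on UNIV f"
  by (intro continuous_at_imp_continuous_on ballI differentiable_imp_continuous_within schwartz_differentiable)

lemma schwartz_measurable: "f \<in> schwartz \<Longrightarrow> f \<in> borel_measurable borel"
  by (intro borel_measurable_continuous_onI schwartz_continuous)

lemma schwartz_integrable: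
  fixes f :: "real^'d::finite \<Rightarrow> complex"
  assumes "f \<in> schwartz"
  shows "integrable lborel f"
proof -
  obtain C where "\<And>x. (1 + norm x) ^ (2 * DIM(real^'d)) * cmod (f x) \<le> C"
    using rapidD[OF schwartz_rapid[OF assms]] by metis
  then show ?thesis by (intro integrable_polynomial_decay schwartz_measurable assms)
qed

lemma schwartz_bounded:
  assumes "f \<in> schwartz"
  obtains C where "C \<ge> 0" "\<And>x. cmod (f x) \<le> C"
  using rapidD[OF schwartz_rapid[OF assms], of 0] by (metis mult_1 power_0)

lemma fourier_cis: "fourier f \<omega> = (LINT x|lborel. f x * cis (- (\<omega> \<bullet> x)))"
  unfolding fourier_def by (simp add: cis_conv_exp)

lemma measurable_cis_inner [measurable]:
  fixes f g :: "'a \<Rightarrow> 'b::euclidean_space"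
  shows "f \<in> borel_measurable M \<Longrightarrow> g \<in> borel_measurable M \<Longrightarrow> (\<lambda>x. cis (f x \<bullet> g x)) \<in> borel_measurable M"
  "f \<in> borel_measurable M \<Longrightarrow> g \<in> borel_measurable M \<Longrightarrow> (\<lambda>x. cis (- (f x \<bullet> g x))) \<in> borel_measurable M"
proof -
  assume [measurable]: "f \<in> borel_measurable M" "g \<in> borel_measurable M"
  have [measurable]: "cis \<in> borel_measurable borel"
    by (intro borel_measurable_continuous_onI continuous_intros)
  show "(\<lambda>x. cis (f x \<bullet> g x)) \<in> borel_measurable M" "(\<lambda>x. cis (- (f x \<bullet> g x))) \<in> borel_measurable M"
    by measurable
qed

lemma integrable_mult_cis:
  assumes "integrable lborel f"
  shows "integrable lborel (\<lambda>x. f x * cis (- (\<omega> \<bullet> x)))" "integrable lborel (\<lambda>x. f x * cis (\<omega> \<bullet> x))"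
proof -
  have [measurable]: "f \<in> borel_measurable borel" using borel_measurable_integrable[OF assms] by simp
  show "integrable lborel (\<lambda>x. f x * cis (- (\<omega> \<bullet> x)))" "integrable lborel (\<lambda>x. f x * cis (\<omega> \<bullet> x))"
    by (auto intro!: Bochner_Integration.integrable_bound[OF assms] simp: norm_mult)
qed

lemma norm_fourier_le: "cmod (fourier f \<omega>) \<le> (\<integral>x. cmod (f x) \<partial>lborel)"
  unfolding fourier_cis
  by (rule order_trans[OF integral_norm_bound]) (simp add: norm_mult)

text \<open>Fubini: both sides are the double integral of \<open>f x g \<omega> exp(-i \<omega> x)\<close>.\<close>

lemma fourier_multiplication:
  fixes f g :: "real^'d::finite \<Rightarrow> complex"
  assumes f: "integrable lborel f" and g: "integrable lborel g"
  shows "(LINT \<omega>|lborel. fourier f \<omega> * g \<omega>) = (LINT x|lborel. f x * fourier g x)"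
proof -
  have [measurable]: "f \<in> borel_measurable borel" "g \<in> borel_measurable borel"
    using borel_measurable_integrable f g by force+
  have i: "integrable (lborel \<Otimes>\<^sub>M lborel) (\<lambda>(x, \<omega>). f x * g \<omega> * cis (- (\<omega> \<bullet> x)))"
  proof (rule lborel_pair.Fubini_integrable)
    show "(\<lambda>(x, \<omega>). f x * g \<omega> * cis (- (\<omega> \<bullet> x))) \<in> borel_measurable (lborel \<Otimes>\<^sub>M lborel)" by measurable
    have "(\<lambda>x. LINT y|lborel. norm (case (x, y) of (x, \<omega>) \<Rightarrow> f x * g \<omega> * cis (- (\<omega> \<bullet> x)))) =
        (\<lambda>x. cmod (f x) * (LINT y|lborel. cmod (g y)))"
      by (simp add: norm_mult)
    then show "integrable lborel (\<lambda>x. LINT y|lborel. norm (case (x, y) of (x, \<omega>) \<Rightarrow> f x * g \<omega> * cis (- (\<omega> \<bullet> x))))"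
      using f by simp
    show "AE x in lborel. integrable lborel (\<lambda>y. case (x, y) of (x, \<omega>) \<Rightarrow> f x * g \<omega> * cis (- (\<omega> \<bullet> x)))"
      using integrable_mult_cis(1)[OF g] by (auto simp: mult.assoc inner_commute)
  qed
  have "(LINT \<omega>|lborel. fourier f \<omega> * g \<omega>) = (LINT \<omega>|lborel. LINT x|lborel. f x * g \<omega> * cis (- (\<omega> \<bullet> x)))"
    unfolding fourier_cis
    by (subst integral_mult_left_zero[symmetric]) (simp add: mult_ac)
  also have "\<dots> = (LINT x|lborel. LINT \<omega>|lborel. f x * g \<omega> * cis (- (\<omega> \<bullet> x)))"
    by (rule lborel_pair.Fubini_integral[OF i])
  also have "\<dots> = (LINT x|lborel. f x * fourier g x)"
    unfolding fourier_cis by (simp add: mult.assoc inner_commute)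
  finally show ?thesis .
qed

lemma fourier_mult_cis: "fourier (\<lambda>x. cis (\<alpha> \<bullet> x) * f x) \<omega> = fourier f (\<omega> - \<alpha>)"
  unfolding fourier_cis
  by (intro arg_cong[where f = "integral\<^sup>L lborel"] ext)
    (simp add: inner_diff_left cis_mult mult_ac flip: mult.assoc)

lemma fourier_dilate:
  fixes f :: "real^'d::finite \<Rightarrow> complex"
  assumes "f \<in> borel_measurable borel" "h > 0"
  shows "fourier (\<lambda>x. f (h *\<^sub>R x)) (h *\<^sub>R \<omega>) = fourier f \<omega> / of_real h ^ CARD('d)"
proof -
  have [measurable]: "f \<in> borel_measurable borel" by fact
  have "fourier f \<omega> = \<bar>h\<bar> ^ CARD('d) *\<^sub>R (LINT x|lborel. f (0 + h *\<^sub>R x) * cis (- (\<omega> \<bullet> (0 + h *\<^sub>R x))))"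
    unfolding fourier_cis using assms by (subst integral_lborel_affine[where c = h and t = 0]) simp_all
  then show ?thesis using assms unfolding fourier_cis
    by (simp add: scaleR_conv_of_real[where 'a=complex])
qed

subsection \<open>Differentiation and decay\<close>

lemma norm_cis_taylor: "cmod (cis (- (\<omega> + \<eta>)) - cis (- \<omega>) + \<i> * complex_of_real \<eta> * cis (- \<omega>)) \<le> \<eta>\<^sup>2"
proof -
  have "cmod (iexp (- \<eta>) - (\<Sum>k\<le>1. (\<i> * complex_of_real (- \<eta>)) ^ k / fact k)) \<le> \<bar>- \<eta>\<bar> ^ Suc 1 / fact (Suc 1)"
    by (rule iexp_approx1)
  also have "\<dots> \<le> \<eta>\<^sup>2" by (simp add: power2_eq_square)
  finally have *: "cmod (cis (- \<eta>) - 1 + \<i> * complex_of_real \<eta>) \<le> \<eta>\<^sup>2"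
    by (simp add: cis_conv_exp algebra_simps)
  have "cis (- (\<omega> + \<eta>)) - cis (- \<omega>) + \<i> * complex_of_real \<eta> * cis (- \<omega>) =
      cis (- \<omega>) * (cis (- \<eta>) - 1 + \<i> * complex_of_real \<eta>)"
    by (simp add: algebra_simps cis_mult)
  then show ?thesis using * by (simp add: norm_mult)
qed

lemma schwartz_inner: "f \<in> schwartz \<Longrightarrow> (\<lambda>x. complex_of_real (\<eta> \<bullet> x) * f x) \<in> schwartz"
proof -
  assume f: "f \<in> schwartz"
  have "(\<lambda>x. \<Sum>i\<in>I. complex_of_real (\<eta> $ i) * (complex_of_real (x $ i) * f x)) \<in> schwartz" if "finite I" for I
    using that
  proof (induction I)
    case empty
    show ?case using schwartz_cmult[OF f, of 0] by simp
  next
    case (insert i I)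
    then show ?case by (simp add: schwartz_add schwartz_cmult schwartz_coord f)
  qed
  from this[of UNIV] show ?thesis
    by (simp add: inner_vec_def sum_distrib_right mult.assoc)
qed

lemma schwartz_norm_sq_integrable:
  assumes "f \<in> schwartz"
  shows "integrable lborel (\<lambda>x. (norm x)\<^sup>2 * cmod (f x))"
proof -
  obtain C where C: "\<And>x. (1 + norm x) ^ (2 + 2 * DIM(real^'a)) * cmod (f x) \<le> C"
    using rapidD[OF schwartz_rapid[OF assms]] by metis
  have [measurable]: "f \<in> borel_measurable borel" by (rule schwartz_measurable[OF assms])
  have "integrable lborel (\<lambda>x. complex_of_real ((norm x)\<^sup>2 * cmod (f x)))"
  proof (rule integrable_polynomial_decay)
    fix x :: "real^'a"
    have "(1 + norm x) ^ (2 * DIM(real^'a)) * ((norm x)\<^sup>2 * cmod (f x)) \<le>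
       (1 + norm x) ^ (2 * DIM(real^'a)) * ((1 + norm x)\<^sup>2 * cmod (f x))"
      by (intro mult_left_mono mult_right_mono power_mono) auto
    also have "\<dots> = (1 + norm x) ^ (2 + 2 * DIM(real^'a)) * cmod (f x)"
      by (simp add: power_add power2_eq_square mult_ac)
    also note C
    finally show "(1 + norm x) ^ (2 * DIM(real^'a)) * cmod (complex_of_real ((norm x)\<^sup>2 * cmod (f x))) \<le> C"
      by (simp add: norm_mult del: of_real_mult)
  qed measurable
  from integrable_Re[OF this] show ?thesis by simp
qed

text \<open>The second-order remainder of the exponential is at most \<open>(\<eta> x)\<^sup>2\<close>, so the remainder of
  \<open>fourier f\<close> is at most \<open>|\<eta>|\<^sup>2\<close> times the second moment of \<open>f\<close>, and the total derivative
  is obtained without a theorem on differentiation under the integral sign.\<close>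

lemma fourier_has_derivative:
  fixes f :: "real^'d::finite \<Rightarrow> complex"
  assumes f: "f \<in> schwartz"
  shows "(fourier f has_derivative (\<lambda>\<eta>. fourier (\<lambda>x. - \<i> * (complex_of_real (\<eta> \<bullet> x) * f x)) \<omega>)) (at \<omega>)"
proof -
  define D where "D \<eta> = fourier (\<lambda>x. - \<i> * (complex_of_real (\<eta> \<bullet> x) * f x)) \<omega>" for \<eta>
  have i1: "integrable lborel (\<lambda>x. (- \<i> * (complex_of_real (\<eta> \<bullet> x) * f x)) * cis (- (\<omega> \<bullet> x)))" for \<eta>
    by (intro integrable_mult_cis schwartz_integrable schwartz_cmult schwartz_inner f)
  have i0: "integrable lborel (\<lambda>x. f x * cis (- (\<omega> \<bullet> x)))" for \<omega>
    by (intro integrable_mult_cis schwartz_integrable f)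
  have lin: "linear D"
  proof
    fix a b :: "real^'d" and r :: real
    show "D (a + b) = D a + D b"
      unfolding D_def fourier_cis
      by (subst Bochner_Integration.integral_add[OF i1 i1, symmetric]) (simp add: inner_add_left algebra_simps)
    show "D (r *\<^sub>R a) = r *\<^sub>R D a"
      unfolding D_def fourier_cis
      by (subst integral_scaleR_right[symmetric]) (simp add: scaleR_conv_of_real[where 'a=complex] mult_ac)
  qed
  define B where "B = (\<integral>x. (norm x)\<^sup>2 * cmod (f x) \<partial>lborel)"
  have B0: "B \<ge> 0" unfolding B_def by (rule Bochner_Integration.integral_nonneg) simp
  have est: "cmod (fourier f (\<omega> + \<eta>) - fourier f \<omega> - D \<eta>) \<le> (norm \<eta>)\<^sup>2 * B" for \<eta>
  proof -
    have "fourier f (\<omega> + \<eta>) - fourier f \<omega> - D \<eta> =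
      (LINT x|lborel. f x * (cis (- (\<omega> \<bullet> x + \<eta> \<bullet> x)) - cis (- (\<omega> \<bullet> x)) + \<i> * complex_of_real (\<eta> \<bullet> x) * cis (- (\<omega> \<bullet> x))))"
      unfolding D_def fourier_cis
      by (subst Bochner_Integration.integral_diff[OF i0 i0, symmetric],
          subst Bochner_Integration.integral_diff[OF Bochner_Integration.integrable_diff[OF i0 i0] i1, symmetric])
        (simp add: algebra_simps inner_add_left)
    also have "cmod \<dots> \<le> (\<integral>x. (norm \<eta>)\<^sup>2 * ((norm x)\<^sup>2 * cmod (f x)) \<partial>lborel)"
    proof (rule Bochner_Integration.integral_norm_bound_integral)
      have "integrable lborel (\<lambda>x. (f x * cis (- ((\<omega> + \<eta>) \<bullet> x)) - f x * cis (- (\<omega> \<bullet> x)))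
          - (- \<i> * (complex_of_real (\<eta> \<bullet> x) * f x)) * cis (- (\<omega> \<bullet> x)))"
        by (intro Bochner_Integration.integrable_diff i0 i1)
      then show "integrable lborel (\<lambda>x. f x * (cis (- (\<omega> \<bullet> x + \<eta> \<bullet> x)) - cis (- (\<omega> \<bullet> x)) + \<i> * complex_of_real (\<eta> \<bullet> x) * cis (- (\<omega> \<bullet> x))))"
        by (simp add: algebra_simps inner_add_left)
      show "integrable lborel (\<lambda>x. (norm \<eta>)\<^sup>2 * ((norm x)\<^sup>2 * cmod (f x)))"
        by (intro integrable_mult_right schwartz_norm_sq_integrable f)
      fix x
      have "cmod (f x) * cmod (cis (- (\<omega> \<bullet> x + \<eta> \<bullet> x)) - cis (- (\<omega> \<bullet> x)) + \<i> * complex_of_real (\<eta> \<bullet> x) * cis (- (\<omega> \<bullet> x)))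
          \<le> cmod (f x) * (\<eta> \<bullet> x)\<^sup>2"
        by (intro mult_left_mono norm_cis_taylor) simp
      also have "\<dots> \<le> cmod (f x) * (norm \<eta> * norm x)\<^sup>2"
        using Cauchy_Schwarz_ineq2[of \<eta> x]
        by (intro mult_left_mono) (metis abs_ge_zero power2_abs power_mono, simp)
      finally show "cmod (f x * (cis (- (\<omega> \<bullet> x + \<eta> \<bullet> x)) - cis (- (\<omega> \<bullet> x)) + \<i> * complex_of_real (\<eta> \<bullet> x) * cis (- (\<omega> \<bullet> x))))
         \<le> (norm \<eta>)\<^sup>2 * ((norm x)\<^sup>2 * cmod (f x))"
        by (simp only: norm_mult power_mult_distrib mult_ac)
    qed
    finally show ?thesis by (simp add: B_def)
  qed
  have "(fourier f has_derivative D) (at \<omega>)"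
    unfolding has_derivative_at_alt
  proof (intro conjI allI impI)
    show "bounded_linear D" using lin by (simp add: linear_conv_bounded_linear)
    fix e :: real assume e: "0 < e"
    have "cmod (fourier f y - fourier f \<omega> - D (y - \<omega>)) \<le> e * norm (y - \<omega>)"
      if "norm (y - \<omega>) < e / (B + 1)" for y
    proof -
      have "cmod (fourier f y - fourier f \<omega> - D (y - \<omega>)) \<le> (norm (y - \<omega>))\<^sup>2 * B"
        using est[of "y - \<omega>"] by simp
      also have "\<dots> = (norm (y - \<omega>) * B) * norm (y - \<omega>)" by (simp add: power2_eq_square)
      also have "\<dots> \<le> e * norm (y - \<omega>)"
      proof (rule mult_right_mono)
        have "norm (y - \<omega>) * B \<le> norm (y - \<omega>) * (B + 1)" by (simp add: mult_left_mono)
        also have "\<dots> \<le> e" using that B0 by (simp add: field_simps)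
        finally show "norm (y - \<omega>) * B \<le> e" .
      qed simp
      finally show ?thesis .
    qed
    moreover have "0 < e / (B + 1)" using e B0 by simp
    ultimately show "\<exists>d>0. \<forall>y. norm (y - \<omega>) < d \<longrightarrow>
        cmod (fourier f y - fourier f \<omega> - D (y - \<omega>)) \<le> e * norm (y - \<omega>)" by blast
  qed
  then show ?thesis unfolding D_def .
qed

lemma partial_fourier:
  assumes "f \<in> schwartz"
  shows "partial i (fourier f) = fourier (\<lambda>x. - \<i> * (complex_of_real (x $ i) * f x))"
  by (rule ext, subst partial_eq[OF fourier_has_derivative[OF assms]])
    (simp add: inner_axis inner_commute)

lemma norm_diff_le_partial:
  fixes f :: "real^'d::finite \<Rightarrow> complex"
  assumes f: "\<And>x. f differentiable (at x)" and t: "0 \<le> t"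
    and C: "\<And>s. 0 \<le> s \<Longrightarrow> s \<le> t \<Longrightarrow> cmod (partial i f (x + s *\<^sub>R axis i 1)) \<le> C"
  shows "cmod (f (x + t *\<^sub>R axis i 1) - f x) \<le> C * t"
proof -
  have D: "((\<lambda>s. f (x + s *\<^sub>R axis i 1)) has_derivative (\<lambda>h. h *\<^sub>R partial i f (x + s *\<^sub>R axis i 1))) (at s within {0..t})" for s
  proof -
    have f': "(f has_derivative frechet_derivative f (at (x + s *\<^sub>R axis i 1))) (at (x + s *\<^sub>R axis i 1))"
      using f frechet_derivative_works by auto
    then interpret f: bounded_linear "frechet_derivative f (at (x + s *\<^sub>R axis i 1))"
      by (rule has_derivative_bounded_linear)
    have "((\<lambda>s. x + s *\<^sub>R axis i 1) has_derivative (\<lambda>h. h *\<^sub>R axis i 1)) (at s within {0..t})"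
      by (auto intro!: derivative_eq_intros)
    from has_derivative_compose[OF this f'] show ?thesis
      by (simp add: partial_def f.scaleR)
  qed
  have "cmod (f (x + t *\<^sub>R axis i 1) - f (x + 0 *\<^sub>R axis i 1)) \<le> C * norm (t - 0)"
  proof (rule differentiable_bound[where S = "{0..t}", OF _ D])
    fix s assume s: "s \<in> {0..t}"
    show "onorm (\<lambda>h. h *\<^sub>R partial i f (x + s *\<^sub>R axis i 1)) \<le> C"
      using C[of s] s by (intro onorm_le) (auto simp: mult.commute[of C] intro!: mult_left_mono)
  qed (use t in auto)
  then show ?thesis using t by simp
qed

text \<open>The integral of \<open>f\<close> is invariant under translations, so the integrals of the difference
  quotients vanish; they converge dominatedly to the partial derivative.\<close>

lemma integral_partial_zero:
  fixes f :: "real^'d::finite \<Rightarrow> complex"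
  assumes f: "f \<in> schwartz"
  shows "(LINT x|lborel. partial i f x) = 0"
proof -
  define N where "N = 2 * DIM(real^'d)"
  define e where "e = (axis i 1 :: real^'d)"
  define g where "g n x = complex_of_real (real (Suc n)) * (f (x + (1 / real (Suc n)) *\<^sub>R e) - f x)" for n x
  obtain C where C: "C \<ge> 0" "\<And>x. (1 + norm x) ^ N * cmod (partial i f x) \<le> C"
    using rapidD[OF schwartz_rapid[OF schwartz_partial[OF f]]] by metis
  have [measurable]: "f \<in> borel_measurable borel" "partial i f \<in> borel_measurable borel"
    by (auto intro: schwartz_measurable schwartz_partial f)
  have zero: "(LINT x|lborel. g n x) = 0" for n
  proof -
    have i: "integrable lborel f" by (rule schwartz_integrable[OF f])
    have "integrable lborel (\<lambda>x. f ((1 / real (Suc n)) *\<^sub>R e + 1 *\<^sub>R x))"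
      by (rule integrable_lborel_affine[OF i]) simp
    moreover have "(LINT x|lborel. f ((1 / real (Suc n)) *\<^sub>R e + 1 *\<^sub>R x)) = (LINT x|lborel. f x)"
      by (subst integral_lborel_affine[where f = f and c = 1 and t = "(1 / real (Suc n)) *\<^sub>R e"]) simp_all
    ultimately show ?thesis using i by (simp add: g_def add.commute)
  qed
  have "(\<lambda>n. LINT x|lborel. g n x) \<longlonglongrightarrow> (LINT x|lborel. partial i f x)"
  proof (rule integral_dominated_convergence)
    show "integrable lborel (\<lambda>x. 2 ^ N * C * (1 / (1 + norm (x::real^'d)) ^ N))"
      using integrable_Re[OF integrable_inverse_polynomial[where 'a = "real^'d"]] unfolding N_def
      by (intro integrable_mult_right) simp
    show "AE x in lborel. (\<lambda>n. g n x) \<longlonglongrightarrow> partial i f x"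
    proof (rule AE_I2)
      fix x
      have f': "(f has_derivative frechet_derivative f (at x)) (at x)"
        using schwartz_differentiable[OF f] frechet_derivative_works by auto
      then interpret f: bounded_linear "frechet_derivative f (at x)"
        by (rule has_derivative_bounded_linear)
      have "((\<lambda>s. x + s *\<^sub>R e) has_derivative (\<lambda>h. h *\<^sub>R e)) (at 0)"
        by (auto intro!: derivative_eq_intros)
      from has_derivative_compose[OF this, of f "frechet_derivative f (at x)"] f'
      have "((\<lambda>s. f (x + s *\<^sub>R e)) has_derivative (\<lambda>s. s *\<^sub>R partial i f x)) (at 0)"
        by (simp add: partial_def f.scaleR e_def)
      then have "((\<lambda>t. cmod (f (x + t *\<^sub>R e) - f x - t *\<^sub>R partial i f x) / \<bar>t\<bar>) \<longlongrightarrow> 0) (at 0)"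
        by (simp add: has_derivative_at)
      moreover have "filterlim (\<lambda>n. 1 / real (Suc n)) (at 0) sequentially"
        unfolding filterlim_at using LIMSEQ_inverse_real_of_nat by (auto simp: inverse_eq_divide)
      ultimately have lim: "(\<lambda>n. cmod (f (x + (1 / real (Suc n)) *\<^sub>R e) - f x - (1 / real (Suc n)) *\<^sub>R partial i f x)
          / \<bar>1 / real (Suc n)\<bar>) \<longlonglongrightarrow> 0"
        by (rule filterlim_compose)
      have eq: "cmod z / \<bar>1 / real (Suc n)\<bar> = cmod (of_nat (Suc n) * z)" for z n
        by (simp add: norm_mult del: of_nat_Suc)
      have "(\<lambda>n. g n x - partial i f x) \<longlonglongrightarrow> 0"
        using lim unfolding eq tendsto_norm_zero_iff
        by (simp add: g_def scaleR_conv_of_real[where 'a=complex] right_diff_distrib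
            mult.assoc[symmetric] del: of_nat_Suc)
      then show "(\<lambda>n. g n x) \<longlonglongrightarrow> partial i f x" by (rule LIM_zero_cancel)
    qed
    show "AE x in lborel. norm (g n x) \<le> 2 ^ N * C * (1 / (1 + norm x) ^ N)" for n
    proof (rule AE_I2)
      fix x
      define t where "t = 1 / real (Suc n)"
      have t: "0 < t" "t \<le> 1" by (auto simp: t_def)
      have "cmod (f (x + t *\<^sub>R axis i 1) - f x) \<le> (2 ^ N * C * (1 / (1 + norm x) ^ N)) * t"
      proof (rule norm_diff_le_partial)
        fix s assume s: "0 \<le> s" "s \<le> t"
        let ?y = "x + s *\<^sub>R axis i 1"
        have "norm x \<le> norm ?y + norm (s *\<^sub>R axis i 1 :: real^'d)"
          using norm_triangle_ineq4[of ?y "s *\<^sub>R axis i 1"] by simp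
        also have "norm (s *\<^sub>R axis i 1 :: real^'d) \<le> 1" using s t by (simp add: norm_axis_1)
        finally have le: "1 + norm x \<le> 2 * (1 + norm ?y)" using norm_ge_zero[of ?y] unfolding distrib_left by linarith
        have "(1 + norm x) ^ N * cmod (partial i f ?y) \<le> (2 * (1 + norm ?y)) ^ N * cmod (partial i f ?y)"
          by (intro mult_right_mono power_mono le) auto
        also have "\<dots> = 2 ^ N * ((1 + norm ?y) ^ N * cmod (partial i f ?y))"
          by (simp only: power_mult_distrib mult.assoc)
        also have "\<dots> \<le> 2 ^ N * C" using C by (intro mult_left_mono) auto
        finally have "(1 + norm x) ^ N * cmod (partial i f ?y) \<le> 2 ^ N * C" .
        moreover have "(1 + norm x) ^ N > 0" by (intro zero_less_power add_pos_nonneg) auto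
        ultimately show "cmod (partial i f ?y) \<le> 2 ^ N * C * (1 / (1 + norm x) ^ N)"
          by (simp add: field_simps)
      qed (use t schwartz_differentiable[OF f] in auto)
      then have "cmod (f (x + t *\<^sub>R axis i 1) - f x) / t \<le> 2 ^ N * C * (1 / (1 + norm x) ^ N)"
        using t by (simp only: pos_divide_le_eq)
      moreover have "norm (g n x) = cmod (f (x + t *\<^sub>R axis i 1) - f x) / t"
        unfolding g_def norm_mult by (simp add: t_def e_def del: of_nat_Suc)
      ultimately show "norm (g n x) \<le> 2 ^ N * C * (1 / (1 + norm x) ^ N)" by (simp only:)
    qed
  qed (auto simp: g_def)
  then show ?thesis unfolding zero by (simp add: LIMSEQ_const_iff)
qed

text \<open>Integration by parts, in the form that the integral of the \<open>i\<close>-th derivative of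
  \<open>f x exp(-i \<omega> x)\<close> is zero.\<close>

lemma fourier_partial:
  fixes f :: "real^'d::finite \<Rightarrow> complex"
  assumes f: "f \<in> schwartz"
  shows "fourier (partial i f) \<omega> = \<i> * complex_of_real (\<omega> $ i) * fourier f \<omega>"
proof -
  have i: "integrable lborel (\<lambda>x. f x * cis (- (\<omega> \<bullet> x)))" "integrable lborel (\<lambda>x. partial i f x * cis (- (\<omega> \<bullet> x)))"
    by (intro integrable_mult_cis schwartz_integrable schwartz_partial f)+
  have "0 = (LINT x|lborel. partial i (\<lambda>x. cis ((- \<omega>) \<bullet> x) * f x) x)"
    by (rule integral_partial_zero[symmetric, OF schwartz_cis[OF f]])
  also have "\<dots> = (LINT x|lborel. (- \<i> * complex_of_real (\<omega> $ i)) * (f x * cis (- (\<omega> \<bullet> x))) + partial i f x * cis (- (\<omega> \<bullet> x)))"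
    unfolding partial_cis(2)[OF schwartz_differentiable[OF f]] by (simp add: algebra_simps)
  also have "\<dots> = (- \<i> * complex_of_real (\<omega> $ i)) * fourier f \<omega> + fourier (partial i f) \<omega>"
    unfolding fourier_cis using i by (subst Bochner_Integration.integral_add) auto
  finally show ?thesis by (simp add: algebra_simps)
qed

text \<open>One more power of \<open>1 + |\<omega>|\<close> is paid for by the partial derivatives of \<open>f\<close>, since
  \<open>|\<omega>|\<close> is at most the sum of the \<open>|\<omega>\<^sub>i|\<close>.\<close>

lemma rapid_fourier:
  fixes f :: "real^'d::finite \<Rightarrow> complex"
  assumes "f \<in> schwartz"
  shows "rapid (fourier f)"
proof -
  have "\<forall>f\<in>schwartz. \<exists>C. \<forall>\<omega> :: real^'d. (1 + norm \<omega>) ^ N * cmod (fourier f \<omega>) \<le> C" for N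
  proof (induction N)
    case 0
    then show ?case using norm_fourier_le by (metis mult_1 power_0)
  next
    case (Suc N)
    show ?case
    proof
      fix f :: "real^'d \<Rightarrow> complex" assume f: "f \<in> schwartz"
      obtain A where A: "\<And>\<omega>. (1 + norm \<omega>) ^ N * cmod (fourier f \<omega>) \<le> A" using Suc f by blast
      have "\<forall>i. \<exists>C. \<forall>\<omega>. (1 + norm \<omega>) ^ N * cmod (fourier (partial i f) \<omega>) \<le> C"
        using Suc schwartz_partial[OF f] by blast
      then obtain B where B: "\<And>i \<omega>. (1 + norm \<omega>) ^ N * cmod (fourier (partial i f) \<omega>) \<le> B i" by metis
      have "(1 + norm \<omega>) ^ Suc N * cmod (fourier f \<omega>) \<le> A + (\<Sum>i\<in>UNIV. B i)" for \<omega>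
      proof -
        have "(1 + norm \<omega>) ^ Suc N * cmod (fourier f \<omega>) =
          (1 + norm \<omega>) * ((1 + norm \<omega>) ^ N * cmod (fourier f \<omega>))" by simp
        also have "\<dots> \<le> (1 + (\<Sum>i\<in>UNIV. \<bar>\<omega> $ i\<bar>)) * ((1 + norm \<omega>) ^ N * cmod (fourier f \<omega>))"
          using norm_le_l1_cart[of \<omega>] by (intro mult_right_mono) auto
        also have "\<dots> = (1 + norm \<omega>) ^ N * cmod (fourier f \<omega>) +
           (\<Sum>i\<in>UNIV. (1 + norm \<omega>) ^ N * cmod (fourier (partial i f) \<omega>))"
          unfolding fourier_partial[OF f] by (simp add: norm_mult sum_distrib_left sum_distrib_right algebra_simps)
        also have "\<dots> \<le> A + (\<Sum>i\<in>UNIV. B i)" by (intro add_mono sum_mono A B)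
        finally show ?thesis .
      qed
      then show "\<exists>C. \<forall>\<omega>. (1 + norm \<omega>) ^ Suc N * cmod (fourier f \<omega>) \<le> C" by blast
    qed
  qed
  then show ?thesis using assms by (auto simp: rapid_def)
qed

theorem schwartz_fourier:
  assumes "f \<in> schwartz"
  shows "fourier f \<in> schwartz"
proof (rule schwartz_coinduct[where X = "fourier ` schwartz"])
  show "fourier f \<in> fourier ` schwartz" using assms by blast
next
  fix F :: "real^'a \<Rightarrow> complex" assume "F \<in> fourier ` schwartz"
  then obtain f where F: "F = fourier f" and f: "f \<in> schwartz" by auto
  show "(\<forall>x. F differentiable (at x)) \<and> rapid F \<and> (\<forall>i. partial i F \<in> fourier ` schwartz)"
    unfolding F partial_fourier[OF f]
    using rapid_fourier[OF f] fourier_has_derivative[OF f] differentiableI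
    by (auto intro!: imageI schwartz_cmult[of _ "- \<i>", simplified] schwartz_coord f)
qed

subsection \<open>Gaussians and Fourier inversion\<close>

definition gauss :: "real^'d::finite \<Rightarrow> complex" where
  "gauss x = complex_of_real (exp (- (norm x)\<^sup>2 / 2))"

text \<open>The products of the Gaussian with polynomials, generated so that closure under partial
  derivatives is a rule induction.\<close>

inductive_set gauss_class :: "(real^'d::finite \<Rightarrow> complex) set" where
  base: "gauss \<in> gauss_class"
| coord: "f \<in> gauss_class \<Longrightarrow> (\<lambda>x. complex_of_real (x $ j) * f x) \<in> gauss_class"
| lin: "f \<in> gauss_class \<Longrightarrow> g \<in> gauss_class \<Longrightarrow> (\<lambda>x. a * f x + b * g x) \<in> gauss_class"

lemma gauss_has_derivative:
  "(gauss has_derivative (\<lambda>h. - complex_of_real (x \<bullet> h) * gauss x)) (at x)"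
proof -
  have "((\<lambda>x. exp (- (x \<bullet> x) / 2)) has_derivative (\<lambda>h. - (x \<bullet> h) * exp (- (x \<bullet> x) / 2))) (at x)"
    by (auto intro!: derivative_eq_intros simp: inner_commute)
  from has_derivative_of_real[OF this, where 'a = complex] show ?thesis
    unfolding gauss_def[abs_def] power2_norm_eq_inner by simp
qed

lemma rapid_gauss: "rapid (gauss :: real^'d::finite \<Rightarrow> complex)"
  unfolding rapid_def
proof
  fix N :: nat
  have "(1 + norm x) ^ N * cmod (gauss x) \<le> 2 ^ N * real (N + 1) ^ (N + 1)" for x :: "real^'d"
  proof -
    define y where "y = (norm x)\<^sup>2 / 2"
    have y: "y \<ge> 0" by (simp add: y_def)
    have "0 \<le> (norm x - 1)\<^sup>2" by simp
    then have "2 * norm x \<le> 1 + 2 * y" by (simp add: power2_diff y_def)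
    then have "1 + norm x \<le> 2 * (1 + y)" using y by (simp add: distrib_left)
    then have "(1 + norm x) ^ N \<le> (2 * (1 + y)) ^ N" by (intro power_mono) auto
    also have "\<dots> = 2 ^ N * (1 + y) ^ N" by (simp only: power_mult_distrib)
    also have "\<dots> \<le> 2 ^ N * (1 + y) ^ (N + 1)" using y by (intro mult_left_mono power_increasing) auto
    also have "(1 + y) ^ (N + 1) \<le> (real (N + 1) * exp (y / real (N + 1))) ^ (N + 1)"
    proof (rule power_mono)
      have "1 + y \<le> real (N + 1) * (1 + y / real (N + 1))" by (simp add: distrib_left)
      also have "\<dots> \<le> real (N + 1) * exp (y / real (N + 1))"
        by (intro mult_left_mono exp_ge_add_one_self) auto
      finally show "1 + y \<le> real (N + 1) * exp (y / real (N + 1))" .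
    qed (use y in auto)
    also have "\<dots> = real (N + 1) ^ (N + 1) * exp y"
      unfolding power_mult_distrib by (subst exp_of_nat_mult[symmetric]) simp
    finally have "(1 + norm x) ^ N \<le> 2 ^ N * (real (N + 1) ^ (N + 1) * exp y)" by simp
    moreover have "cmod (gauss x) = inverse (exp y)"
      by (simp add: gauss_def y_def exp_minus[symmetric])
    ultimately have "(1 + norm x) ^ N * cmod (gauss x) = (1 + norm x) ^ N / exp y"
      and "(1 + norm x) ^ N \<le> (2 ^ N * real (N + 1) ^ (N + 1)) * exp y"
      by (simp_all only: divide_inverse mult.assoc)
    then show ?thesis by (simp only: pos_divide_le_eq[OF exp_gt_zero])
  qed
  then show "\<exists>C. \<forall>x :: real^'d. (1 + norm x) ^ N * cmod (gauss x) \<le> C" by blast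
qed

lemma schwartz_gauss: "gauss \<in> schwartz"
proof (rule schwartz_coinduct[where X = gauss_class])
  fix f :: "real^'a \<Rightarrow> complex" assume "f \<in> gauss_class"
  then show "(\<forall>x. f differentiable (at x)) \<and> rapid f \<and> (\<forall>i. partial i f \<in> gauss_class)"
  proof induction
    case base
    have "partial i gauss = (\<lambda>x :: real^'a. - 1 * (complex_of_real (x $ i) * gauss x) + 0 * gauss x)" for i
      by (rule ext, subst partial_eq[OF gauss_has_derivative]) (simp add: inner_axis)
    moreover have "(\<lambda>x :: real^'a. - 1 * (complex_of_real (x $ i) * gauss x) + 0 * gauss x) \<in> gauss_class" for i
      by (intro gauss_class.intros)
    ultimately have "partial i (gauss :: real^'a \<Rightarrow> complex) \<in> gauss_class" for i by (simp only:)
    then show ?case using gauss_has_derivative rapid_gauss differentiableI by blast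
  next
    case (coord f j)
    have "partial i (\<lambda>x. complex_of_real (x $ j) * f x) =
        (\<lambda>x. (if i = j then 1 else 0) * f x + 1 * (complex_of_real (x $ j) * partial i f x))" for i
      using partial_coord(2)[of f _ i j] coord.IH by auto
    moreover have "rapid (\<lambda>x. complex_of_real (x $ j) * f x)"
    proof (rule rapid_dominated[of f _ 1 1])
      fix x :: "real^'a"
      have "\<bar>x $ j\<bar> \<le> 1 + norm x" using component_le_norm_cart[of x j] by linarith
      then show "cmod (complex_of_real (x $ j) * f x) \<le> 1 * (1 + norm x) ^ 1 * cmod (f x)"
        by (simp add: norm_mult mult_right_mono)
    qed (use coord in blast)
    ultimately show ?case using coord
      by (simp only:) (intro conjI allI partial_coord(1) gauss_class.intros; blast)
  next
    case (lin f g a b)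
    have "partial i (\<lambda>x. a * f x + b * g x) = (\<lambda>x. a * partial i f x + b * partial i g x)" for i
      using partial_lin(2)[of f _ g] lin.IH by auto
    then show ?case using lin
      by (simp only:) (intro conjI allI partial_lin(1) rapid_lin gauss_class.intros; blast)
  qed
qed (rule gauss_class.base)

lemma gauss_1d:
  shows "integrable lborel (\<lambda>t. complex_of_real (exp (- t\<^sup>2 / 2)) * cis (a * t))"
    and "(LINT t|lborel. complex_of_real (exp (- t\<^sup>2 / 2)) * cis (a * t)) =
      complex_of_real (sqrt (2 * pi) * exp (- a\<^sup>2 / 2))"
proof -
  have c [measurable]: "(\<lambda>t. cis (a * t)) \<in> borel_measurable borel"
    by (intro borel_measurable_continuous_onI continuous_intros)
  have eq: "exp (- t\<^sup>2 / 2) = sqrt (2 * pi) * std_normal_density t" for t :: real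
    by (simp add: std_normal_density_def)
  have "integrable lborel (\<lambda>t. complex_of_real (sqrt (2 * pi) * std_normal_density t))"
    by (intro integrable_of_real integrable_mult_right integrable_normal_density) simp
  then have i: "integrable lborel (\<lambda>t. complex_of_real (exp (- t\<^sup>2 / 2)))" by (simp only: eq)
  show "integrable lborel (\<lambda>t. complex_of_real (exp (- t\<^sup>2 / 2)) * cis (a * t))"
    by (rule Bochner_Integration.integrable_bound[OF i]) (auto simp: norm_mult)
  have "complex_of_real (exp (- a\<^sup>2 / 2)) = char std_normal_distribution a"
    by (simp add: char_std_normal_distribution)
  also have "\<dots> = (LINT t|lborel. std_normal_density t *\<^sub>R cis (a * t))"
    unfolding char_def cis_conv_exp[symmetric] by (subst integral_density) auto
  finally have "complex_of_real (sqrt (2 * pi)) * complex_of_real (exp (- a\<^sup>2 / 2)) =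
     (LINT t|lborel. complex_of_real (sqrt (2 * pi)) * (std_normal_density t *\<^sub>R cis (a * t)))"
    by (simp only: integral_mult_right_zero)
  moreover have "(\<lambda>t. complex_of_real (exp (- t\<^sup>2 / 2)) * cis (a * t)) =
      (\<lambda>t. complex_of_real (sqrt (2 * pi)) * (std_normal_density t *\<^sub>R cis (a * t)))"
    unfolding eq by (simp add: scaleR_conv_of_real mult.assoc)
  ultimately show "(LINT t|lborel. complex_of_real (exp (- t\<^sup>2 / 2)) * cis (a * t)) =
      complex_of_real (sqrt (2 * pi) * exp (- a\<^sup>2 / 2))"
    by (simp only: of_real_mult)
qed

lemma fourier_gauss:
  fixes \<omega> :: "real^'d::finite"
  shows "fourier gauss \<omega> = complex_of_real (sqrt (2 * pi)) ^ CARD('d) * gauss \<omega>"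
proof -
  have prod: "gauss x * cis (- (\<omega> \<bullet> x)) =
     (\<Prod>b\<in>Basis. complex_of_real (exp (- (x \<bullet> b)\<^sup>2 / 2)) * cis (- (\<omega> \<bullet> b) * (x \<bullet> b)))"
    for \<omega> x :: "real^'d"
  proof -
    have n: "(norm x)\<^sup>2 = (\<Sum>b\<in>Basis. (x \<bullet> b)\<^sup>2)"
      unfolding power2_norm_eq_inner by (subst euclidean_inner) (simp add: power2_eq_square)
    have "gauss x * cis (- (\<omega> \<bullet> x)) =
        exp (complex_of_real (- (norm x)\<^sup>2 / 2) + \<i> * complex_of_real (- (\<omega> \<bullet> x)))"
      unfolding gauss_def cis_conv_exp exp_of_real[symmetric] by (simp only: exp_add)
    also have "complex_of_real (- (norm x)\<^sup>2 / 2) + \<i> * complex_of_real (- (\<omega> \<bullet> x)) =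
       (\<Sum>b\<in>Basis. complex_of_real (- (x \<bullet> b)\<^sup>2 / 2) + \<i> * complex_of_real (- (\<omega> \<bullet> b) * (x \<bullet> b)))"
      unfolding n by (subst euclidean_inner[of \<omega> x])
        (simp add: sum.distrib sum_negf sum_subtractf sum_divide_distrib sum_distrib_left)
    also have "exp \<dots> = (\<Prod>b\<in>Basis. exp (complex_of_real (- (x \<bullet> b)\<^sup>2 / 2) + \<i> * complex_of_real (- (\<omega> \<bullet> b) * (x \<bullet> b))))"
      by (rule exp_sum) simp
    also have "\<dots> = (\<Prod>b\<in>Basis. complex_of_real (exp (- (x \<bullet> b)\<^sup>2 / 2)) * cis (- (\<omega> \<bullet> b) * (x \<bullet> b)))"
      by (intro prod.cong refl) (simp only: exp_add cis_conv_exp exp_of_real)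
    finally show ?thesis .
  qed
  have "fourier gauss \<omega> = (\<Prod>b\<in>Basis. complex_of_real (sqrt (2 * pi) * exp (- (- (\<omega> \<bullet> b))\<^sup>2 / 2)))"
    unfolding fourier_cis prod
    by (subst integral_lborel_prod[OF gauss_1d(1)]) (simp only: gauss_1d(2))
  also have "\<dots> = complex_of_real (sqrt (2 * pi)) ^ CARD('d) * (gauss \<omega> * cis (- (0 \<bullet> \<omega>)))"
    unfolding inner_commute[of _ \<omega>]
    by (subst inner_commute, subst inner_commute[of 0 \<omega>])
      (use prod[where \<omega> = 0 and x = \<omega>] in \<open>simp add: prod.distrib\<close>)
  finally show ?thesis by simp
qed

text \<open>The double integral defining \<open>fourier (fourier f)\<close> does not converge absolutely. It is
  regularized by a wide Gaussian of parameter \<open>e n\<close>; the multiplication formula turns the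
  Gaussian into a narrow one that averages \<open>f\<close> around \<open>x\<close>, and both sides converge as
  \<open>e n \<rightarrow> 0\<close>.\<close>

theorem fourier_inversion:
  fixes f :: "real^'d::finite \<Rightarrow> complex"
  assumes f: "f \<in> schwartz"
  shows "fourier (fourier f) (- x) = complex_of_real (2 * pi) ^ CARD('d) * f x"
proof -
  define c where "c = complex_of_real (sqrt (2 * pi)) ^ CARD('d)"
  define e where "e n = 1 / real (Suc n)" for n
  have e: "0 < e n" "e \<longlonglongrightarrow> 0" for n
    using LIMSEQ_inverse_real_of_nat by (auto simp: e_def[abs_def] inverse_eq_divide)
  have [measurable]: "f \<in> borel_measurable borel" "gauss \<in> borel_measurable borel"
    "fourier f \<in> borel_measurable borel"
    by (auto intro: schwartz_measurable schwartz_gauss schwartz_fourier f)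
  define G where "G n \<omega> = cis (x \<bullet> \<omega>) * gauss (e n *\<^sub>R \<omega>)" for n \<omega>
  have G: "G n \<in> schwartz" for n
    unfolding G_def using schwartz_affine[OF schwartz_gauss, of "e n" 0] e(1)[of n]
    by (intro schwartz_cis) auto
  have FG: "fourier (G n) y = c * gauss ((1 / e n) *\<^sub>R (y - x)) / of_real (e n) ^ CARD('d)" for n y
    using fourier_dilate[of gauss "e n" "(1 / e n) *\<^sub>R (y - x)"] e(1)[of n]
    by (simp add: G_def[abs_def] fourier_mult_cis fourier_gauss c_def)
  have eq: "(LINT \<omega>|lborel. fourier f \<omega> * G n \<omega>) = (LINT z|lborel. f (x + e n *\<^sub>R z) * (c * gauss z))" for n
  proof -
    have [measurable]: "fourier (G n) \<in> borel_measurable borel"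
      by (intro schwartz_measurable schwartz_fourier G)
    have "(LINT \<omega>|lborel. fourier f \<omega> * G n \<omega>) = (LINT y|lborel. f y * fourier (G n) y)"
      by (intro fourier_multiplication schwartz_integrable f G)
    also have "\<dots> = \<bar>e n\<bar> ^ CARD('d) *\<^sub>R (LINT z|lborel. f (x + e n *\<^sub>R z) * fourier (G n) (x + e n *\<^sub>R z))"
      using e(1)[of n] by (subst integral_lborel_affine[where c = "e n" and t = x])
        auto
    also have "\<dots> = (LINT z|lborel. f (x + e n *\<^sub>R z) * (c * gauss z))"
      using e(1)[of n] by (subst integral_scaleR_right[symmetric])
        (simp add: FG scaleR_conv_of_real[where 'a=complex])
    finally show ?thesis .
  qed
  have "(\<lambda>n. LINT \<omega>|lborel. fourier f \<omega> * G n \<omega>) \<longlonglongrightarrow> (LINT \<omega>|lborel. fourier f \<omega> * cis (x \<bullet> \<omega>))"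
  proof (rule integral_dominated_convergence)
    show "integrable lborel (\<lambda>\<omega>. cmod (fourier f \<omega>))"
      by (intro integrable_norm schwartz_integrable schwartz_fourier f)
    show "AE \<omega> in lborel. (\<lambda>n. fourier f \<omega> * G n \<omega>) \<longlonglongrightarrow> fourier f \<omega> * cis (x \<bullet> \<omega>)"
    proof (rule AE_I2)
      fix \<omega>
      have "(\<lambda>n. fourier f \<omega> * (cis (x \<bullet> \<omega>) * complex_of_real (exp (- (norm (e n *\<^sub>R \<omega>))\<^sup>2 / 2)))) \<longlonglongrightarrow>
         fourier f \<omega> * (cis (x \<bullet> \<omega>) * complex_of_real (exp (- (norm (0 *\<^sub>R \<omega>))\<^sup>2 / 2)))"
        by (intro tendsto_intros e) simp
      then show "(\<lambda>n. fourier f \<omega> * G n \<omega>) \<longlonglongrightarrow> fourier f \<omega> * cis (x \<bullet> \<omega>)"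
        by (simp add: G_def gauss_def)
    qed
    show "AE \<omega> in lborel. norm (fourier f \<omega> * G n \<omega>) \<le> cmod (fourier f \<omega>)" for n
      by (intro AE_I2) (simp add: G_def gauss_def norm_mult mult_left_le)
  qed (auto simp: G_def)
  moreover have "(\<lambda>n. LINT z|lborel. f (x + e n *\<^sub>R z) * (c * gauss z)) \<longlonglongrightarrow>
      (LINT z|(lborel :: (real^'d) measure). f x * (c * gauss z))"
  proof -
    obtain B where B: "B \<ge> 0" "\<And>x. cmod (f x) \<le> B" using schwartz_bounded[OF f] by metis
    show ?thesis
    proof (rule integral_dominated_convergence[where w = "\<lambda>z. B * cmod (c * gauss z)"])
      show "integrable lborel (\<lambda>z :: real^'d. B * cmod (c * gauss z))"
        by (intro integrable_mult_right integrable_norm schwartz_integrable schwartz_gauss)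
      show "AE z in lborel. (\<lambda>n. f (x + e n *\<^sub>R z) * (c * gauss z)) \<longlonglongrightarrow> f x * (c * gauss z)"
      proof (rule AE_I2)
        fix z
        have "isCont f x" using differentiable_imp_continuous_within[OF schwartz_differentiable[OF f]] .
        moreover have "(\<lambda>n. x + e n *\<^sub>R z) \<longlonglongrightarrow> x + 0 *\<^sub>R z" by (intro tendsto_intros e)
        ultimately have "(\<lambda>n. f (x + e n *\<^sub>R z)) \<longlonglongrightarrow> f x" using isCont_tendsto_compose by fastforce
        then show "(\<lambda>n. f (x + e n *\<^sub>R z) * (c * gauss z)) \<longlonglongrightarrow> f x * (c * gauss z)"
          by (intro tendsto_intros)
      qed
      show "AE z in lborel. norm (f (x + e n *\<^sub>R z) * (c * gauss z)) \<le> B * cmod (c * gauss z)" for n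
        by (intro AE_I2) (simp add: norm_mult[of "f _"] mult_right_mono B)
    qed auto
  qed
  ultimately have "(LINT \<omega>|lborel. fourier f \<omega> * cis (x \<bullet> \<omega>)) = (LINT z|(lborel :: (real^'d) measure). f x * (c * gauss z))"
    unfolding eq by (rule LIMSEQ_unique)
  also have "\<dots> = f x * (c * fourier gauss (0 :: real^'d))"
    by (simp add: fourier_cis)
  also have "\<dots> = (c * c) * f x" by (simp add: fourier_gauss c_def gauss_def)
  also have "c * c = complex_of_real (2 * pi) ^ CARD('d)"
    unfolding c_def power_mult_distrib[symmetric] of_real_mult[symmetric] by simp
  finally show ?thesis by (simp add: fourier_cis)
qed

section \<open>Density of trigonometric polynomials\<close>

lemma norm_sq_add_le: "(norm (a + b))\<^sup>2 \<le> 2 * (norm a)\<^sup>2 + 2 * (norm b :: real)\<^sup>2"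
proof -
  have "(norm (a + b))\<^sup>2 \<le> (norm a + norm b)\<^sup>2" by (intro power_mono norm_triangle_ineq) simp
  also have "\<dots> \<le> 2 * (norm a)\<^sup>2 + 2 * (norm b)\<^sup>2"
    using zero_le_power2[of "norm a - norm b"] by (simp add: power2_sum power2_diff)
  finally show ?thesis .
qed

lemma nn_integral_norm_sq_add_le:
  fixes u v :: "'a \<Rightarrow> complex"
  assumes [measurable]: "u \<in> borel_measurable M" "v \<in> borel_measurable M" "w \<in> borel_measurable M"
  shows "(\<integral>\<^sup>+x. w x * ennreal ((cmod (u x + v x))\<^sup>2) \<partial>M) \<le>
    2 * (\<integral>\<^sup>+x. w x * ennreal ((cmod (u x))\<^sup>2) \<partial>M) + 2 * (\<integral>\<^sup>+x. w x * ennreal ((cmod (v x))\<^sup>2) \<partial>M)"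
proof -
  have "(\<integral>\<^sup>+x. w x * ennreal ((cmod (u x + v x))\<^sup>2) \<partial>M) \<le>
     (\<integral>\<^sup>+x. 2 * (w x * ennreal ((cmod (u x))\<^sup>2)) + 2 * (w x * ennreal ((cmod (v x))\<^sup>2)) \<partial>M)"
  proof (rule nn_integral_mono)
    fix x
    have "ennreal ((cmod (u x + v x))\<^sup>2) \<le> ennreal (2 * (cmod (u x))\<^sup>2 + 2 * (cmod (v x))\<^sup>2)"
      by (intro ennreal_leI norm_sq_add_le)
    also have "\<dots> = 2 * ennreal ((cmod (u x))\<^sup>2) + 2 * ennreal ((cmod (v x))\<^sup>2)"
      by (simp add: ennreal_mult)
    finally have "w x * ennreal ((cmod (u x + v x))\<^sup>2) \<le> w x * (2 * ennreal ((cmod (u x))\<^sup>2) + 2 * ennreal ((cmod (v x))\<^sup>2))"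
      by (rule mult_left_mono) simp
    then show "w x * ennreal ((cmod (u x + v x))\<^sup>2) \<le>
       2 * (w x * ennreal ((cmod (u x))\<^sup>2)) + 2 * (w x * ennreal ((cmod (v x))\<^sup>2))"
      by (simp add: distrib_left mult.left_commute)
  qed
  also have "\<dots> = 2 * (\<integral>\<^sup>+x. w x * ennreal ((cmod (u x))\<^sup>2) \<partial>M) + 2 * (\<integral>\<^sup>+x. w x * ennreal ((cmod (v x))\<^sup>2) \<partial>M)"
    by (simp add: nn_integral_add nn_integral_cmult)
  finally show ?thesis .
qed

lemma ennreal_pos_real:
  assumes "(e :: ennreal) > 0"
  obtains c where "c > 0" "ennreal c \<le> e"
proof (cases e)
  case (real r)
  with assms that[of r] show ?thesis by auto
next
  case top
  with that[of 1] show ?thesis by auto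
qed

lemma ennreal_quarters:
  assumes "a < ennreal (c / 4)" "b < ennreal (c / 4)" "c > 0"
  shows "2 * a + 2 * b < ennreal c"
proof -
  have "2 * a + 2 * b = (a + a) + (b + b)" by (simp add: mult_2)
  also have "\<dots> < (ennreal (c / 4) + ennreal (c / 4)) + (ennreal (c / 4) + ennreal (c / 4))"
    by (intro add_strict_mono assms)
  also have "\<dots> = ennreal c" using assms(3) by (simp flip: ennreal_plus)
  finally show ?thesis .
qed

text \<open>The class \<open>P\<close> itself need not consist of square integrable functions; only the
  differences are measured.\<close>

definition L2_closure :: "'a measure \<Rightarrow> ('a \<Rightarrow> complex) set \<Rightarrow> ('a \<Rightarrow> complex) set" where
  "L2_closure M P = {u \<in> borel_measurable M. \<forall>e>0. \<exists>p\<in>P. (\<integral>\<^sup>+x. ennreal ((cmod (u x - p x))\<^sup>2) \<partial>M) < e}"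

lemma L2_closureD:
  assumes "u \<in> L2_closure M P"
  shows "u \<in> borel_measurable M"
    and "e > 0 \<Longrightarrow> \<exists>p\<in>P. (\<integral>\<^sup>+x. ennreal ((cmod (u x - p x))\<^sup>2) \<partial>M) < e"
  using assms by (auto simp: L2_closure_def)

lemma L2_closure_closure:
  assumes u: "u \<in> borel_measurable M" and P: "P \<subseteq> borel_measurable M"
    and ex: "\<And>e :: ennreal. e > 0 \<Longrightarrow> \<exists>v\<in>L2_closure M P. (\<integral>\<^sup>+x. ennreal ((cmod (u x - v x))\<^sup>2) \<partial>M) < e"
  shows "u \<in> L2_closure M P"
  unfolding L2_closure_def
proof (intro CollectI conjI u allI impI)
  fix e :: ennreal assume e: "e > 0"
  then obtain c :: real where c: "c > 0" "ennreal c \<le> e" by (rule ennreal_pos_real)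
  then have e4: "ennreal (c / 4) > 0" by simp
  from ex[OF this] obtain v where v: "v \<in> L2_closure M P"
    "(\<integral>\<^sup>+x. ennreal ((cmod (u x - v x))\<^sup>2) \<partial>M) < ennreal (c / 4)" by blast
  then obtain p where p: "p \<in> P" "(\<integral>\<^sup>+x. ennreal ((cmod (v x - p x))\<^sup>2) \<partial>M) < ennreal (c / 4)"
    using L2_closureD(2)[OF v(1) e4] by blast
  have [measurable]: "u \<in> borel_measurable M" "v \<in> borel_measurable M" "p \<in> borel_measurable M"
    using u v p P by (auto simp: L2_closure_def)
  have "(\<integral>\<^sup>+x. ennreal ((cmod (u x - p x))\<^sup>2) \<partial>M) \<le>
    2 * (\<integral>\<^sup>+x. ennreal ((cmod (u x - v x))\<^sup>2) \<partial>M) + 2 * (\<integral>\<^sup>+x. ennreal ((cmod (v x - p x))\<^sup>2) \<partial>M)"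
    using nn_integral_norm_sq_add_le[of "\<lambda>x. u x - v x" M "\<lambda>x. v x - p x" "\<lambda>_. 1"] by simp
  also have "\<dots> < ennreal c" by (intro ennreal_quarters v p c)
  also note c(2)
  finally show "\<exists>p\<in>P. (\<integral>\<^sup>+x. ennreal ((cmod (u x - p x))\<^sup>2) \<partial>M) < e" using p(1) by blast
qed

text \<open>Dominated convergence, for sequences in the closure.\<close>

lemma L2_closure_limit:
  assumes u: "u \<in> borel_measurable M" and P: "P \<subseteq> borel_measurable M"
    and s: "\<And>n. s n \<in> L2_closure M P" and lim: "AE x in M. (\<lambda>n. s n x) \<longlonglongrightarrow> u x"
    and bound: "\<And>n. AE x in M. (cmod (u x - s n x))\<^sup>2 \<le> w x"
    and w: "w \<in> borel_measurable M" "(\<integral>\<^sup>+x. ennreal (w x) \<partial>M) < \<infinity>"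
  shows "u \<in> L2_closure M P"
proof (rule L2_closure_closure[OF u P])
  have [measurable]: "u \<in> borel_measurable M" "s n \<in> borel_measurable M" for n
    using u s by (auto simp: L2_closure_def)
  have "(\<lambda>n. \<integral>\<^sup>+x. ennreal ((cmod (u x - s n x))\<^sup>2) \<partial>M) \<longlonglongrightarrow> (\<integral>\<^sup>+x. 0 \<partial>M)"
  proof (rule nn_integral_dominated_convergence[OF _ _ _ _ w(2)])
    show "AE x in M. ennreal ((cmod (u x - s n x))\<^sup>2) \<le> ennreal (w x)" for n
      using bound[of n] by eventually_elim (rule ennreal_leI)
    show "AE x in M. (\<lambda>n. ennreal ((cmod (u x - s n x))\<^sup>2)) \<longlonglongrightarrow> 0"
      using lim
    proof eventually_elim
      fix x assume "(\<lambda>n. s n x) \<longlonglongrightarrow> u x"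
      then have "(\<lambda>n. (cmod (u x - s n x))\<^sup>2) \<longlonglongrightarrow> (cmod (u x - u x))\<^sup>2" by (intro tendsto_intros)
      from tendsto_ennrealI[OF this] show "(\<lambda>n. ennreal ((cmod (u x - s n x))\<^sup>2)) \<longlonglongrightarrow> 0" by simp
    qed
  qed (use w in auto)
  then have lim0: "(\<lambda>n. \<integral>\<^sup>+x. ennreal ((cmod (u x - s n x))\<^sup>2) \<partial>M) \<longlonglongrightarrow> 0" by simp
  fix e :: ennreal assume "e > 0"
  from order_tendstoD(2)[OF lim0 this] obtain n where "(\<integral>\<^sup>+x. ennreal ((cmod (u x - s n x))\<^sup>2) \<partial>M) < e"
    by (auto simp: eventually_sequentially)
  then show "\<exists>v\<in>L2_closure M P. (\<integral>\<^sup>+x. ennreal ((cmod (u x - v x))\<^sup>2) \<partial>M) < e" using s by blast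
qed

lemma L2_closure_add:
  assumes P: "P \<subseteq> borel_measurable M" and add: "\<And>p q. p \<in> P \<Longrightarrow> q \<in> P \<Longrightarrow> (\<lambda>x. p x + q x) \<in> P"
    and u: "u \<in> L2_closure M P" and v: "v \<in> L2_closure M P"
  shows "(\<lambda>x. u x + v x) \<in> L2_closure M P"
proof -
  have [measurable]: "u \<in> borel_measurable M" "v \<in> borel_measurable M"
    using u v by (auto simp: L2_closure_def)
  show ?thesis
    unfolding L2_closure_def
  proof (intro CollectI conjI allI impI)
    fix e :: ennreal assume e: "e > 0"
    then obtain c :: real where c: "c > 0" "ennreal c \<le> e" by (rule ennreal_pos_real)
    then have e4: "ennreal (c / 4) > 0" by simp
    then obtain p q where p: "p \<in> P" "(\<integral>\<^sup>+x. ennreal ((cmod (u x - p x))\<^sup>2) \<partial>M) < ennreal (c / 4)"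
      and q: "q \<in> P" "(\<integral>\<^sup>+x. ennreal ((cmod (v x - q x))\<^sup>2) \<partial>M) < ennreal (c / 4)"
      using L2_closureD(2)[OF u e4] L2_closureD(2)[OF v e4] by blast
    have [measurable]: "p \<in> borel_measurable M" "q \<in> borel_measurable M" using p q P by auto
    have "(\<integral>\<^sup>+x. ennreal ((cmod (u x + v x - (p x + q x)))\<^sup>2) \<partial>M) \<le>
      2 * (\<integral>\<^sup>+x. ennreal ((cmod (u x - p x))\<^sup>2) \<partial>M) + 2 * (\<integral>\<^sup>+x. ennreal ((cmod (v x - q x))\<^sup>2) \<partial>M)"
      using nn_integral_norm_sq_add_le[of "\<lambda>x. u x - p x" M "\<lambda>x. v x - q x" "\<lambda>_. 1"] by (simp add: algebra_simps)
    also have "\<dots> < ennreal c" by (intro ennreal_quarters q p c)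
    also note c(2)
    finally show "\<exists>p\<in>P. (\<integral>\<^sup>+x. ennreal ((cmod (u x + v x - p x))\<^sup>2) \<partial>M) < e"
      by (intro bexI[OF _ add[OF p(1) q(1)]])
  qed simp
qed

lemma L2_closure_cmult:
  assumes P: "P \<subseteq> borel_measurable M" and cmult: "\<And>p a. p \<in> P \<Longrightarrow> (\<lambda>x. a * p x) \<in> P"
    and u: "u \<in> L2_closure M P"
  shows "(\<lambda>x. a * u x) \<in> L2_closure M P"
proof -
  have [measurable]: "u \<in> borel_measurable M" using u by (auto simp: L2_closure_def)
  show ?thesis
    unfolding L2_closure_def
  proof (intro CollectI conjI allI impI)
    fix e :: ennreal assume e: "e > 0"
    then obtain c :: real where c: "c > 0" "ennreal c \<le> e" by (rule ennreal_pos_real)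
    define d where "d = c / ((cmod a)\<^sup>2 + 1)"
    have d: "d > 0" using c by (simp add: d_def add_nonneg_pos)
    then have "ennreal d > 0" by simp
    then obtain p where p: "p \<in> P" "(\<integral>\<^sup>+x. ennreal ((cmod (u x - p x))\<^sup>2) \<partial>M) < ennreal d"
      using u unfolding L2_closure_def by blast
    have [measurable]: "p \<in> borel_measurable M" using p P by auto
    have "(\<integral>\<^sup>+x. ennreal ((cmod (a * u x - a * p x))\<^sup>2) \<partial>M) =
        ennreal ((cmod a)\<^sup>2) * (\<integral>\<^sup>+x. ennreal ((cmod (u x - p x))\<^sup>2) \<partial>M)"
      by (subst nn_integral_cmult[symmetric])
        (auto simp: right_diff_distrib[symmetric] norm_mult power_mult_distrib ennreal_mult)
    also have "\<dots> \<le> ennreal ((cmod a)\<^sup>2) * ennreal d" using p by (intro mult_left_mono) auto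
    also have "\<dots> = ennreal ((cmod a)\<^sup>2 * d)" using d by (simp add: ennreal_mult)
    also have "\<dots> < ennreal c"
    proof (rule ennreal_lessI[OF c(1)])
      have "(cmod a)\<^sup>2 * d < ((cmod a)\<^sup>2 + 1) * d" using d by (intro mult_strict_right_mono) auto
      also have "\<dots> = c" using add_nonneg_pos[of "(cmod a)\<^sup>2" 1] by (simp add: d_def)
      finally show "(cmod a)\<^sup>2 * d < c" .
    qed
    also note c(2)
    finally show "\<exists>p\<in>P. (\<integral>\<^sup>+x. ennreal ((cmod (a * u x - p x))\<^sup>2) \<partial>M) < e"
      by (intro bexI[OF _ cmult[OF p(1)]])
  qed simp
qed

lemma L2_closure_refl:
  assumes "P \<subseteq> borel_measurable M" "p \<in> P"
  shows "p \<in> L2_closure M P"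
  using assms by (auto simp: L2_closure_def intro!: bexI[of _ p])

lemma polynomial_function_cmult_complex:
  fixes f :: "'a::euclidean_space \<Rightarrow> complex"
  assumes "polynomial_function f"
  shows "polynomial_function (\<lambda>x. a * f x)"
  using polynomial_function_compose[OF assms polynomial_function_bounded_linear[OF bounded_linear_mult_right[of a]]]
  by (simp add: o_def)

text \<open>By the Stone--Weierstrass theorem the closure contains all continuous functions, hence the
  indicators of closed sets as bounded limits of such functions. The sets whose indicators lie in
  the closure are stable under complements and disjoint unions, so all Borel sets are among them.\<close>

lemma polynomial_L2_closure_indicator:
  fixes M :: "'a::euclidean_space measure"
  assumes fin: "finite_measure M" and sets: "sets M = sets borel"
    and K: "compact K" "AE x in M. x \<in> K" and A: "A \<in> sets borel"
  shows "(\<lambda>x. indicator A x :: complex) \<in> L2_closure M (Collect polynomial_function)"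
proof -
  interpret finite_measure M by fact
  let ?P = "Collect polynomial_function :: ('a \<Rightarrow> complex) set"
  have bm [simp]: "borel_measurable M = (borel_measurable borel :: ('a \<Rightarrow> complex) set)"
    using measurable_cong_sets[OF sets refl] .
  have P: "?P \<subseteq> borel_measurable M"
    by (auto intro!: borel_measurable_continuous_onI continuous_on_polymonial_function)
  have cont: "f \<in> L2_closure M ?P" if f: "continuous_on UNIV f" for f :: "'a \<Rightarrow> complex"
    unfolding L2_closure_def
  proof (intro CollectI conjI allI impI)
    show "f \<in> borel_measurable M" using f by (simp add: borel_measurable_continuous_onI)
    fix e :: ennreal assume e: "e > 0"
    then obtain c :: real where c: "c > 0" "ennreal c \<le> e" by (rule ennreal_pos_real)
    define m where "m = measure M (space M) + 1"
    have m: "m > 0" by (simp add: m_def add_nonneg_pos)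
    define d where "d = sqrt (c / m)"
    have d: "d > 0" using c m by (simp add: d_def)
    obtain p where p: "polynomial_function p" "\<And>x. x \<in> K \<Longrightarrow> norm (f x - p x) < d"
      using Stone_Weierstrass_polynomial_function[OF K(1) continuous_on_subset[OF f] d] by blast
    have "(\<integral>\<^sup>+x. ennreal ((cmod (f x - p x))\<^sup>2) \<partial>M) \<le> (\<integral>\<^sup>+x. ennreal (d\<^sup>2) \<partial>M)"
      using K(2) by (intro nn_integral_mono_AE, eventually_elim)
        (auto intro!: ennreal_leI power_mono less_imp_le[OF p(2)])
    also have "\<dots> = ennreal (d\<^sup>2 * measure M (space M))"
      by (simp add: emeasure_eq_measure ennreal_mult)
    also have "\<dots> < ennreal c"
    proof (rule ennreal_lessI[OF c(1)])
      have "d\<^sup>2 * measure M (space M) < d\<^sup>2 * m" using d by (simp add: m_def)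
      also have "\<dots> = c" using c m by (simp add: d_def)
      finally show "d\<^sup>2 * measure M (space M) < c" .
    qed
    also note c(2)
    finally show "\<exists>p\<in>?P. (\<integral>\<^sup>+x. ennreal ((cmod (f x - p x))\<^sup>2) \<partial>M) < e" using p(1) by blast
  qed
  have fin1: "(\<integral>\<^sup>+x. ennreal (c :: real) \<partial>M) < \<infinity>" for c
    by (simp add: ennreal_mult_less_top emeasure_eq_measure)
  have "Int_stable (Collect closed :: 'a set set)" by (auto simp: Int_stable_def)
  moreover have "Collect closed \<subseteq> Pow (UNIV :: 'a set)" by simp
  moreover have "A \<in> sigma_sets UNIV (Collect closed)"
    using A unfolding borel_eq_closed by simp
  ultimately show ?thesis
  proof (induction rule: sigma_sets_induct_disjoint)
    case (basic A)
    then have cl: "closed A" by simp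
    show ?case
    proof (cases "A = {}")
      case True
      then show ?thesis by (simp add: L2_closure_refl[OF P])
    next
      case False
      define f where "f n x = complex_of_real (max 0 (1 - real n * infdist x A))" for n x
      have f: "f n \<in> L2_closure M ?P" for n
        unfolding f_def by (intro cont continuous_intros)
      show ?thesis
      proof (rule L2_closure_limit[OF _ P f])
        show "(\<lambda>x. indicator A x :: complex) \<in> borel_measurable M" using cl by simp
        show "AE x in M. (\<lambda>n. f n x) \<longlonglongrightarrow> indicator A x"
        proof (rule AE_I2)
          fix x
          show "(\<lambda>n. f n x) \<longlonglongrightarrow> indicator A x"
          proof (cases "x \<in> A")
            case True
            then show ?thesis by (simp add: f_def)
          next
            case nA: False
            then have pos: "infdist x A > 0"
              using in_closed_iff_infdist_zero[OF cl False, of x] infdist_nonneg[of x A] by linarith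
            obtain N where N: "1 / infdist x A < real N" using reals_Archimedean2 by blast
            have "f n x = 0" if "n \<ge> N" for n
            proof -
              have "1 / infdist x A < real n" using N that by linarith
              then have "1 < real n * infdist x A" using pos by (simp add: field_simps)
              then show ?thesis by (simp add: f_def)
            qed
            then have "eventually (\<lambda>n. f n x = indicator A x) sequentially"
              using nA by (auto simp: eventually_sequentially)
            then show ?thesis by (rule tendsto_eventually)
          qed
        qed
        show "AE x in M. (cmod (indicator A x - f n x))\<^sup>2 \<le> 1" for n
        proof (rule AE_I2)
          fix x
          have *: "0 \<le> max 0 (1 - real n * infdist x A)" "max 0 (1 - real n * infdist x A) \<le> 1"
            by (auto simp: infdist_nonneg)
          have "cmod (indicator A x - f n x) \<le> 1"
          proof (cases "x \<in> A")
            case True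
            then show ?thesis by (simp add: f_def)
          next
            case False
            obtain m where "f n x = of_real m" "0 \<le> m" "m \<le> 1" using * f_def by blast
            then show ?thesis using False by simp
          qed
          then show "(cmod (indicator A x - f n x))\<^sup>2 \<le> 1" by (simp add: power_le_one)
        qed
        show "(\<integral>\<^sup>+x. ennreal 1 \<partial>M) < \<infinity>" by (rule fin1)
      qed simp
    qed
  next
    case empty
    show ?case by (simp add: L2_closure_refl[OF P])
  next
    case (compl A)
    have "(\<lambda>x. 1 + (- 1) * indicator A x) \<in> L2_closure M ?P"
      by (intro L2_closure_add[OF P] L2_closure_cmult[OF P] L2_closure_refl[OF P] compl.IH)
        (auto intro: polynomial_function_cmult_complex)
    moreover have "(\<lambda>x. 1 + (- 1) * indicator A x) = (indicator (UNIV - A) :: 'a \<Rightarrow> complex)"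
      by (auto simp: indicator_def)
    ultimately show ?case by simp
  next
    case (union A)
    have A: "A i \<in> sets borel" for i using union.hyps(2) unfolding borel_eq_closed by auto
    have s: "(\<lambda>x. \<Sum>i<n. indicator (A i) x) \<in> L2_closure M ?P" for n
    proof (induction n)
      case 0
      show ?case by (simp add: L2_closure_refl[OF P])
    next
      case (Suc n)
      then show ?case by (simp, intro L2_closure_add[OF P] union.IH) (auto intro: polynomial_function_add)
    qed
    have s_eq: "(\<Sum>i<n. indicator (A i) x) = (indicator (\<Union>i<n. A i) x :: complex)" for n x
      using union.hyps(1) by (subst indicator_UN_disjoint) (auto simp: disjoint_family_on_def)
    show ?case
    proof (rule L2_closure_limit[OF _ P s])
      show "(\<lambda>x. indicator (\<Union> (range A)) x :: complex) \<in> borel_measurable M" using A by simp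
      show "AE x in M. (\<lambda>n. \<Sum>i<n. indicator (A i) x) \<longlonglongrightarrow> (indicator (\<Union> (range A)) x :: complex)"
      proof (rule AE_I2)
        fix x
        show "(\<lambda>n. \<Sum>i<n. indicator (A i) x) \<longlonglongrightarrow> (indicator (\<Union> (range A)) x :: complex)"
          unfolding s_eq by (rule LIMSEQ_indicator_UN)
      qed
      show "AE x in M. (cmod (indicator (\<Union> (range A)) x - (\<Sum>i<n. indicator (A i) x)))\<^sup>2 \<le> 1" for n
        unfolding s_eq by (rule AE_I2) (simp add: indicator_def)
      show "(\<integral>\<^sup>+x. ennreal 1 \<partial>M) < \<infinity>" by (rule fin1)
    qed simp
  qed
qed

theorem polynomial_L2_dense:
  fixes M :: "'a::euclidean_space measure" and u :: "'a \<Rightarrow> complex"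
  assumes fin: "finite_measure M" and sets: "sets M = sets borel"
    and K: "compact K" "AE x in M. x \<in> K"
    and u [measurable]: "u \<in> borel_measurable borel" and L2: "(\<integral>\<^sup>+x. ennreal ((cmod (u x))\<^sup>2) \<partial>M) < \<infinity>"
  shows "u \<in> L2_closure M (Collect polynomial_function)"
proof -
  let ?P = "Collect polynomial_function :: ('a \<Rightarrow> complex) set"
  have bm [simp]: "borel_measurable M = (borel_measurable borel :: ('a \<Rightarrow> complex) set)"
    "borel_measurable M = (borel_measurable borel :: ('a \<Rightarrow> real) set)"
    using measurable_cong_sets[OF sets refl] by auto
  have space: "space M = UNIV" using sets_eq_imp_space_eq[OF sets] by simp
  have P: "?P \<subseteq> borel_measurable M"
    by (auto intro!: borel_measurable_continuous_onI continuous_on_polymonial_function)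
  obtain s where s: "\<And>i. simple_function M (s i)" "\<And>x. (\<lambda>i. s i x) \<longlonglongrightarrow> u x"
    "\<And>i x. dist (s i x) 0 \<le> 2 * dist (u x) 0"
    using borel_measurable_implies_sequence_metric[of u M 0] space by auto
  have cl: "s i \<in> L2_closure M ?P" for i
  proof -
    have fin_im: "finite (range (s i))" using simple_functionD(1)[OF s(1)[of i]] space by simp
    have "(\<lambda>x. \<Sum>y\<in>Y. y * indicator (s i -` {y}) x) \<in> L2_closure M ?P" if "finite Y" for Y
      using that
    proof induction
      case empty
      show ?case by (simp add: L2_closure_refl[OF P])
    next
      case (insert y Y)
      have "s i -` {y} \<in> sets borel"
        using simple_functionD(2)[OF s(1)[of i], of "{y}"] space sets by simp
      note ind = polynomial_L2_closure_indicator[OF fin sets K this]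
      have "(\<lambda>x. y * indicator (s i -` {y}) x + (\<Sum>y\<in>Y. y * indicator (s i -` {y}) x)) \<in> L2_closure M ?P"
        by (intro L2_closure_add[OF P] L2_closure_cmult[OF P] ind insert.IH)
          (auto intro: polynomial_function_add polynomial_function_cmult_complex)
      then show ?case unfolding sum.insert[OF insert.hyps] .
    qed
    from this[OF fin_im] have "(\<lambda>x. \<Sum>y\<in>range (s i). y * indicator (s i -` {y}) x) \<in> L2_closure M ?P" .
    moreover have "(\<lambda>x. \<Sum>y\<in>range (s i). y * indicator (s i -` {y}) x) = s i"
    proof
      fix x
      show "(\<Sum>y\<in>range (s i). y * indicator (s i -` {y}) x) = s i x"
        by (subst sum.remove[OF fin_im, of "s i x"]) (auto simp: indicator_def intro!: sum.neutral)
    qed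
    ultimately show ?thesis by simp
  qed
  have fin9: "(\<integral>\<^sup>+x. ennreal (9 * (cmod (u x))\<^sup>2) \<partial>M) < \<infinity>"
  proof -
    have "(\<integral>\<^sup>+x. ennreal (9 * (cmod (u x))\<^sup>2) \<partial>M) = 9 * (\<integral>\<^sup>+x. ennreal ((cmod (u x))\<^sup>2) \<partial>M)"
      by (subst nn_integral_cmult[symmetric]) (auto simp: ennreal_mult)
    then show ?thesis using L2 by (simp add: ennreal_mult_less_top)
  qed
  have le9: "(cmod (u x - s n x))\<^sup>2 \<le> 9 * (cmod (u x))\<^sup>2" for n x
  proof -
    have "cmod (u x - s n x) \<le> 3 * cmod (u x)"
      using norm_triangle_ineq4[of "u x" "s n x"] s(3)[of n x] by simp
    then have "(cmod (u x - s n x))\<^sup>2 \<le> (3 * cmod (u x))\<^sup>2" by (intro power_mono) auto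
    then show ?thesis by (simp add: power_mult_distrib)
  qed
  show ?thesis
  proof (rule L2_closure_limit[OF _ P, where s = s and w = "\<lambda>x. 9 * (cmod (u x))\<^sup>2"])
    show "u \<in> borel_measurable M" unfolding bm by (rule u)
    show "(\<lambda>x. 9 * (cmod (u x))\<^sup>2) \<in> borel_measurable M" unfolding bm by measurable
  qed (use s(2) cl fin9 le9 in \<open>auto\<close>)
qed

text \<open>Trigonometric polynomials of period \<open>2 \<pi> / r\<close> are the polynomials composed with this map
  onto the torus.\<close>

definition torus :: "real \<Rightarrow> real^'d::finite \<Rightarrow> complex^'d" where
  "torus r x = (\<chi> i. cis (r * x $ i))"

inductive_set trig :: "real \<Rightarrow> (real^'d::finite \<Rightarrow> complex) set" for r where
  const: "(\<lambda>x. a) \<in> trig r"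
| char: "(\<lambda>x. cis (r * x $ i)) \<in> trig r"
| char_uminus: "(\<lambda>x. cis (- (r * x $ i))) \<in> trig r"
| add: "p \<in> trig r \<Longrightarrow> q \<in> trig r \<Longrightarrow> (\<lambda>x. p x + q x) \<in> trig r"
| mult: "p \<in> trig r \<Longrightarrow> q \<in> trig r \<Longrightarrow> (\<lambda>x. p x * q x) \<in> trig r"

lemma trig_sum: "finite I \<Longrightarrow> (\<And>i. i \<in> I \<Longrightarrow> p i \<in> trig r) \<Longrightarrow> (\<lambda>x. \<Sum>i\<in>I. p i x) \<in> trig r"
  by (induction I rule: finite_induct) (auto intro: trig.intros)

lemma trig_measurable: "p \<in> trig r \<Longrightarrow> p \<in> borel_measurable borel"
proof (induction rule: trig.induct)
  case (char i)
  then show ?case by (intro borel_measurable_continuous_onI continuous_intros)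
next
  case (char_uminus i)
  then show ?case by (intro borel_measurable_continuous_onI continuous_intros)
qed auto

lemma torus_measurable [measurable]: "torus r \<in> borel_measurable borel"
  unfolding torus_def
  by (intro borel_measurable_continuous_onI continuous_intros)

lemma trig_real_polynomial:
  fixes p :: "complex^'d::finite \<Rightarrow> real"
  assumes "real_polynomial_function p"
  shows "(\<lambda>x. complex_of_real (p (torus r x))) \<in> trig r"
  using assms
proof induction
  case (linear f)
  interpret f: bounded_linear f by fact
  have b: "(\<lambda>x :: real^'d. complex_of_real (torus r x \<bullet> b)) \<in> trig r" if "b \<in> Basis" for b
  proof -
    obtain i u where b: "b = axis i u" "u = 1 \<or> u = \<i>"
      using \<open>b \<in> Basis\<close> by (auto simp: Basis_vec_def Basis_complex_def)
    have eq: "complex_of_real (torus r x \<bullet> b) = complex_of_real (cis (r * x $ i) \<bullet> u)" for x :: "real^'d"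
      by (simp add: b(1) inner_axis torus_def)
    show ?thesis
    proof (cases "u = 1")
      case True
      have "complex_of_real (cis (r * x $ i) \<bullet> u) = (1 / 2) * (cis (r * x $ i) + cis (- (r * x $ i)))" for x :: "real^'d"
        by (simp add: True complex_eq_iff inner_complex_def)
      then show ?thesis unfolding eq by (simp only:) (intro trig.intros)
    next
      case False
      then have u: "u = \<i>" using b by simp
      have "complex_of_real (cis (r * x $ i) \<bullet> u) = (- \<i> / 2) * (cis (r * x $ i) + (- 1) * cis (- (r * x $ i)))" for x :: "real^'d"
        by (simp add: u complex_eq_iff inner_complex_def)
      then show ?thesis unfolding eq by (simp only:) (intro trig.intros)
    qed
  qed
  have "f z = (\<Sum>b\<in>Basis. f b * (z \<bullet> b))" for z
    by (subst euclidean_representation[of z, symmetric]) (simp add: f.sum f.scaleR mult.commute del: euclidean_representation)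
  then have "(\<lambda>x. complex_of_real (f (torus r x))) =
      (\<lambda>x. \<Sum>b\<in>Basis. complex_of_real (f b) * complex_of_real (torus r x \<bullet> b))"
    by (metis (no_types, lifting) of_real_mult of_real_sum sum.cong)
  also have "\<dots> \<in> trig r" by (intro trig_sum trig.mult trig.const b) auto
  finally show ?case .
qed (auto intro: trig.intros)

lemma trig_polynomial:
  fixes p :: "complex^'d::finite \<Rightarrow> complex"
  assumes "polynomial_function p"
  shows "(\<lambda>x. p (torus r x)) \<in> trig r"
proof -
  have "real_polynomial_function (Re \<circ> p)" "real_polynomial_function (Im \<circ> p)"
    using assms bounded_linear_Re bounded_linear_Im unfolding polynomial_function_def by blast+
  from this[THEN trig_real_polynomial, of r]
  have "(\<lambda>x. complex_of_real (Re (p (torus r x))) + \<i> * complex_of_real (Im (p (torus r x)))) \<in> trig r"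
    by (intro trig.intros) (auto simp: o_def)
  then show ?thesis by (simp add: complex_eq[symmetric])
qed

text \<open>The push-forward of the measure to the torus is a finite measure with compact support, on
  which polynomials are dense.\<close>

theorem trig_L2_dense:
  fixes M :: "(real^'d::finite) measure" and u :: "complex^'d \<Rightarrow> complex"
  assumes fin: "finite_measure M" and sets [measurable_cong, simp]: "sets M = sets borel"
    and u [measurable]: "u \<in> borel_measurable borel"
    and L2: "(\<integral>\<^sup>+x. ennreal ((cmod (u (torus r x)))\<^sup>2) \<partial>M) < \<infinity>" and e: "(e :: ennreal) > 0"
  shows "\<exists>p\<in>trig r. (\<integral>\<^sup>+x. ennreal ((cmod (u (torus r x) - p x))\<^sup>2) \<partial>M) < e"
proof -
  interpret finite_measure M by fact
  define N where "N = distr M borel (torus r :: real^'d \<Rightarrow> complex^'d)"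
  have fN: "finite_measure N" unfolding N_def by (rule finite_measure_distr) measurable
  have sN: "sets N = sets borel" by (simp add: N_def)
  have K: "compact (cball 0 (real CARD('d)) :: (complex^'d) set)" by simp
  have AE: "AE z in N. z \<in> cball 0 (real CARD('d))"
    unfolding N_def
  proof (subst AE_distr_iff)
    have "norm (torus r x) \<le> real CARD('d)" for x :: "real^'d"
    proof -
      have "norm (torus r x) \<le> (\<Sum>i\<in>UNIV. norm (torus r x $ i))" unfolding norm_vec_def by (rule L2_set_le_sum) simp
      also have "\<dots> = real CARD('d)" by (simp add: torus_def)
      finally show ?thesis .
    qed
    then show "AE x in M. torus r x \<in> cball 0 (real CARD('d))" by simp
  qed auto
  have "u \<in> L2_closure N (Collect polynomial_function)"
    by (rule polynomial_L2_dense[OF fN sN K AE u]) (use L2 in \<open>simp add: N_def nn_integral_distr\<close>)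
  from L2_closureD(2)[OF this e] obtain p where p: "polynomial_function p"
    "(\<integral>\<^sup>+x. ennreal ((cmod (u x - p x))\<^sup>2) \<partial>N) < e" by blast
  have [measurable]: "p \<in> borel_measurable borel"
    by (intro borel_measurable_continuous_onI continuous_on_polymonial_function p)
  show ?thesis
    using p(2) trig_polynomial[OF p(1), of r] by (auto simp: N_def nn_integral_distr)
qed

text \<open>A Borel inverse of \<open>torus 1\<close>, from the part of the torus where all coordinates have
  positive real part to the cube of half side \<open>\<pi> / 2\<close>. The default \<open>2\<close> exceeds \<open>\<pi> / 2\<close>, which marks the points outside this
  part.\<close>

definition unwrap :: "complex^'d::finite \<Rightarrow> real^'d" where
  "unwrap z = (\<chi> i. if Re (z $ i) > 0 then arctan (Im (z $ i) / Re (z $ i)) else 2)"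

lemma unwrap_measurable [measurable]: "unwrap \<in> borel_measurable borel"
proof -
  have [measurable]: "(\<lambda>z :: complex^'d. Re (z $ i)) \<in> borel_measurable borel"
    "(\<lambda>z :: complex^'d. Im (z $ i)) \<in> borel_measurable borel" "arctan \<in> borel_measurable borel" for i
    by (intro borel_measurable_continuous_onI continuous_intros)+
  have "(\<lambda>z :: complex^'d. if Re (z $ i) > 0 then arctan (Im (z $ i) / Re (z $ i)) else 2) \<in> borel_measurable borel" for i
    by measurable
  then show ?thesis
    by (subst borel_measurable_euclidean_space) (auto simp: Basis_vec_def inner_axis unwrap_def)
qed

lemma unwrap_torus:
  assumes "\<And>i. \<bar>r * x $ i\<bar> < pi / 2"
  shows "unwrap (torus r x) = r *\<^sub>R x"
proof -
  have "cos (r * x $ i) > 0" "arctan (sin (r * x $ i) / cos (r * x $ i)) = r * x $ i" for i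
    using assms[of i] arctan_tan[of "r * x $ i"] by (auto simp: tan_def abs_less_iff intro!: cos_gt_zero_pi)
  then show ?thesis by (simp add: unwrap_def torus_def vec_eq_iff)
qed

lemma unwrap_torus_periodic:
  assumes "\<And>i. \<bar>unwrap (torus 1 x) $ i\<bar> < pi / 2"
  shows "\<exists>n :: int. x $ i - unwrap (torus 1 x) $ i = 2 * pi * of_int n"
proof -
  have pos: "cos (x $ i) > 0"
  proof (rule ccontr)
    assume "\<not> cos (x $ i) > 0"
    then have "unwrap (torus 1 x) $ i = 2" by (simp add: unwrap_def torus_def)
    then show False using assms[of i] pi_less_4 by simp
  qed
  define t where "t = sin (x $ i) / cos (x $ i)"
  have un: "unwrap (torus 1 x) $ i = arctan t" using pos by (simp add: unwrap_def torus_def t_def)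
  have "1 + t\<^sup>2 = 1 / (cos (x $ i))\<^sup>2"
    using pos sin_cos_squared_add[of "x $ i"] by (simp add: t_def power_divide field_simps)
  then have s: "sqrt (1 + t\<^sup>2) = 1 / cos (x $ i)" using pos by (simp add: real_sqrt_divide)
  have "cos (arctan t) = cos (x $ i)" unfolding cos_arctan s by simp
  moreover have "sin (arctan t) = sin (x $ i)" unfolding sin_arctan s using pos by (simp add: t_def)
  ultimately obtain n :: int where "x $ i = arctan t + 2 * pi * of_int n"
    using sin_cos_eq_iff by metis
  then show ?thesis unfolding un by (intro exI[of _ n]) simp
qed

lemma schwartz_trig: "p \<in> trig r \<Longrightarrow> f \<in> schwartz \<Longrightarrow> (\<lambda>x. p x * f x) \<in> schwartz"
proof (induction arbitrary: f rule: trig.induct)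
  case (const a)
  then show ?case by (rule schwartz_cmult)
next
  case (char i)
  from schwartz_cis[OF char, of "axis i r"] show ?case by (simp add: inner_axis')
next
  case (char_uminus i)
  from schwartz_cis[OF char_uminus, of "axis i (- r)"] show ?case by (simp add: inner_axis')
next
  case (add p q)
  then show ?case by (simp add: distrib_right schwartz_add)
next
  case (mult p q)
  then show ?case by (simp add: mult.assoc)
qed

text \<open>After multiplication by a Gaussian, \<open>v = u gauss\<close> is integrable and annihilates all
  trigonometric polynomials, of any period. Those are dense in \<open>L\<^sub>2\<close> of the finite measure
  \<open>|v| dx\<close>, so \<open>v\<close> annihilates a bounded function of period \<open>2 \<pi> (n + 1)\<close> that equals the
  conjugate sign of \<open>v\<close> on a large cube. What remains of the norm of \<open>v\<close> is at most twice its
  mass outside the cube, and this tends to zero.\<close>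

lemma schwartz_separates:
  fixes u :: "real^'d::finite \<Rightarrow> complex"
  assumes u [measurable]: "u \<in> borel_measurable borel"
    and int: "\<And>f. f \<in> schwartz \<Longrightarrow> integrable lborel (\<lambda>x. u x * f x)"
    and zero: "\<And>f. f \<in> schwartz \<Longrightarrow> (LINT x|lborel. u x * f x) = 0"
  shows "AE x in lborel. u x = 0"
proof -
  define v where "v x = u x * gauss x" for x
  have vi: "integrable lborel v" unfolding v_def by (intro int schwartz_gauss)
  have [measurable]: "v \<in> borel_measurable borel" using borel_measurable_integrable[OF vi] by simp
  define A where "A = (\<integral>x. cmod (v x) \<partial>lborel)"
  have A: "A \<ge> 0" unfolding A_def by (rule Bochner_Integration.integral_nonneg) simp
  define M where "M = density lborel (\<lambda>x. ennreal (cmod (v x)))"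
  have M: "finite_measure M" "sets M = sets borel"
    using integrableD(2)[OF integrable_norm[OF vi]]
    by (auto intro!: finite_measureI simp: M_def emeasure_density)
  define out where "out n x = (if \<forall>i. \<bar>x $ i\<bar> < real (Suc n) then 0 else 1 :: real)" for n and x :: "real^'d"
  have [measurable]: "out n \<in> borel_measurable borel" for n unfolding out_def by measurable
  have key: "A \<le> (\<integral>x. 2 * (cmod (v x) * out n x) \<partial>lborel)" for n
  proof -
    define r where "r = 1 / real (Suc n)"
    have r: "r > 0" by (simp add: r_def)
    define g where "g x = (if \<forall>i. \<bar>x $ i\<bar> < real (Suc n) then cnj (sgn (v x)) else 0)" for x
    \<comment> \<open>\<open>U \<circ> torus r\<close> is the periodic continuation of the conjugate sign of \<open>v\<close>\<close>
    define U where "U z = g ((1 / r) *\<^sub>R unwrap z)" for z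
    have g1: "cmod (g x) \<le> 1" for x by (simp add: g_def norm_sgn)
    have [measurable]: "cnj \<in> borel_measurable borel"
      by (intro borel_measurable_continuous_onI continuous_intros)
    have [measurable]: "(\<lambda>x. cnj (sgn (v x))) \<in> borel_measurable borel"
      unfolding sgn_div_norm by measurable
    have [measurable]: "g \<in> borel_measurable borel" unfolding g_def by measurable
    have [measurable]: "U \<in> borel_measurable borel" unfolding U_def by measurable
    have vg: "v x * U (torus r x) = cmod (v x)" if "\<forall>i. \<bar>x $ i\<bar> < real (Suc n)" for x
    proof -
      have "\<bar>r * x $ i\<bar> < pi / 2" for i
      proof -
        have "\<bar>r * x $ i\<bar> = \<bar>x $ i\<bar> / real (Suc n)" by (simp add: r_def abs_mult)
        also have "\<dots> < 1" using that by (simp add: divide_less_eq)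
        also have "1 < pi / 2" using pi_gt3 by simp
        finally show ?thesis .
      qed
      then have "U (torus r x) = cnj (sgn (v x))" using r that by (simp add: U_def unwrap_torus g_def)
      then have "v x * U (torus r x) = inverse (complex_of_real (cmod (v x))) * (v x * cnj (v x))"
        by (simp add: sgn_div_norm scaleR_conv_of_real)
      also have "\<dots> = cmod (v x)"
        unfolding complex_norm_square[symmetric]
        by (cases "v x = 0") (simp_all add: power2_eq_square field_simps)
      finally show ?thesis .
    qed
    define W where "W x = v x * U (torus r x)" for x
    have Wi: "integrable lborel W"
      unfolding W_def
      by (rule Bochner_Integration.integrable_bound[OF vi]) (auto simp: norm_mult U_def intro!: mult_left_le g1)
    have small: "cmod (LINT x|lborel. W x) \<le> d * (A + 1)" if d: "d > 0" for d
    proof -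
      have "\<exists>p\<in>trig r. (\<integral>\<^sup>+x. ennreal ((cmod (U (torus r x) - p x))\<^sup>2) \<partial>M) < ennreal (d\<^sup>2)"
      proof (rule trig_L2_dense[OF M])
        interpret finite_measure M by (rule M)
        have "(\<integral>\<^sup>+x. ennreal ((cmod (U (torus r x)))\<^sup>2) \<partial>M) \<le> (\<integral>\<^sup>+x. 1 \<partial>M)"
          by (intro nn_integral_mono) (simp add: U_def power_le_one g1)
        also have "\<dots> < \<infinity>" by (simp add: emeasure_eq_measure)
        finally show "(\<integral>\<^sup>+x. ennreal ((cmod (U (torus r x)))\<^sup>2) \<partial>M) < \<infinity>" .
      qed (use d in auto)
      then obtain p where p: "p \<in> trig r"
        "(\<integral>\<^sup>+x. ennreal ((cmod (U (torus r x) - p x))\<^sup>2) \<partial>M) < ennreal (d\<^sup>2)" by blast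
      have [measurable]: "p \<in> borel_measurable borel" by (rule trig_measurable[OF p(1)])
      have pg: "(\<lambda>x. p x * gauss x) \<in> schwartz" by (rule schwartz_trig[OF p(1) schwartz_gauss])
      have pv: "integrable lborel (\<lambda>x. v x * p x)" "(LINT x|lborel. v x * p x) = 0"
        using int[OF pg] zero[OF pg] by (simp_all add: v_def mult_ac)
      define Q where "Q x = cmod (v x) * (cmod (U (torus r x) - p x))\<^sup>2" for x
      have [measurable]: "Q \<in> borel_measurable borel" unfolding Q_def by measurable
      have Qe: "(\<integral>\<^sup>+x. ennreal (Q x) \<partial>lborel) < ennreal (d\<^sup>2)"
        using p(2) unfolding M_def by (subst (asm) nn_integral_density) (auto simp: Q_def ennreal_mult)
      then have Qi: "integrable lborel Q"
        by (intro integrableI_nonneg) (auto simp: Q_def intro: order.strict_trans)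
      have Q: "(\<integral>x. Q x \<partial>lborel) \<le> d\<^sup>2"
      proof -
        have Q0: "Q x \<ge> 0" for x by (simp add: Q_def)
        then have "ennreal (\<integral>x. Q x \<partial>lborel) < ennreal (d\<^sup>2)"
          using Qe by (subst (asm) nn_integral_eq_integral[OF Qi]) auto
        moreover have "(\<integral>x. Q x \<partial>lborel) \<ge> 0" using Q0 by (rule Bochner_Integration.integral_nonneg)
        ultimately show ?thesis by (simp add: ennreal_less_iff)
      qed
      have "(LINT x|lborel. W x) = (LINT x|lborel. W x - v x * p x)"
        using Wi pv by simp
      also have "cmod \<dots> \<le> (\<integral>x. d * cmod (v x) + (1 / d) * Q x \<partial>lborel)"
      proof (rule Bochner_Integration.integral_norm_bound_integral)
        show "integrable lborel (\<lambda>x. W x - v x * p x)" using Wi pv by simp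
        show "integrable lborel (\<lambda>x. d * cmod (v x) + (1 / d) * Q x)" using vi Qi by simp
        fix x
        define b where "b = cmod (U (torus r x) - p x)"
        \<comment> \<open>a substitute for the Cauchy--Schwarz inequality, to compare \<open>L\<^sub>1\<close> with \<open>L\<^sub>2\<close>\<close>
        have "b \<le> d + (1 / d) * b\<^sup>2"
        proof (cases "b \<le> d")
          case True
          then show ?thesis using d by (simp add: add_increasing2)
        next
          case False
          then have "b * d \<le> b * b" using d by (intro mult_left_mono) (auto simp: b_def)
          then have "b \<le> (1 / d) * b\<^sup>2" using d by (simp add: field_simps power2_eq_square)
          then show ?thesis using d by linarith
        qed
        then have "cmod (v x) * b \<le> cmod (v x) * (d + (1 / d) * b\<^sup>2)" by (rule mult_left_mono) simp
        then show "cmod (W x - v x * p x) \<le> d * cmod (v x) + (1 / d) * Q x"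
          unfolding W_def Q_def b_def right_diff_distrib[symmetric] norm_mult by (simp add: algebra_simps)
      qed
      also have "\<dots> = d * A + (1 / d) * (\<integral>x. Q x \<partial>lborel)"
        using vi Qi by (simp add: A_def)
      also have "\<dots> \<le> d * A + (1 / d) * d\<^sup>2" using Q d by (intro add_left_mono mult_left_mono) auto
      also have "\<dots> = d * (A + 1)" using d by (simp add: power2_eq_square algebra_simps)
      finally show ?thesis .
    qed
    have W0: "(LINT x|lborel. W x) = 0"
    proof (rule ccontr)
      assume "\<not> ?thesis"
      then have c: "cmod (LINT x|lborel. W x) > 0" by simp
      define d where "d = cmod (LINT x|lborel. W x) / 2 / (A + 1)"
      have A1: "A + 1 > 0" using A by simp
      have "d > 0" unfolding d_def using c A1 by (intro divide_pos_pos) auto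
      moreover have "d * (A + 1) = cmod (LINT x|lborel. W x) / 2"
        using A1 unfolding d_def by (subst times_divide_eq_left) (simp del: divide_divide_eq_left)
      ultimately show False using small[of d] c by linarith
    qed
    have "complex_of_real A = (LINT x|lborel. complex_of_real (cmod (v x)) - W x)"
      using vi Wi W0 by (simp add: A_def)
    then have "A = cmod (LINT x|lborel. complex_of_real (cmod (v x)) - W x)"
      using A by (metis abs_of_nonneg norm_of_real)
    also have "\<dots> \<le> (\<integral>x. 2 * (cmod (v x) * out n x) \<partial>lborel)"
    proof (rule Bochner_Integration.integral_norm_bound_integral)
      show "integrable lborel (\<lambda>x. complex_of_real (cmod (v x)) - W x)" using vi Wi by simp
      have "integrable lborel (\<lambda>x. cmod (v x) * out n x)"
        by (rule Bochner_Integration.integrable_bound[OF integrable_norm[OF vi]]) (auto simp: out_def)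
      then show "integrable lborel (\<lambda>x. 2 * (cmod (v x) * out n x))" by simp
      fix x :: "real^'d"
      show "cmod (complex_of_real (cmod (v x)) - W x) \<le> 2 * (cmod (v x) * out n x)"
      proof (cases "\<forall>i. \<bar>x $ i\<bar> < real (Suc n)")
        case True
        then show ?thesis unfolding W_def vg[OF True] by (simp add: out_def)
      next
        case False
        have "cmod (complex_of_real (cmod (v x)) - W x) \<le> cmod (v x) + cmod (W x)"
          using norm_triangle_ineq4[of "complex_of_real (cmod (v x))" "W x"] by simp
        also have "cmod (W x) \<le> cmod (v x)" by (simp add: W_def norm_mult U_def mult_left_le g1)
        finally have "cmod (complex_of_real (cmod (v x)) - W x) \<le> 2 * cmod (v x)" by simp
        moreover have "out n x = 1" using False by (auto simp: out_def)
        ultimately show ?thesis by simp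
      qed
    qed
    finally show ?thesis .
  qed
  have "(\<lambda>n. \<integral>x. 2 * (cmod (v x) * out n x) \<partial>lborel) \<longlonglongrightarrow> (LINT x|(lborel :: (real^'d) measure). 0)"
  proof (rule integral_dominated_convergence[where w = "\<lambda>x. 2 * cmod (v x)"])
    show "AE x in lborel. (\<lambda>n. 2 * (cmod (v x) * out n x)) \<longlonglongrightarrow> 0"
    proof (rule AE_I2)
      fix x :: "real^'d"
      obtain N where N: "norm x < real N" using reals_Archimedean2 by blast
      have "out n x = 0" if "n \<ge> N" for n
        using component_le_norm_cart[of x] N that unfolding out_def
        by (auto intro: le_less_trans[OF component_le_norm_cart])
      then have "eventually (\<lambda>n. 2 * (cmod (v x) * out n x) = 0) sequentially"
        by (auto simp: eventually_sequentially)
      then show "(\<lambda>n. 2 * (cmod (v x) * out n x)) \<longlonglongrightarrow> 0" by (rule tendsto_eventually)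
    qed
  qed (use vi in \<open>auto simp: out_def\<close>)
  then have "(\<lambda>n. \<integral>x. 2 * (cmod (v x) * out n x) \<partial>lborel) \<longlonglongrightarrow> 0" by simp
  then have "A \<le> 0" by (rule LIMSEQ_le_const) (use key in auto)
  then have "A = 0" using A by simp
  then have "AE x in lborel. cmod (v x) = 0"
    unfolding A_def by (subst (asm) integral_nonneg_eq_0_iff_AE) (use vi in auto)
  then show ?thesis by eventually_elim (simp add: v_def gauss_def)
qed

section \<open>Tempered distributions and their Fourier transforms\<close>

lemma tempered_linear:
  assumes "T \<in> tempered" "\<psi> \<in> schwartz" "\<eta> \<in> schwartz"
  shows "T (\<lambda>x. a * \<psi> x + b * \<eta> x) = a * T \<psi> + b * T \<eta>"
  using assms by (auto simp: tempered_def)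

lemma tempered_outside: "T \<in> tempered \<Longrightarrow> \<psi> \<notin> schwartz \<Longrightarrow> T \<psi> = 0"
  by (auto simp: tempered_def)

lemma tempered_bound:
  assumes "T \<in> tempered"
  obtains N C where "C \<ge> 0" "\<And>\<psi>. \<psi> \<in> schwartz \<Longrightarrow> cmod (T \<psi>) \<le> C * schwartz_seminorm N \<psi>"
proof -
  obtain N C where "\<And>\<psi>. \<psi> \<in> schwartz \<Longrightarrow> cmod (T \<psi>) \<le> C * schwartz_seminorm N \<psi>"
    using assms unfolding tempered_def by blast
  then have "cmod (T \<psi>) \<le> \<bar>C\<bar> * schwartz_seminorm N \<psi>" if "\<psi> \<in> schwartz" for \<psi>
    using that seminorm_nonneg[OF that, of N] by (meson abs_ge_self mult_right_mono order_trans)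
  then show ?thesis using that[of "\<bar>C\<bar>" N] by simp
qed

lemma temperedI:
  assumes "\<And>\<psi>. \<psi> \<notin> schwartz \<Longrightarrow> T \<psi> = 0"
    and "\<And>\<psi> \<eta> a b. \<psi> \<in> schwartz \<Longrightarrow> \<eta> \<in> schwartz \<Longrightarrow> T (\<lambda>x. a * \<psi> x + b * \<eta> x) = a * T \<psi> + b * T \<eta>"
    and "\<And>\<psi>. \<psi> \<in> schwartz \<Longrightarrow> cmod (T \<psi>) \<le> C * schwartz_seminorm N \<psi>"
  shows "T \<in> tempered"
  using assms unfolding tempered_def by blast

lemma tempered_zero: "(\<lambda>_. 0) \<in> tempered"
  by (rule temperedI[where C = 0 and N = 0]) auto

lemma tempered_lin:
  assumes f: "f \<in> tempered" and g: "g \<in> tempered"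
  shows "(\<lambda>\<psi>. a * f \<psi> + b * g \<psi>) \<in> tempered"
proof -
  obtain N C where N: "C \<ge> 0" "\<And>\<psi>. \<psi> \<in> schwartz \<Longrightarrow> cmod (f \<psi>) \<le> C * schwartz_seminorm N \<psi>"
    using tempered_bound[OF f] by metis
  obtain M D where M: "D \<ge> 0" "\<And>\<psi>. \<psi> \<in> schwartz \<Longrightarrow> cmod (g \<psi>) \<le> D * schwartz_seminorm M \<psi>"
    using tempered_bound[OF g] by metis
  show ?thesis
  proof (rule temperedI)
    fix \<psi> :: "real^'a \<Rightarrow> complex" assume "\<psi> \<notin> schwartz"
    then show "a * f \<psi> + b * g \<psi> = 0" using f g by (simp add: tempered_outside)
  next
    fix \<psi> \<eta> :: "real^'a \<Rightarrow> complex" and c d assume "\<psi> \<in> schwartz" "\<eta> \<in> schwartz"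
    then show "a * f (\<lambda>x. c * \<psi> x + d * \<eta> x) + b * g (\<lambda>x. c * \<psi> x + d * \<eta> x) =
        c * (a * f \<psi> + b * g \<psi>) + d * (a * f \<eta> + b * g \<eta>)"
      using f g by (simp add: tempered_linear algebra_simps)
  next
    fix \<psi> :: "real^'a \<Rightarrow> complex" assume \<psi>: "\<psi> \<in> schwartz"
    have "cmod (a * f \<psi> + b * g \<psi>) \<le> cmod a * cmod (f \<psi>) + cmod b * cmod (g \<psi>)"
      by (metis norm_mult norm_triangle_ineq)
    also have "\<dots> \<le> cmod a * (C * schwartz_seminorm (max M N) \<psi>) + cmod b * (D * schwartz_seminorm (max M N) \<psi>)"
      using N(1) M(1)
      by (intro add_mono mult_left_mono order_trans[OF N(2)[OF \<psi>]] order_trans[OF M(2)[OF \<psi>]] seminorm_mono \<psi>) auto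
    finally show "cmod (a * f \<psi> + b * g \<psi>) \<le> (cmod a * C + cmod b * D) * schwartz_seminorm (max M N) \<psi>"
      by (simp add: algebra_simps)
  qed
qed

text \<open>Translations and dilations are the two instances.\<close>

lemma tempered_affine:
  fixes f :: "'d::finite dist"
  assumes f: "f \<in> tempered" and h: "h \<noteq> 0"
  shows "(\<lambda>\<psi>. c * f (\<lambda>x. \<psi> (h *\<^sub>R x + \<alpha>))) \<in> tempered"
proof -
  obtain N C where N: "C \<ge> 0" "\<And>\<psi>. \<psi> \<in> schwartz \<Longrightarrow> cmod (f \<psi>) \<le> C * schwartz_seminorm N \<psi>"
    using tempered_bound[OF f] by metis
  show ?thesis
  proof (rule temperedI)
    fix \<psi> :: "real^'d \<Rightarrow> complex" assume "\<psi> \<notin> schwartz"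
    then show "c * f (\<lambda>x. \<psi> (h *\<^sub>R x + \<alpha>)) = 0"
      using f by (simp add: tempered_outside schwartz_affine_iff h)
  next
    fix \<psi> \<eta> :: "real^'d \<Rightarrow> complex" and a b assume s: "\<psi> \<in> schwartz" "\<eta> \<in> schwartz"
    from tempered_linear[OF f schwartz_affine[OF s(1) h] schwartz_affine[OF s(2) h]]
    show "c * f (\<lambda>x. a * \<psi> (h *\<^sub>R x + \<alpha>) + b * \<eta> (h *\<^sub>R x + \<alpha>)) =
        a * (c * f (\<lambda>x. \<psi> (h *\<^sub>R x + \<alpha>))) + b * (c * f (\<lambda>x. \<eta> (h *\<^sub>R x + \<alpha>)))"
      by (simp add: algebra_simps)
  next
    fix \<psi> :: "real^'d \<Rightarrow> complex" assume \<psi>: "\<psi> \<in> schwartz"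
    let ?K = "(1 + \<bar>h\<bar>) ^ N * ((1 + 1 / \<bar>h\<bar>) * (1 + norm \<alpha>)) ^ N"
    have "cmod (c * f (\<lambda>x. \<psi> (h *\<^sub>R x + \<alpha>))) \<le> cmod c * (C * schwartz_seminorm N (\<lambda>x. \<psi> (h *\<^sub>R x + \<alpha>)))"
      unfolding norm_mult by (intro mult_left_mono N schwartz_affine \<psi> h) simp
    also have "\<dots> \<le> cmod c * (C * (?K * schwartz_seminorm N \<psi>))"
      by (intro mult_left_mono N seminorm_affine \<psi> h) simp
    finally show "cmod (c * f (\<lambda>x. \<psi> (h *\<^sub>R x + \<alpha>))) \<le> (cmod c * C * ?K) * schwartz_seminorm N \<psi>"
      by (simp only: mult.assoc)
  qed
qed

lemma tempered_translate: "f \<in> tempered \<Longrightarrow> translate \<alpha> f \<in> tempered"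
  using tempered_affine[of f 1 1 "- \<alpha>"] by (simp add: translate_def[abs_def])

lemma tempered_dilate:
  fixes f :: "'d::finite dist"
  shows "f \<in> tempered \<Longrightarrow> h > 0 \<Longrightarrow> dilate h f \<in> tempered"
  using tempered_affine[of f h "complex_of_real h ^ CARD('d)" 0] by (simp add: dilate_def[abs_def])

subsection \<open>Functions representing a Fourier transform\<close>

lemma has_hat_measurable: "has_hat f u \<Longrightarrow> u \<in> borel_measurable borel"
  by (simp add: has_hat_def locally_L2_def)

lemma has_hatD:
  assumes "has_hat f u" "\<psi> \<in> schwartz"
  shows "integrable lborel (\<lambda>\<omega>. u \<omega> * \<psi> \<omega>)" "f (fourier \<psi>) = (LINT \<omega>|lborel. u \<omega> * \<psi> \<omega>)"
  using assms by (auto simp: has_hat_def represents_def dist_fourier_def)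

lemma has_hatI:
  assumes "locally_L2 u"
    and "\<And>\<psi>. \<psi> \<in> schwartz \<Longrightarrow> integrable lborel (\<lambda>\<omega>. u \<omega> * \<psi> \<omega>)"
    and "\<And>\<psi>. \<psi> \<in> schwartz \<Longrightarrow> f (fourier \<psi>) = (LINT \<omega>|lborel. u \<omega> * \<psi> \<omega>)"
  shows "has_hat f u"
  using assms by (auto simp: has_hat_def represents_def dist_fourier_def)

lemma has_hat_unique:
  fixes f :: "'d::finite dist"
  assumes u: "has_hat f u" and v: "has_hat f v"
  shows "AE \<omega> in lborel. u \<omega> = v \<omega>"
proof -
  have "AE \<omega> in lborel. u \<omega> - v \<omega> = 0"
  proof (rule schwartz_separates)
    fix \<psi> :: "real^'d \<Rightarrow> complex" assume "\<psi> \<in> schwartz"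
    note i = has_hatD[OF u this] has_hatD[OF v this]
    show "integrable lborel (\<lambda>x. (u x - v x) * \<psi> x)" using i by (simp add: left_diff_distrib)
    show "(LINT x|lborel. (u x - v x) * \<psi> x) = 0" using i by (simp add: left_diff_distrib)
  qed (use has_hat_measurable[OF u] has_hat_measurable[OF v] in simp)
  then show ?thesis by eventually_elim simp
qed

lemma locally_L2_lin:
  assumes u: "locally_L2 u" and v: "locally_L2 v"
  shows "locally_L2 (\<lambda>\<omega>. a * u \<omega> + b * v \<omega>)"
  unfolding locally_L2_def
proof (intro conjI allI impI)
  have [measurable]: "u \<in> borel_measurable borel" "v \<in> borel_measurable borel"
    using u v by (auto simp: locally_L2_def)
  show "(\<lambda>\<omega>. a * u \<omega> + b * v \<omega>) \<in> borel_measurable borel" by measurable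
  fix K :: "(real^'a) set" assume K: "compact K"
  then have [measurable]: "K \<in> sets borel" by (simp add: borel_compact)
  have fin: "(\<integral>\<^sup>+\<omega>. indicator K \<omega> * ennreal ((cmod (a * u \<omega>))\<^sup>2) \<partial>lborel) < \<infinity>"
    if "locally_L2 u" for a and u :: "real^'a \<Rightarrow> complex"
  proof -
    have [measurable]: "u \<in> borel_measurable borel" using that by (simp add: locally_L2_def)
    have "(\<integral>\<^sup>+\<omega>. indicator K \<omega> * ennreal ((cmod (a * u \<omega>))\<^sup>2) \<partial>lborel) =
        (\<integral>\<^sup>+\<omega>. ennreal ((cmod a)\<^sup>2) * (ennreal ((cmod (u \<omega>))\<^sup>2) * indicator K \<omega>) \<partial>lborel)"
      by (intro nn_integral_cong) (simp add: norm_mult power_mult_distrib ennreal_mult mult_ac)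
    also have "\<dots> = ennreal ((cmod a)\<^sup>2) * (\<integral>\<^sup>+\<omega>\<in>K. ennreal ((cmod (u \<omega>))\<^sup>2) \<partial>lborel)"
      by (rule nn_integral_cmult) measurable
    also have "\<dots> < \<infinity>" using that K by (auto simp: locally_L2_def ennreal_mult_less_top)
    finally show ?thesis .
  qed
  have "(\<integral>\<^sup>+\<omega>\<in>K. ennreal ((cmod (a * u \<omega> + b * v \<omega>))\<^sup>2) \<partial>lborel) =
      (\<integral>\<^sup>+\<omega>. indicator K \<omega> * ennreal ((cmod (a * u \<omega> + b * v \<omega>))\<^sup>2) \<partial>lborel)"
    by (simp add: mult.commute)
  also have "\<dots> \<le> 2 * (\<integral>\<^sup>+\<omega>. indicator K \<omega> * ennreal ((cmod (a * u \<omega>))\<^sup>2) \<partial>lborel) +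
      2 * (\<integral>\<^sup>+\<omega>. indicator K \<omega> * ennreal ((cmod (b * v \<omega>))\<^sup>2) \<partial>lborel)"
    by (rule nn_integral_norm_sq_add_le) measurable
  also have "\<dots> < \<infinity>" using fin[OF u, of a] fin[OF v, of b] by (simp add: ennreal_mult_less_top)
  finally show "(\<integral>\<^sup>+\<omega>\<in>K. ennreal ((cmod (a * u \<omega> + b * v \<omega>))\<^sup>2) \<partial>lborel) < \<infinity>" .
qed

lemma has_hat_lin:
  assumes u: "has_hat f u" and v: "has_hat g v"
  shows "has_hat (\<lambda>\<psi>. a * f \<psi> + b * g \<psi>) (\<lambda>\<omega>. a * u \<omega> + b * v \<omega>)"
proof (rule has_hatI)
  show "locally_L2 (\<lambda>\<omega>. a * u \<omega> + b * v \<omega>)"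
    using u v by (intro locally_L2_lin) (auto simp: has_hat_def)
  fix \<psi> :: "real^'a \<Rightarrow> complex" assume "\<psi> \<in> schwartz"
  note i = has_hatD[OF u this] has_hatD[OF v this]
  have eq: "(\<lambda>\<omega>. (a * u \<omega> + b * v \<omega>) * \<psi> \<omega>) = (\<lambda>\<omega>. a * (u \<omega> * \<psi> \<omega>) + b * (v \<omega> * \<psi> \<omega>))"
    by (auto simp: algebra_simps)
  show "integrable lborel (\<lambda>\<omega>. (a * u \<omega> + b * v \<omega>) * \<psi> \<omega>)" unfolding eq using i by simp
  show "a * f (fourier \<psi>) + b * g (fourier \<psi>) = (LINT \<omega>|lborel. (a * u \<omega> + b * v \<omega>) * \<psi> \<omega>)"
    unfolding eq using i by simp
qed

lemma has_hat_diff: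
  assumes "has_hat f u" "has_hat g v"
  shows "has_hat (\<lambda>\<psi>. f \<psi> - g \<psi>) (\<lambda>\<omega>. u \<omega> - v \<omega>)"
  using has_hat_lin[OF assms, of 1 "-1"] by simp

lemma has_hat_zero: "has_hat (\<lambda>_. 0) (\<lambda>_. 0)"
  by (rule has_hatI) (auto simp: locally_L2_def)

lemma has_hat_translate:
  assumes u: "has_hat f u"
  shows "has_hat (translate \<alpha> f) (\<lambda>\<omega>. cis (\<alpha> \<bullet> \<omega>) * u \<omega>)"
proof (rule has_hatI)
  have [measurable]: "u \<in> borel_measurable borel" by (rule has_hat_measurable[OF u])
  show "locally_L2 (\<lambda>\<omega>. cis (\<alpha> \<bullet> \<omega>) * u \<omega>)"
    using u by (auto simp: has_hat_def locally_L2_def norm_mult)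
  fix \<psi> :: "real^'a \<Rightarrow> complex" assume "\<psi> \<in> schwartz"
  note i = has_hatD[OF u schwartz_cis[OF this, of \<alpha>]]
  show "integrable lborel (\<lambda>\<omega>. cis (\<alpha> \<bullet> \<omega>) * u \<omega> * \<psi> \<omega>)" using i(1) by (simp add: mult_ac)
  have "fourier (\<lambda>x. cis (\<alpha> \<bullet> x) * \<psi> x) = (\<lambda>x. fourier \<psi> (x - \<alpha>))"
    by (rule ext) (rule fourier_mult_cis)
  with i(2) show "translate \<alpha> f (fourier \<psi>) = (LINT \<omega>|lborel. cis (\<alpha> \<bullet> \<omega>) * u \<omega> * \<psi> \<omega>)"
    by (simp add: translate_def mult_ac)
qed

lemma locally_L2_dilate:
  assumes u: "locally_L2 u" and h: "h \<noteq> 0"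
  shows "locally_L2 (\<lambda>\<omega>. u (h *\<^sub>R \<omega>))"
  unfolding locally_L2_def
proof (intro conjI allI impI)
  have [measurable]: "u \<in> borel_measurable borel" using u by (simp add: locally_L2_def)
  show "(\<lambda>\<omega>. u (h *\<^sub>R \<omega>)) \<in> borel_measurable borel" by measurable
  fix K :: "(real^'a) set" assume K: "compact K"
  then have K': "compact ((*\<^sub>R) h ` K)" by (rule compact_scaling)
  then have [measurable]: "(*\<^sub>R) h ` K \<in> sets borel" by (simp add: borel_compact)
  have ind: "indicator K \<omega> = (indicator ((*\<^sub>R) h ` K) (h *\<^sub>R \<omega>) :: ennreal)" for \<omega>
    using h by (auto simp: indicator_def)
  have "(\<integral>\<^sup>+\<omega>\<in>((*\<^sub>R) h ` K). ennreal ((cmod (u \<omega>))\<^sup>2) \<partial>lborel) =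
     ennreal (\<bar>h\<bar> ^ DIM(real^'a)) * (\<integral>\<^sup>+\<omega>\<in>K. ennreal ((cmod (u (h *\<^sub>R \<omega>)))\<^sup>2) \<partial>lborel)"
    unfolding ind by (subst nn_integral_lborel_affine[where c = h and t = 0, OF _ h]) (auto, measurable)
  moreover have "\<dots> < \<infinity>" if "(\<integral>\<^sup>+\<omega>\<in>((*\<^sub>R) h ` K). ennreal ((cmod (u \<omega>))\<^sup>2) \<partial>lborel) = \<dots>"
    using u K' unfolding that[symmetric] by (auto simp: locally_L2_def)
  ultimately show "(\<integral>\<^sup>+\<omega>\<in>K. ennreal ((cmod (u (h *\<^sub>R \<omega>)))\<^sup>2) \<partial>lborel) < \<infinity>"
    using h by (auto simp: ennreal_mult_less_top ennreal_power[symmetric])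
qed

text \<open>The transform of \<open>\<psi>(\<cdot> / h)\<close> is \<open>h ^ d\<close> times that of \<open>\<psi>\<close> at \<open>h \<omega>\<close>; linearity of
  \<open>f\<close> removes this factor, for which \<open>f\<close> has to be a tempered distribution.\<close>

lemma has_hat_dilate:
  fixes f :: "'d::finite dist"
  assumes f: "f \<in> tempered" and u: "has_hat f u" and h: "h > 0"
  shows "has_hat (dilate h f) (\<lambda>\<omega>. complex_of_real h ^ CARD('d) * u (h *\<^sub>R \<omega>))"
proof (rule has_hatI)
  have [measurable]: "u \<in> borel_measurable borel" by (rule has_hat_measurable[OF u])
  have "locally_L2 (\<lambda>\<omega>. u (h *\<^sub>R \<omega>))" using u h by (intro locally_L2_dilate) (auto simp: has_hat_def)
  from locally_L2_lin[OF this this, of _ 0]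
  show "locally_L2 (\<lambda>\<omega>. complex_of_real h ^ CARD('d) * u (h *\<^sub>R \<omega>))" by simp
  fix \<psi> :: "real^'d \<Rightarrow> complex" assume \<psi>: "\<psi> \<in> schwartz"
  define \<eta> where "\<eta> x = \<psi> ((1 / h) *\<^sub>R x)" for x
  have \<eta>: "\<eta> \<in> schwartz" using schwartz_affine[OF \<psi>, of "1 / h" 0] h by (simp add: \<eta>_def[abs_def])
  have [measurable]: "\<eta> \<in> borel_measurable borel" "\<psi> \<in> borel_measurable borel"
    by (rule schwartz_measurable[OF \<eta>] schwartz_measurable[OF \<psi>])+
  note i = has_hatD[OF u \<eta>]
  have \<psi>\<eta>: "\<psi> x = \<eta> (h *\<^sub>R x)" for x using h by (simp add: \<eta>_def)
  have "integrable lborel (\<lambda>\<omega>. u (0 + h *\<^sub>R \<omega>) * \<eta> (0 + h *\<^sub>R \<omega>))"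
    using integrable_lborel_affine[OF i(1), of h 0] h by simp
  then show "integrable lborel (\<lambda>\<omega>. complex_of_real h ^ CARD('d) * u (h *\<^sub>R \<omega>) * \<psi> \<omega>)"
    by (simp add: \<psi>\<eta>[symmetric] mult.assoc)
  have "fourier \<psi> (h *\<^sub>R \<omega>) = (1 / complex_of_real h ^ CARD('d)) * fourier \<eta> \<omega> + 0 * fourier \<eta> \<omega>" for \<omega>
    using fourier_dilate[of \<eta> h \<omega>] h by (simp add: \<psi>\<eta>[symmetric])
  then have "dilate h f (fourier \<psi>) = complex_of_real h ^ CARD('d) *
      f (\<lambda>\<omega>. (1 / complex_of_real h ^ CARD('d)) * fourier \<eta> \<omega> + 0 * fourier \<eta> \<omega>)"
    by (simp only: dilate_def)
  also have "\<dots> = f (fourier \<eta>)"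
    using tempered_linear[OF f schwartz_fourier[OF \<eta>] schwartz_fourier[OF \<eta>], of "1 / complex_of_real h ^ CARD('d)" 0] h
    by simp
  also have "\<dots> = (LINT \<omega>|lborel. u \<omega> * \<eta> \<omega>)" by (rule i(2))
  also have "\<dots> = \<bar>h\<bar> ^ DIM(real^'d) *\<^sub>R (LINT \<omega>|lborel. u (0 + h *\<^sub>R \<omega>) * \<eta> (0 + h *\<^sub>R \<omega>))"
    using h by (intro integral_lborel_affine) auto
  also have "\<dots> = (LINT \<omega>|lborel. complex_of_real h ^ CARD('d) * u (h *\<^sub>R \<omega>) * \<psi> \<omega>)"
    using h by (simp add: \<psi>\<eta>[symmetric] scaleR_conv_of_real[where 'a=complex] mult.assoc)
  finally show "dilate h f (fourier \<psi>) = (LINT \<omega>|lborel. complex_of_real h ^ CARD('d) * u (h *\<^sub>R \<omega>) * \<psi> \<omega>)" .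
qed

text \<open>The distribution is \<open>\<eta> \<mapsto> (2 \<pi>) ^ (-d) \<integral> u(\<omega>) fourier \<eta> (-\<omega>) d\<omega>\<close>. On \<open>\<eta> = fourier \<psi>\<close>
  this is the integral of \<open>u \<psi>\<close> by inversion; it is defined there because Fourier transforms of
  Schwartz functions are Schwartz functions.\<close>

lemma has_hat_surj:
  fixes u :: "real^'d::finite \<Rightarrow> complex"
  assumes L2: "locally_L2 u" and u: "integrable lborel u"
  shows "\<exists>f\<in>tempered. has_hat f u"
proof -
  have [measurable]: "u \<in> borel_measurable borel" using borel_measurable_integrable[OF u] by simp
  define c where "c = complex_of_real (2 * pi) ^ CARD('d)"
  have c: "c \<noteq> 0" by (simp add: c_def)
  define f where "f \<eta> = (if \<eta> \<in> schwartz then (1 / c) * (LINT \<omega>|lborel. u \<omega> * fourier \<eta> (- \<omega>)) else 0)" for \<eta>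
  have bnd: "integrable lborel (\<lambda>\<omega>. u \<omega> * g \<omega>)"
    "cmod (LINT \<omega>|lborel. u \<omega> * g \<omega>) \<le> B * (\<integral>\<omega>. cmod (u \<omega>) \<partial>lborel)"
    if [measurable]: "g \<in> borel_measurable borel" and g: "\<And>\<omega>. cmod (g \<omega>) \<le> B" for g B
  proof -
    have "B \<ge> 0" using g[of 0] norm_ge_zero order_trans by blast
    show i: "integrable lborel (\<lambda>\<omega>. u \<omega> * g \<omega>)"
      by (rule Bochner_Integration.integrable_bound[of _ "\<lambda>\<omega>. B * cmod (u \<omega>)"])
        (use u \<open>B \<ge> 0\<close> in \<open>auto simp: norm_mult mult.commute[of B] intro!: mult_left_mono g\<close>)
    have "cmod (LINT \<omega>|lborel. u \<omega> * g \<omega>) \<le> (\<integral>\<omega>. B * cmod (u \<omega>) \<partial>lborel)"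
      by (rule Bochner_Integration.integral_norm_bound_integral[OF i])
        (use u in \<open>auto simp: norm_mult mult.commute[of B] intro!: mult_left_mono g\<close>)
    then show "cmod (LINT \<omega>|lborel. u \<omega> * g \<omega>) \<le> B * (\<integral>\<omega>. cmod (u \<omega>) \<partial>lborel)" by simp
  qed
  have Fm [measurable]: "(\<lambda>\<omega>. fourier \<psi> (- \<omega>)) \<in> borel_measurable borel" if "\<psi> \<in> schwartz" for \<psi> :: "real^'d \<Rightarrow> complex"
    using schwartz_measurable[OF schwartz_fourier[OF that]] by measurable
  have Fi: "integrable lborel (\<lambda>\<omega>. u \<omega> * fourier \<psi> (- \<omega>))" if "\<psi> \<in> schwartz" for \<psi>
    by (rule bnd(1)[OF Fm[OF that] norm_fourier_le])
  define J where "J = (LINT x|(lborel :: (real^'d) measure). 1 / (1 + norm x) ^ (2 * DIM(real^'d)))"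
  have "f \<in> tempered"
  proof (rule temperedI)
    fix \<psi> \<eta> :: "real^'d \<Rightarrow> complex" and a b assume s: "\<psi> \<in> schwartz" "\<eta> \<in> schwartz"
    have lin: "fourier (\<lambda>x. a * \<psi> x + b * \<eta> x) \<omega> = a * fourier \<psi> \<omega> + b * fourier \<eta> \<omega>" for \<omega>
    proof -
      have "integrable lborel (\<lambda>x. \<psi> x * cis (- (\<omega> \<bullet> x)))" "integrable lborel (\<lambda>x. \<eta> x * cis (- (\<omega> \<bullet> x)))"
        by (intro integrable_mult_cis schwartz_integrable s)+
      then show ?thesis unfolding fourier_cis
        by (simp add: distrib_right mult.assoc)
    qed
    show "f (\<lambda>x. a * \<psi> x + b * \<eta> x) = a * f \<psi> + b * f \<eta>"
      using s Fi[OF s(1)] Fi[OF s(2)] by (simp add: f_def schwartz_lin lin distrib_left mult.left_commute)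
  next
    fix \<psi> :: "real^'d \<Rightarrow> complex" assume \<psi>: "\<psi> \<in> schwartz"
    let ?N = "2 * DIM(real^'d)"
    have "(\<integral>x. cmod (\<psi> x) \<partial>lborel) \<le> schwartz_seminorm ?N \<psi> * J"
      unfolding J_def
      using seminorm_upper[OF \<psi>, of "[]" ?N] by (intro integrable_polynomial_decay(2) schwartz_measurable \<psi>) simp
    then have "cmod (fourier \<psi> (- \<omega>)) \<le> schwartz_seminorm ?N \<psi> * J" for \<omega>
      by (rule order_trans[OF norm_fourier_le])
    from bnd(2)[OF Fm[OF \<psi>] this]
    have "cmod (1 / c) * cmod (LINT \<omega>|lborel. u \<omega> * fourier \<psi> (- \<omega>)) \<le>
       cmod (1 / c) * (schwartz_seminorm ?N \<psi> * J * (\<integral>\<omega>. cmod (u \<omega>) \<partial>lborel))"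
      by (rule mult_left_mono) simp
    then show "cmod (f \<psi>) \<le> (cmod (1 / c) * (J * (\<integral>\<omega>. cmod (u \<omega>) \<partial>lborel))) * schwartz_seminorm ?N \<psi>"
      using \<psi> by (simp only: f_def if_True norm_mult mult_ac)
  qed (simp add: f_def)
  moreover have "has_hat f u"
  proof (rule has_hatI[OF L2])
    fix \<psi> :: "real^'d \<Rightarrow> complex" assume \<psi>: "\<psi> \<in> schwartz"
    obtain B where "\<And>x. cmod (\<psi> x) \<le> B" using schwartz_bounded[OF \<psi>] by metis
    from bnd(1)[OF schwartz_measurable[OF \<psi>] this] show "integrable lborel (\<lambda>\<omega>. u \<omega> * \<psi> \<omega>)" .
    have "f (fourier \<psi>) = (1 / c) * (LINT \<omega>|lborel. c * (u \<omega> * \<psi> \<omega>))"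
      using \<psi> by (simp add: f_def schwartz_fourier fourier_inversion c_def mult_ac)
    then show "f (fourier \<psi>) = (LINT \<omega>|lborel. u \<omega> * \<psi> \<omega>)" using c by simp
  qed
  ultimately show ?thesis by blast
qed

section \<open>The Sobolev spaces in terms of Fourier transforms\<close>

text \<open>For \<open>h = 1\<close> this is the squared norm of \<open>W\<^sub>2\<^sup>s\<close>. The weight with parameter \<open>h\<close> is the one
  that appears after dilation by \<open>h\<close>; see \<open>energy_scaled\<close>.\<close>

definition energy :: "real \<Rightarrow> real \<Rightarrow> (real^'d::finite \<Rightarrow> complex) \<Rightarrow> ennreal" where
  "energy h s u = (\<integral>\<^sup>+\<omega>. ennreal ((h + norm \<omega>) powr (2 * s)) * ennreal ((cmod (u \<omega>))\<^sup>2) \<partial>lborel)"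

lemma energy_cong_AE: "AE \<omega> in lborel. u \<omega> = v \<omega> \<Longrightarrow> energy h s u = energy h s v"
  unfolding energy_def by (rule nn_integral_cong_AE, erule eventually_mono) simp

lemma has_hat_hat: "has_hat f u \<Longrightarrow> has_hat f (hat f)"
  unfolding hat_def by (rule someI[of "has_hat f"])

lemma sobolev_energy_eq:
  assumes "has_hat f u"
  shows "sobolev_energy s f = energy 1 s u"
proof -
  have "sobolev_energy s f = energy 1 s (hat f)"
    unfolding sobolev_energy_def energy_def by (intro nn_integral_cong) (simp add: ennreal_mult)
  also have "\<dots> = energy 1 s u"
    by (rule energy_cong_AE[OF has_hat_unique[OF has_hat_hat[OF assms] assms]])
  finally show ?thesis .
qed

lemma sobolevI: "f \<in> tempered \<Longrightarrow> has_hat f u \<Longrightarrow> energy 1 s u < \<infinity> \<Longrightarrow> f \<in> sobolev s"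
  using sobolev_energy_eq[of f u s] by (auto simp: sobolev_def)

lemma sobolevD:
  assumes "f \<in> sobolev s"
  shows "f \<in> tempered" "has_hat f (hat f)" "energy 1 s (hat f) < \<infinity>"
proof -
  show "f \<in> tempered" using assms by (simp add: sobolev_def)
  show hat: "has_hat f (hat f)" using assms has_hat_hat by (auto simp: sobolev_def)
  show "energy 1 s (hat f) < \<infinity>"
    using assms sobolev_energy_eq[OF hat, of s] by (simp add: sobolev_def)
qed

lemma hat_measurable: "f \<in> sobolev s \<Longrightarrow> hat f \<in> borel_measurable borel"
  by (rule has_hat_measurable[OF sobolevD(2)])

lemma energy_add_le:
  assumes [measurable]: "u \<in> borel_measurable borel" "v \<in> borel_measurable borel"
  shows "energy h s (\<lambda>\<omega>. u \<omega> + v \<omega>) \<le> 2 * energy h s u + 2 * energy h s v"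
  unfolding energy_def by (rule nn_integral_norm_sq_add_le) measurable

lemma energy_cmult:
  assumes [measurable]: "u \<in> borel_measurable borel"
  shows "energy h s (\<lambda>\<omega>. a * u \<omega>) = ennreal ((cmod a)\<^sup>2) * energy h s u"
  unfolding energy_def
  by (subst nn_integral_cmult[symmetric])
    (auto simp: norm_mult power_mult_distrib ennreal_mult mult_ac)

lemma energy_finite_lin:
  assumes "u \<in> borel_measurable borel" "v \<in> borel_measurable borel"
    and "energy h s u < \<infinity>" "energy h s v < \<infinity>"
  shows "energy h s (\<lambda>\<omega>. a * u \<omega> + b * v \<omega>) < \<infinity>"
proof -
  have [measurable]: "u \<in> borel_measurable borel" "v \<in> borel_measurable borel" using assms by auto
  have "energy h s (\<lambda>\<omega>. a * u \<omega> + b * v \<omega>) \<le> 2 * energy h s (\<lambda>\<omega>. a * u \<omega>) + 2 * energy h s (\<lambda>\<omega>. b * v \<omega>)"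
    by (rule energy_add_le) measurable
  also have "\<dots> < \<infinity>" using assms by (simp add: energy_cmult ennreal_mult_less_top)
  finally show ?thesis .
qed

lemma powr_le_of_bounds:
  fixes x y :: real
  assumes "0 < a" "0 < y" "a * y \<le> x" "x \<le> b * y"
  shows "x powr t \<le> (a powr t + b powr t) * y powr t"
proof -
  have x: "x > 0" using assms mult_pos_pos[of a y] by linarith
  then have b: "b > 0" using assms zero_less_mult_pos2[of b y] by linarith
  show ?thesis
  proof (cases "t \<ge> 0")
    case True
    then have "x powr t \<le> (b * y) powr t" using assms x by (intro powr_mono2) auto
    also have "\<dots> = b powr t * y powr t" using assms b by (simp add: powr_mult)
    also have "\<dots> \<le> (a powr t + b powr t) * y powr t" by (intro mult_right_mono) auto
    finally show ?thesis .
  next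
    case False
    then have "x powr t \<le> (a * y) powr t" using assms x by (intro powr_mono2') auto
    also have "\<dots> = a powr t * y powr t" using assms by (simp add: powr_mult)
    also have "\<dots> \<le> (a powr t + b powr t) * y powr t" by (intro mult_right_mono) auto
    finally show ?thesis .
  qed
qed

lemma energy_dilate:
  fixes u :: "real^'d::finite \<Rightarrow> complex"
  assumes [measurable]: "u \<in> borel_measurable borel" and h: "h > 0"
  shows "energy h s u = ennreal (h powr (real CARD('d) + 2 * s)) * energy 1 s (\<lambda>\<omega>. u (h *\<^sub>R \<omega>))"
proof -
  have w: "ennreal ((h + norm (h *\<^sub>R \<omega>)) powr (2 * s)) =
      ennreal (h powr (2 * s)) * ennreal ((1 + norm \<omega>) powr (2 * s))" for \<omega> :: "real^'d"
  proof -
    have "h + norm (h *\<^sub>R \<omega>) = h * (1 + norm \<omega>)" using h by (simp add: distrib_left)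
    then show ?thesis using h by (simp add: powr_mult ennreal_mult)
  qed
  have "energy h s u = ennreal (\<bar>h\<bar> ^ DIM(real^'d)) *
     (\<integral>\<^sup>+\<omega>. ennreal ((h + norm (h *\<^sub>R \<omega>)) powr (2 * s)) * ennreal ((cmod (u (h *\<^sub>R \<omega>)))\<^sup>2) \<partial>lborel)"
    unfolding energy_def using h by (subst nn_integral_lborel_affine[where c = h and t = 0]) auto
  also have "\<dots> = ennreal (\<bar>h\<bar> ^ DIM(real^'d)) * (ennreal (h powr (2 * s)) * energy 1 s (\<lambda>\<omega>. u (h *\<^sub>R \<omega>)))"
    unfolding energy_def w by (subst nn_integral_cmult[symmetric]) (auto simp: mult.assoc)
  also have "\<dots> = ennreal (h powr (real CARD('d) + 2 * s)) * energy 1 s (\<lambda>\<omega>. u (h *\<^sub>R \<omega>))"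
    using h by (simp add: powr_add powr_realpow ennreal_mult mult.assoc)
  finally show ?thesis .
qed

lemma energy_weight_le:
  assumes [measurable]: "u \<in> borel_measurable borel" and h: "h > 0"
  shows "energy h s u \<le> ennreal (min h 1 powr (2 * s) + max h 1 powr (2 * s)) * energy 1 s u"
proof -
  have "energy h s u \<le> (\<integral>\<^sup>+\<omega>. ennreal (min h 1 powr (2 * s) + max h 1 powr (2 * s)) *
      (ennreal ((1 + norm \<omega>) powr (2 * s)) * ennreal ((cmod (u \<omega>))\<^sup>2)) \<partial>lborel)"
    unfolding energy_def
  proof (rule nn_integral_mono)
    fix \<omega> :: "real^'a"
    have "(h + norm \<omega>) powr (2 * s) \<le> (min h 1 powr (2 * s) + max h 1 powr (2 * s)) * (1 + norm \<omega>) powr (2 * s)"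
    proof (rule powr_le_of_bounds)
      have "min h 1 * norm \<omega> \<le> 1 * norm \<omega>" "1 * norm \<omega> \<le> max h 1 * norm \<omega>" by (intro mult_right_mono; simp)+
      then show "min h 1 * (1 + norm \<omega>) \<le> h + norm \<omega>" "h + norm \<omega> \<le> max h 1 * (1 + norm \<omega>)"
        by (auto simp: distrib_left intro: add_mono)
    qed (use h in \<open>auto simp: add_pos_nonneg\<close>)
    then have "ennreal ((h + norm \<omega>) powr (2 * s)) \<le>
       ennreal (min h 1 powr (2 * s) + max h 1 powr (2 * s)) * ennreal ((1 + norm \<omega>) powr (2 * s))"
      by (simp add: ennreal_mult[symmetric] ennreal_leI del: ennreal_plus)
    then show "ennreal ((h + norm \<omega>) powr (2 * s)) * ennreal ((cmod (u \<omega>))\<^sup>2) \<le>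
       ennreal (min h 1 powr (2 * s) + max h 1 powr (2 * s)) *
        (ennreal ((1 + norm \<omega>) powr (2 * s)) * ennreal ((cmod (u \<omega>))\<^sup>2))"
      unfolding mult.assoc[symmetric] by (rule mult_right_mono) simp
  qed
  also have "\<dots> = ennreal (min h 1 powr (2 * s) + max h 1 powr (2 * s)) * energy 1 s u"
    unfolding energy_def by (rule nn_integral_cmult) measurable
  finally show ?thesis .
qed

lemma energy_scaled:
  fixes u :: "real^'d::finite \<Rightarrow> complex"
  assumes u [measurable]: "u \<in> borel_measurable borel" and h: "h > 0"
  shows "energy 1 s (\<lambda>\<omega>. complex_of_real h ^ CARD('d) * u (h *\<^sub>R \<omega>)) =
    ennreal (h powr (real CARD('d) - 2 * s)) * energy h s u"
proof -
  have "energy 1 s (\<lambda>\<omega>. complex_of_real h ^ CARD('d) * u (h *\<^sub>R \<omega>)) =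
      ennreal (h powr (2 * real CARD('d))) * energy 1 s (\<lambda>\<omega>. u (h *\<^sub>R \<omega>))"
  proof -
    have "(h ^ CARD('d))\<^sup>2 = h powr (2 * real CARD('d))"
      by (simp only: mult_2 powr_add power2_eq_square powr_realpow[OF h])
    then show ?thesis using h by (simp add: energy_cmult norm_power)
  qed
  also have "h powr (2 * real CARD('d)) = h powr (real CARD('d) - 2 * s) * h powr (real CARD('d) + 2 * s)"
    by (simp add: powr_add[symmetric])
  also have "ennreal (h powr (real CARD('d) - 2 * s) * h powr (real CARD('d) + 2 * s)) * energy 1 s (\<lambda>\<omega>. u (h *\<^sub>R \<omega>)) =
      ennreal (h powr (real CARD('d) - 2 * s)) * energy h s u"
    by (subst energy_dilate[OF u h]) (simp add: ennreal_mult mult.assoc)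
  finally show ?thesis .
qed

lemma energy_scaled_le:
  fixes u :: "real^'d::finite \<Rightarrow> complex"
  assumes u: "u \<in> borel_measurable borel" and h: "h > 0"
  shows "energy 1 s (\<lambda>\<omega>. complex_of_real h ^ CARD('d) * u (h *\<^sub>R \<omega>)) \<le>
    ennreal (h powr (real CARD('d) - 2 * s) * (min h 1 powr (2 * s) + max h 1 powr (2 * s))) * energy 1 s u"
  using mult_left_mono[OF energy_weight_le[OF u h, of s], of "ennreal (h powr (real CARD('d) - 2 * s))"]
  by (simp add: energy_scaled[OF u h] ennreal_mult mult.assoc del: ennreal_plus)

lemma sobolev_lin:
  assumes "f \<in> sobolev s" "g \<in> sobolev s"
  shows "(\<lambda>\<psi>. a * f \<psi> + b * g \<psi>) \<in> sobolev s"
  using assms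
  by (intro sobolevI[OF tempered_lin has_hat_lin[OF sobolevD(2) sobolevD(2)]] energy_finite_lin)
    (auto dest: sobolevD intro: hat_measurable)

lemma sobolev_diff: "f \<in> sobolev s \<Longrightarrow> g \<in> sobolev s \<Longrightarrow> (\<lambda>\<psi>. f \<psi> - g \<psi>) \<in> sobolev s"
  using sobolev_lin[of f s g 1 "-1"] by simp

lemma sobolev_zero: "(\<lambda>_. 0) \<in> sobolev s"
  by (rule sobolevI[OF tempered_zero has_hat_zero]) (simp add: energy_def)

lemma sobolev_translate:
  assumes "f \<in> sobolev s"
  shows "translate \<alpha> f \<in> sobolev s"
proof (rule sobolevI[OF tempered_translate has_hat_translate])
  show "energy 1 s (\<lambda>\<omega>. cis (\<alpha> \<bullet> \<omega>) * hat f \<omega>) < \<infinity>"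
    using sobolevD(3)[OF assms] by (simp add: energy_def norm_mult)
qed (use sobolevD[OF assms] in auto)

lemma sobolev_dilate:
  fixes f :: "'d::finite dist"
  assumes "f \<in> sobolev s" "h > 0"
  shows "dilate h f \<in> sobolev s"
proof (rule sobolevI[OF tempered_dilate has_hat_dilate])
  show "energy 1 s (\<lambda>\<omega>. complex_of_real h ^ CARD('d) * hat f (h *\<^sub>R \<omega>)) < \<infinity>"
    using energy_scaled_le[OF hat_measurable[OF assms(1)] assms(2), of s] sobolevD(3)[OF assms(1)]
    by (auto simp: ennreal_mult_less_top le_less_trans simp del: ennreal_plus elim!: le_less_trans)
qed (use sobolevD[OF assms(1)] assms(2) in auto)

lemma sobolev_norm_sq:
  assumes f: "f \<in> sobolev s" and u: "has_hat f u"
  shows "ennreal ((sobolev_norm s f)\<^sup>2) = energy 1 s u"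
proof -
  have "sobolev_energy s f < \<infinity>" using f by (simp add: sobolev_def)
  then show ?thesis
    unfolding sobolev_norm_def sobolev_energy_eq[OF u, symmetric] by simp
qed

lemma sobolev_norm_nonneg: "sobolev_norm s f \<ge> 0"
  by (simp add: sobolev_norm_def)

lemma sobolev_dist_sq:
  assumes "f \<in> sobolev s" "g \<in> sobolev s" "has_hat f u" "has_hat g v"
  shows "ennreal ((sobolev_dist s f g)\<^sup>2) = energy 1 s (\<lambda>\<omega>. u \<omega> - v \<omega>)"
  unfolding sobolev_dist_def
  by (intro sobolev_norm_sq sobolev_diff has_hat_diff assms)

lemma sobolev_dist_nonneg: "sobolev_dist s f g \<ge> 0"
  by (simp add: sobolev_dist_def sobolev_norm_nonneg)

lemma sobolev_dist_dilate_le: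
  fixes f :: "'d::finite dist"
  assumes h: "h > 0"
  obtains K where "K \<ge> 0" "\<And>f g :: 'd dist. f \<in> sobolev s \<Longrightarrow> g \<in> sobolev s \<Longrightarrow>
    sobolev_dist s (dilate h f) (dilate h g) \<le> K * sobolev_dist s f g"
proof -
  define c where "c = h powr (real CARD('d) - 2 * s) * (min h 1 powr (2 * s) + max h 1 powr (2 * s))"
  have c: "c \<ge> 0" by (simp add: c_def)
  have "sobolev_dist s (dilate h f) (dilate h g) \<le> sqrt c * sobolev_dist s f g"
    if f: "f \<in> sobolev s" and g: "g \<in> sobolev s" for f g :: "'d dist"
  proof -
    have "ennreal ((sobolev_dist s (dilate h f) (dilate h g))\<^sup>2) =
        energy 1 s (\<lambda>\<omega>. complex_of_real h ^ CARD('d) * hat f (h *\<^sub>R \<omega>) - complex_of_real h ^ CARD('d) * hat g (h *\<^sub>R \<omega>))"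
      by (intro sobolev_dist_sq sobolev_dilate f g h has_hat_dilate sobolevD(1)[OF f] sobolevD(1)[OF g]
          sobolevD(2)[OF f] sobolevD(2)[OF g])
    also have "\<dots> = energy 1 s (\<lambda>\<omega>. complex_of_real h ^ CARD('d) * (\<lambda>\<omega>. hat f \<omega> - hat g \<omega>) (h *\<^sub>R \<omega>))"
      by (simp add: right_diff_distrib)
    also have "\<dots> \<le> ennreal c * energy 1 s (\<lambda>\<omega>. hat f \<omega> - hat g \<omega>)"
      unfolding c_def by (intro energy_scaled_le h borel_measurable_diff hat_measurable[OF f] hat_measurable[OF g])
    also have "\<dots> = ennreal c * ennreal ((sobolev_dist s f g)\<^sup>2)"
      by (subst sobolev_dist_sq[OF f g sobolevD(2)[OF f] sobolevD(2)[OF g]]) simp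
    also have "\<dots> = ennreal ((sqrt c * sobolev_dist s f g)\<^sup>2)"
      using c by (simp add: ennreal_mult[symmetric] power_mult_distrib)
    finally have "(sobolev_dist s (dilate h f) (dilate h g))\<^sup>2 \<le> (sqrt c * sobolev_dist s f g)\<^sup>2"
      by (simp add: ennreal_le_iff)
    then show ?thesis by (rule power2_le_imp_le) (intro mult_nonneg_nonneg sobolev_dist_nonneg, use c in simp)
  qed
  then show ?thesis using that[of "sqrt c"] c by simp
qed

section \<open>Principal shift-invariant spaces\<close>

lemma sobolev_closed_subspace: "closed_subspace s (sobolev s)" "shift_invariant 1 (sobolev s)"
  by (auto simp: closed_subspace_def shift_invariant_def sobolev_zero sobolev_lin sobolev_translate)

text \<open>All defining conditions are preserved by intersections, and \<open>sobolev s\<close> itself satisfies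
  them.\<close>

lemma psi_space_props:
  assumes \<phi>: "\<phi> \<in> sobolev s"
  shows "closed_subspace s (psi_space s \<phi>)" "shift_invariant 1 (psi_space s \<phi>)" "\<phi> \<in> psi_space s \<phi>"
proof -
  have sub: "psi_space s \<phi> \<subseteq> sobolev s"
    using sobolev_closed_subspace \<phi> unfolding psi_space_def by blast
  show "\<phi> \<in> psi_space s \<phi>" by (simp add: psi_space_def)
  show "shift_invariant 1 (psi_space s \<phi>)"
    unfolding shift_invariant_def psi_space_def by blast
  show "closed_subspace s (psi_space s \<phi>)"
    unfolding closed_subspace_def
  proof (intro conjI sub ballI allI impI)
    show "(\<lambda>_. 0) \<in> psi_space s \<phi>" by (auto simp: psi_space_def closed_subspace_def)
    show "(\<lambda>\<psi>. a * f \<psi> + b * g \<psi>) \<in> psi_space s \<phi>" if "f \<in> psi_space s \<phi>" "g \<in> psi_space s \<phi>" for f g a b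
      using that unfolding psi_space_def closed_subspace_def by blast
    fix F f assume *: "(\<forall>n. F n \<in> psi_space s \<phi>) \<and> f \<in> sobolev s \<and> (\<lambda>n. sobolev_dist s (F n) f) \<longlonglongrightarrow> 0"
    show "f \<in> psi_space s \<phi>"
      unfolding psi_space_def
    proof clarify
      fix V assume V: "closed_subspace s V" "shift_invariant 1 V" "\<phi> \<in> V"
      then have "\<forall>n. F n \<in> V" using * by (auto simp: psi_space_def)
      with V(1) * show "f \<in> V" unfolding closed_subspace_def by blast
    qed
  qed
qed

lemma psi_space_sobolev: "\<phi> \<in> sobolev s \<Longrightarrow> g \<in> psi_space s \<phi> \<Longrightarrow> g \<in> sobolev s"
  using psi_space_props(1) unfolding closed_subspace_def by blast

lemma dilate_inverse:
  fixes f :: "'d::finite dist"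
  assumes "h > 0"
  shows "dilate h (dilate (1 / h) f) = f" "dilate (1 / h) (dilate h f) = f"
proof -
  have "complex_of_real h ^ CARD('d) * (complex_of_real (1 / h) ^ CARD('d) * c) = c"
    "complex_of_real (1 / h) ^ CARD('d) * (complex_of_real h ^ CARD('d) * c) = c" for c
    using assms by (simp_all add: mult.assoc[symmetric] power_mult_distrib[symmetric])
  then show "dilate h (dilate (1 / h) f) = f" "dilate (1 / h) (dilate h f) = f"
    using assms by (auto simp: dilate_def fun_eq_iff)
qed

lemma translate_dilate: "translate (h *\<^sub>R \<alpha>) (dilate h f) = dilate h (translate \<alpha> f)"
  by (rule ext) (simp add: translate_def dilate_def scaleR_diff_right)

lemma dilate_closed_subspace:
  fixes V :: "'d::finite dist set"
  assumes V: "closed_subspace s V" and h: "h > 0"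
  shows "closed_subspace s (dilate h ` V)"
proof -
  have sub: "f \<in> sobolev s" if "f \<in> V" for f using V that by (auto simp: closed_subspace_def)
  show ?thesis
    unfolding closed_subspace_def
  proof (intro conjI allI impI ballI)
    show "dilate h ` V \<subseteq> sobolev s" using sub by (auto intro: sobolev_dilate h)
    have "dilate h (\<lambda>_. 0) = ((\<lambda>_. 0) :: 'd dist)" by (rule ext) (simp add: dilate_def)
    moreover have "(\<lambda>_. 0) \<in> V" using V by (simp add: closed_subspace_def)
    ultimately show "(\<lambda>_. 0) \<in> dilate h ` V" by (intro image_eqI[of _ _ "\<lambda>_. 0"]) simp_all
    fix f g a b assume "f \<in> dilate h ` V" "g \<in> dilate h ` V"
    then obtain f' g' where fg: "f' \<in> V" "g' \<in> V" "f = dilate h f'" "g = dilate h g'" by auto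
    have "(\<lambda>\<psi>. a * f \<psi> + b * g \<psi>) = dilate h (\<lambda>\<psi>. a * f' \<psi> + b * g' \<psi>)"
      by (rule ext) (simp add: fg dilate_def algebra_simps)
    moreover have "(\<lambda>\<psi>. a * f' \<psi> + b * g' \<psi>) \<in> V" using V fg by (auto simp: closed_subspace_def)
    ultimately show "(\<lambda>\<psi>. a * f \<psi> + b * g \<psi>) \<in> dilate h ` V" by blast
  next
    fix F f assume *: "(\<forall>n. F n \<in> dilate h ` V) \<and> f \<in> sobolev s \<and> (\<lambda>n. sobolev_dist s (F n) f) \<longlonglongrightarrow> 0"
    have GV: "dilate (1 / h) (F n) \<in> V" and FS: "F n \<in> sobolev s" for n
    proof -
      obtain g where "g \<in> V" "F n = dilate h g" using * by blast
      then show "dilate (1 / h) (F n) \<in> V" "F n \<in> sobolev s"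
        using dilate_inverse(2)[OF h, of g] sub sobolev_dilate[OF _ h] by auto
    qed
    obtain K where K: "K \<ge> 0" "\<And>f g :: 'd dist. f \<in> sobolev s \<Longrightarrow> g \<in> sobolev s \<Longrightarrow>
        sobolev_dist s (dilate (1 / h) f) (dilate (1 / h) g) \<le> K * sobolev_dist s f g"
      using sobolev_dist_dilate_le[of "1 / h"] h by auto
    have "(\<lambda>n. K * sobolev_dist s (F n) f) \<longlonglongrightarrow> K * 0" using * by (intro tendsto_intros) blast
    then have lim: "(\<lambda>n. K * sobolev_dist s (F n) f) \<longlonglongrightarrow> 0" by simp
    have lo: "\<forall>\<^sub>F n in sequentially. 0 \<le> sobolev_dist s (dilate (1 / h) (F n)) (dilate (1 / h) f)"
      by (intro always_eventually allI sobolev_dist_nonneg)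
    have hi: "\<forall>\<^sub>F n in sequentially. sobolev_dist s (dilate (1 / h) (F n)) (dilate (1 / h) f) \<le>
        K * sobolev_dist s (F n) f"
      using K(2)[OF FS] * by (intro always_eventually allI) blast
    have "(\<lambda>n. sobolev_dist s (dilate (1 / h) (F n)) (dilate (1 / h) f)) \<longlonglongrightarrow> 0"
      by (rule tendsto_sandwich[OF lo hi tendsto_const lim])
    moreover have "dilate (1 / h) f \<in> sobolev s" using * h by (intro sobolev_dilate) auto
    ultimately have "dilate (1 / h) f \<in> V" using V GV unfolding closed_subspace_def
      by (elim conjE allE[of _ "\<lambda>n. dilate (1 / h) (F n)"]) blast
    then show "f \<in> dilate h ` V"
      by (intro image_eqI[of _ _ "dilate (1 / h) f"]) (simp_all add: dilate_inverse(1)[OF h])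
  qed
qed

lemma ladder_psi:
  assumes "\<And>h. h > 0 \<Longrightarrow> \<phi> h \<in> sobolev s"
  shows "ladder s (\<lambda>h. dilate h ` psi_space s (\<phi> h))"
  unfolding ladder_def
proof (intro allI impI conjI)
  fix h :: real assume h: "h > 0"
  note P = psi_space_props[OF assms[OF h]]
  show "closed_subspace s (dilate h ` psi_space s (\<phi> h))" by (rule dilate_closed_subspace[OF P(1) h])
  show "shift_invariant h (dilate h ` psi_space s (\<phi> h))"
    using P(2) by (auto simp: shift_invariant_def translate_dilate)
qed

text \<open>Each coordinate exponential is the multiplier of a unit translation, so trigonometric
  polynomials act on closed shift-invariant spaces. They suffice for upper bounds of distances,
  because these are infima.\<close>

lemma trig_mult_closed:
  assumes V: "closed_subspace s V" "shift_invariant 1 V" and p: "p \<in> trig 1"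
    and g: "g \<in> V" "has_hat g u"
  shows "\<exists>g'\<in>V. has_hat g' (\<lambda>\<omega>. p \<omega> * u \<omega>)"
  using p g
proof (induction arbitrary: g u rule: trig.induct)
  case (const a)
  have "(\<lambda>\<psi>. a * g \<psi> + 0 * g \<psi>) \<in> V" using V(1) const(1) unfolding closed_subspace_def by blast
  then show ?case using has_hat_lin[OF const(2) const(2), of a 0] by auto
next
  case (char i)
  have "translate (1 *\<^sub>R axis i 1) g \<in> V"
    using V(2) char(1) by (auto simp: shift_invariant_def axis_def)
  then show ?case using has_hat_translate[OF char(2), of "axis i 1"]
    by (intro bexI[of _ "translate (axis i 1) g"]) (auto simp: inner_axis')
next
  case (char_uminus i)
  have "translate (1 *\<^sub>R axis i (- 1)) g \<in> V"
    using V(2) char_uminus(1) by (auto simp: shift_invariant_def axis_def)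
  then show ?case using has_hat_translate[OF char_uminus(2), of "axis i (- 1)"]
    by (intro bexI[of _ "translate (axis i (- 1)) g"]) (auto simp: inner_axis')
next
  case (add p q)
  obtain g1 g2 where g: "g1 \<in> V" "has_hat g1 (\<lambda>\<omega>. p \<omega> * u \<omega>)" "g2 \<in> V" "has_hat g2 (\<lambda>\<omega>. q \<omega> * u \<omega>)"
    using add.IH(1)[OF add.prems] add.IH(2)[OF add.prems] by blast
  have "(\<lambda>\<psi>. 1 * g1 \<psi> + 1 * g2 \<psi>) \<in> V" using V(1) g unfolding closed_subspace_def by blast
  then show ?case using has_hat_lin[OF g(2,4), of 1 1] by (auto simp: distrib_right)
next
  case (mult p q)
  obtain g2 where g2: "g2 \<in> V" "has_hat g2 (\<lambda>\<omega>. q \<omega> * u \<omega>)"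
    using mult.IH(2)[OF mult.prems] by blast
  from mult.IH(1)[OF this] show ?case by (simp add: mult.assoc)
qed

section \<open>Sums over the dual lattice\<close>

lemma infsum_ennreal_suminf:
  fixes f :: "'a \<Rightarrow> ennreal"
  assumes "countable A"
  shows "infsum f A = (\<Sum>n. if n \<in> to_nat_on A ` A then f (from_nat_into A n) else 0)"
proof -
  have "infsum f A = (\<Sum>\<^sub>\<infinity>n\<in>to_nat_on A ` A. f (from_nat_into A n))"
    using assms by (intro infsum_reindex_bij_betw[symmetric] bij_betwI[of _ _ _ "to_nat_on A"])
      (auto simp: from_nat_into_to_nat_on)
  also have "\<dots> = (\<Sum>\<^sub>\<infinity>n. if n \<in> to_nat_on A ` A then f (from_nat_into A n) else 0)"
    by (intro infsum_cong_neutral) auto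
  also have "\<dots> = (\<Sum>n. if n \<in> to_nat_on A ` A then f (from_nat_into A n) else 0)"
    by (intro sums_unique has_sum_imp_sums has_sum_infsum nonneg_summable_on_complete) simp
  finally show ?thesis .
qed

lemma measurable_infsum_ennreal:
  fixes f :: "'a \<Rightarrow> 'b \<Rightarrow> ennreal"
  assumes A: "countable A" and f: "\<And>a. a \<in> A \<Longrightarrow> f a \<in> borel_measurable M"
  shows "(\<lambda>x. \<Sum>\<^sub>\<infinity>a\<in>A. f a x) \<in> borel_measurable M"
proof -
  have "(\<lambda>x. if n \<in> to_nat_on A ` A then f (from_nat_into A n) x else 0) \<in> borel_measurable M" for n
    using f A by (cases "n \<in> to_nat_on A ` A") auto
  then show ?thesis unfolding infsum_ennreal_suminf[OF A] by (rule borel_measurable_suminf_order)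
qed

lemma nn_integral_infsum:
  fixes f :: "'a \<Rightarrow> 'b \<Rightarrow> ennreal"
  assumes A: "countable A" and f: "\<And>a. a \<in> A \<Longrightarrow> f a \<in> borel_measurable M"
  shows "(\<integral>\<^sup>+x. (\<Sum>\<^sub>\<infinity>a\<in>A. f a x) \<partial>M) = (\<Sum>\<^sub>\<infinity>a\<in>A. \<integral>\<^sup>+x. f a x \<partial>M)"
proof -
  have "(\<lambda>x. if n \<in> to_nat_on A ` A then f (from_nat_into A n) x else 0) \<in> borel_measurable M" for n
    using f A by (cases "n \<in> to_nat_on A ` A") auto
  then have "(\<integral>\<^sup>+x. (\<Sum>\<^sub>\<infinity>a\<in>A. f a x) \<partial>M) =
      (\<Sum>n. \<integral>\<^sup>+x. (if n \<in> to_nat_on A ` A then f (from_nat_into A n) x else 0) \<partial>M)"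
    unfolding infsum_ennreal_suminf[OF A] by (rule nn_integral_suminf)
  also have "\<dots> = (\<Sum>n. if n \<in> to_nat_on A ` A then (\<integral>\<^sup>+x. f (from_nat_into A n) x \<partial>M) else 0)"
    by (intro suminf_cong) auto
  finally show ?thesis unfolding infsum_ennreal_suminf[OF A] .
qed

lemma infsum_cmult_ennreal:
  fixes f :: "'a \<Rightarrow> ennreal"
  assumes A: "countable A"
  shows "(\<Sum>\<^sub>\<infinity>a\<in>A. c * f a) = c * infsum f A"
  unfolding infsum_ennreal_suminf[OF A] ennreal_suminf_cmult[symmetric]
  by (intro suminf_cong) auto

lemma infsum_ge_term_ennreal:
  fixes f :: "'a \<Rightarrow> ennreal"
  assumes "a \<in> A"
  shows "f a \<le> infsum f A"
  using infsum_mono_neutral[of f "{a}" f A] assms by (auto simp: nonneg_summable_on_complete)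

lemma dual_latticeE:
  assumes "\<alpha> \<in> dual_lattice"
  obtains n :: "'d::finite \<Rightarrow> int" where "\<And>i. \<alpha> $ i = 2 * pi * of_int (n i)"
proof -
  have "\<forall>i. \<exists>n :: int. \<alpha> $ i = 2 * pi * of_int n" using assms by (simp add: dual_lattice_def)
  from choice[OF this] show ?thesis using that by blast
qed

lemma dual_lattice_zero [simp]: "0 \<in> dual_lattice"
  by (auto simp: dual_lattice_def intro: exI[of _ "0 :: int"])

lemma dual_lattice_diff:
  assumes "\<alpha> \<in> dual_lattice" "\<beta> \<in> dual_lattice"
  shows "\<alpha> - \<beta> \<in> dual_lattice"
proof -
  obtain m n where "\<And>i. \<alpha> $ i = 2 * pi * of_int (m i)" "\<And>i. \<beta> $ i = 2 * pi * of_int (n i)"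
    using assms by (metis dual_latticeE)
  then have "(\<alpha> - \<beta>) $ i = 2 * pi * of_int (m i - n i)" for i by (simp add: algebra_simps)
  then show ?thesis unfolding dual_lattice_def by blast
qed

lemma countable_dual_lattice: "countable (dual_lattice :: (real^'d::finite) set)"
proof -
  have "dual_lattice \<subseteq> (\<lambda>f :: 'd \<Rightarrow> int. \<chi> i. 2 * pi * of_int (f i)) ` UNIV"
  proof
    fix \<alpha> :: "real^'d" assume "\<alpha> \<in> dual_lattice"
    then obtain f :: "'d \<Rightarrow> int" where "\<And>i. \<alpha> $ i = 2 * pi * of_int (f i)"
      using dual_latticeE by blast
    then show "\<alpha> \<in> (\<lambda>f :: 'd \<Rightarrow> int. \<chi> i. 2 * pi * of_int (f i)) ` UNIV"
      by (intro image_eqI[of _ _ f]) (auto simp: vec_eq_iff)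
  qed
  moreover have "countable (UNIV :: ('d \<Rightarrow> int) set)" by (rule countableI_type)
  ultimately show ?thesis by (meson countable_image countable_subset)
qed

lemma countable_dual_lattice_minus: "countable (dual_lattice - {0} :: (real^'d::finite) set)"
  by (rule countable_subset[OF Diff_subset countable_dual_lattice])

lemma norm_dual_lattice:
  assumes "\<alpha> \<in> dual_lattice" "\<alpha> \<noteq> 0"
  shows "norm \<alpha> \<ge> 6"
proof -
  obtain i where i: "\<alpha> $ i \<noteq> 0" using assms(2) by (auto simp: vec_eq_iff)
  obtain n :: int where n: "\<alpha> $ i = 2 * pi * of_int n" using assms(1) by (auto simp: dual_lattice_def)
  with i have "n \<noteq> 0" by auto
  then have "1 \<le> \<bar>real_of_int n\<bar>" by linarith
  then have "2 * pi * 1 \<le> 2 * pi * \<bar>real_of_int n\<bar>" by (intro mult_left_mono) auto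
  moreover have "\<bar>\<alpha> $ i\<bar> = 2 * pi * \<bar>real_of_int n\<bar>" using n by (simp add: abs_mult)
  ultimately have "6 \<le> \<bar>\<alpha> $ i\<bar>" using pi_gt3 by linarith
  then show ?thesis using component_le_norm_cart[of \<alpha> i] by linarith
qed

lemma AE_dual_lattice:
  fixes P :: "real^'d::finite \<Rightarrow> bool"
  assumes "AE \<omega> in lborel. P \<omega>"
  shows "AE \<omega> in lborel. \<forall>\<alpha>\<in>dual_lattice. P (\<omega> + \<alpha>)"
  using AE_lborel_affine[OF assms, of 1]
  by (subst AE_ball_countable[OF countable_dual_lattice]) (simp add: add.commute)

lemma cis_dual_lattice:
  assumes "\<alpha> \<in> dual_lattice" "\<And>i. a $ i \<in> \<int>"
  shows "cis (a \<bullet> (\<omega> + \<alpha>)) = cis (a \<bullet> \<omega>)"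
proof -
  obtain n :: "'a \<Rightarrow> int" where n: "\<And>i. \<alpha> $ i = 2 * pi * of_int (n i)"
    using dual_latticeE[OF assms(1)] by blast
  have "a \<bullet> \<alpha> = 2 * pi * (\<Sum>i\<in>UNIV. a $ i * of_int (n i))"
    by (simp add: inner_vec_def n sum_distrib_left mult_ac)
  moreover have "(\<Sum>i\<in>UNIV. a $ i * of_int (n i)) \<in> \<int>" using assms(2) by (intro Ints_sum Ints_mult) auto
  ultimately have "cis (a \<bullet> \<alpha>) = 1" by (simp add: cis_multiple_2pi)
  then show ?thesis by (simp add: inner_add_right cis_mult[symmetric])
qed

lemma nn_integral_translate:
  fixes f :: "real^'d::finite \<Rightarrow> ennreal"
  assumes "f \<in> borel_measurable borel"
  shows "(\<integral>\<^sup>+\<xi>. f \<xi> \<partial>lborel) = (\<integral>\<^sup>+\<xi>. f (\<xi> + \<alpha>) \<partial>lborel)"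
  using nn_integral_lborel_affine[OF assms, of 1 \<alpha>] by (simp add: add.commute)

section \<open>The fibres of a principal shift-invariant space\<close>

text \<open>The distributions with this property form a closed shift-invariant subspace containing
  \<open>\<phi>\<close>: an integer translation multiplies the whole fibre by one number, and a convergent
  sequence in \<open>W\<^sub>2\<^sup>s\<close> has a subsequence whose Fourier transforms converge almost everywhere, while
  the multiples of a fixed vector are closed under pointwise convergence. A relation of the form
  \<open>hat g (\<omega>) hat \<phi> (\<omega> + \<alpha>) = hat g (\<omega> + \<alpha>) hat \<phi> (\<omega>)\<close> would be weaker: it says nothing on the
  fibres on which \<open>hat \<phi>\<close> vanishes.\<close>

lemma psi_space_fibre:
  fixes \<phi> :: "'d::finite dist"
  assumes \<phi>: "\<phi> \<in> sobolev s" and g: "g \<in> psi_space s \<phi>"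
  shows "AE \<omega> in lborel. \<exists>c. \<forall>\<alpha>\<in>dual_lattice. hat g (\<omega> + \<alpha>) = c * hat \<phi> (\<omega> + \<alpha>)"
proof -
  define R where "R u \<longleftrightarrow> (AE \<omega> in lborel. \<exists>c. \<forall>\<alpha>\<in>dual_lattice. u (\<omega> + \<alpha>) = c * hat \<phi> (\<omega> + \<alpha>))"
    for u :: "real^'d \<Rightarrow> complex"
  define V where "V = {g \<in> sobolev s. R (hat g)}"
  have R_cong: "R (hat f)" if u: "has_hat f u" and R: "R u" for f u
  proof -
    have "AE \<omega> in lborel. u \<omega> = hat f \<omega>" by (rule has_hat_unique[OF u has_hat_hat[OF u]])
    from AE_dual_lattice[OF this] R show ?thesis
      unfolding R_def by eventually_elim simp
  qed
  have "closed_subspace s V"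
    unfolding closed_subspace_def
  proof (intro conjI ballI allI impI)
    show "V \<subseteq> sobolev s" by (auto simp: V_def)
    have "R (\<lambda>_. 0)" unfolding R_def by (intro AE_I2 exI[of _ 0]) simp
    from R_cong[OF has_hat_zero this] show "(\<lambda>_. 0) \<in> V" by (simp add: V_def sobolev_zero)
    fix f g a b assume f: "f \<in> V" and g: "g \<in> V"
    have "R (\<lambda>\<omega>. a * hat f \<omega> + b * hat g \<omega>)"
      unfolding R_def using f[unfolded V_def R_def, THEN CollectD, THEN conjunct2] g[unfolded V_def R_def, THEN CollectD, THEN conjunct2]
    proof eventually_elim
      case (elim \<omega>)
      then obtain c d where "\<forall>\<alpha>\<in>dual_lattice. hat f (\<omega> + \<alpha>) = c * hat \<phi> (\<omega> + \<alpha>)"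
        "\<forall>\<alpha>\<in>dual_lattice. hat g (\<omega> + \<alpha>) = d * hat \<phi> (\<omega> + \<alpha>)" by blast
      then show ?case by (intro exI[of _ "a * c + b * d"]) (simp add: algebra_simps)
    qed
    then show "(\<lambda>\<psi>. a * f \<psi> + b * g \<psi>) \<in> V"
      using f g by (auto simp: V_def sobolev_lin intro!: R_cong[OF has_hat_lin] sobolevD(2))
  next
    fix F f assume *: "(\<forall>n. F n \<in> V) \<and> f \<in> sobolev s \<and> (\<lambda>n. sobolev_dist s (F n) f) \<longlonglongrightarrow> 0"
    then have FS: "F n \<in> sobolev s" and RF: "R (hat (F n))" and f: "f \<in> sobolev s" for n by (auto simp: V_def)
    have [measurable]: "hat (F n) \<in> borel_measurable borel" "hat f \<in> borel_measurable borel" for n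
      by (auto intro: hat_measurable FS f)
    define D where "D n \<omega> = (1 + norm \<omega>) powr (2 * s) * (cmod (hat (F n) \<omega> - hat f \<omega>))\<^sup>2" for n \<omega>
    have [measurable]: "D n \<in> borel_measurable borel" for n unfolding D_def by measurable
    have Dn: "(\<integral>\<^sup>+\<omega>. ennreal (D n \<omega>) \<partial>lborel) = ennreal ((sobolev_dist s (F n) f)\<^sup>2)" for n
      by (subst sobolev_dist_sq[OF FS f sobolevD(2)[OF FS] sobolevD(2)[OF f]])
        (simp add: D_def energy_def ennreal_mult)
    have D0: "D n \<omega> \<ge> 0" for n \<omega> by (simp add: D_def)
    have Di: "integrable lborel (D n)" for n
      by (rule integrableI_nonneg) (auto simp: D0 Dn)
    have DI: "(\<integral>\<omega>. D n \<omega> \<partial>lborel) = (sobolev_dist s (F n) f)\<^sup>2" for n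
      using Dn[of n] by (subst (asm) nn_integral_eq_integral[OF Di])
        (auto simp: D0 Bochner_Integration.integral_nonneg)
    have "(\<lambda>n. (sobolev_dist s (F n) f)\<^sup>2) \<longlonglongrightarrow> 0\<^sup>2" using * by (intro tendsto_intros) blast
    then have "(\<lambda>n. \<integral>\<omega>. norm (D n \<omega>) \<partial>lborel) \<longlonglongrightarrow> 0" using D0 by (simp add: DI)
    from tendsto_L1_AE_subseq[OF Di this] obtain r where r: "AE \<omega> in lborel. (\<lambda>n. D (r n) \<omega>) \<longlonglongrightarrow> 0" by blast
    have "AE \<omega> in lborel. (\<lambda>n. hat (F (r n)) \<omega>) \<longlonglongrightarrow> hat f \<omega>"
      using r
    proof eventually_elim
      case (elim \<omega>)
      have "1 + norm \<omega> > 0" by (simp add: add_pos_nonneg)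
      then have w: "(1 + norm \<omega>) powr (2 * s) > 0" by simp
      have "(\<lambda>n. inverse ((1 + norm \<omega>) powr (2 * s)) * D (r n) \<omega>) \<longlonglongrightarrow> inverse ((1 + norm \<omega>) powr (2 * s)) * 0"
        by (intro tendsto_intros elim)
      then have "(\<lambda>n. (cmod (hat (F (r n)) \<omega> - hat f \<omega>))\<^sup>2) \<longlonglongrightarrow> 0"
        using w by (simp add: D_def mult.assoc[symmetric])
      from tendsto_real_sqrt[OF this] have "(\<lambda>n. cmod (hat (F (r n)) \<omega> - hat f \<omega>)) \<longlonglongrightarrow> 0" by simp
      then show ?case using LIM_zero_cancel tendsto_norm_zero_iff by blast
    qed
    from AE_dual_lattice[OF this]
    have lim: "AE \<omega> in lborel. \<forall>\<alpha>\<in>dual_lattice. (\<lambda>n. hat (F (r n)) (\<omega> + \<alpha>)) \<longlonglongrightarrow> hat f (\<omega> + \<alpha>)" .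
    have "AE \<omega> in lborel. \<forall>n. \<exists>c. \<forall>\<alpha>\<in>dual_lattice. hat (F (r n)) (\<omega> + \<alpha>) = c * hat \<phi> (\<omega> + \<alpha>)"
      using RF unfolding R_def AE_all_countable by blast
    with lim have "R (hat f)"
      unfolding R_def
    proof eventually_elim
      case (elim \<omega>)
      obtain c where c: "\<And>n \<alpha>. \<alpha> \<in> dual_lattice \<Longrightarrow> hat (F (r n)) (\<omega> + \<alpha>) = c n * hat \<phi> (\<omega> + \<alpha>)"
        using elim(2) by metis
      show ?case
      proof (cases "\<forall>\<alpha>\<in>dual_lattice. hat \<phi> (\<omega> + \<alpha>) = 0")
        case True
        have "hat f (\<omega> + \<alpha>) = 0" if "\<alpha> \<in> dual_lattice" for \<alpha>
          using elim(1) c True that by (auto simp: LIMSEQ_const_iff)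
        then show ?thesis by (intro exI[of _ 0]) simp
      next
        case False
        then obtain \<beta> where \<beta>: "\<beta> \<in> dual_lattice" "hat \<phi> (\<omega> + \<beta>) \<noteq> 0" by blast
        have "(\<lambda>n. hat (F (r n)) (\<omega> + \<beta>) / hat \<phi> (\<omega> + \<beta>)) \<longlonglongrightarrow> hat f (\<omega> + \<beta>) / hat \<phi> (\<omega> + \<beta>)"
          using elim(1) \<beta> by (intro tendsto_intros) auto
        then have cl: "c \<longlonglongrightarrow> hat f (\<omega> + \<beta>) / hat \<phi> (\<omega> + \<beta>)" using c[OF \<beta>(1)] \<beta>(2) by simp
        have "hat f (\<omega> + \<alpha>) = hat f (\<omega> + \<beta>) / hat \<phi> (\<omega> + \<beta>) * hat \<phi> (\<omega> + \<alpha>)" if \<alpha>: "\<alpha> \<in> dual_lattice" for \<alpha>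
        proof (rule LIMSEQ_unique)
          show "(\<lambda>n. hat (F (r n)) (\<omega> + \<alpha>)) \<longlonglongrightarrow> hat f (\<omega> + \<alpha>)" using elim(1) \<alpha> by blast
          show "(\<lambda>n. hat (F (r n)) (\<omega> + \<alpha>)) \<longlonglongrightarrow> hat f (\<omega> + \<beta>) / hat \<phi> (\<omega> + \<beta>) * hat \<phi> (\<omega> + \<alpha>)"
            unfolding c[OF \<alpha>] by (intro tendsto_intros cl)
        qed
        then show ?thesis by blast
      qed
    qed
    then show "f \<in> V" using f by (simp add: V_def)
  qed
  moreover have "shift_invariant 1 V"
    unfolding shift_invariant_def
  proof (intro ballI allI impI)
    fix f and a :: "real^'d" assume f: "f \<in> V" and a: "\<forall>i. a $ i \<in> \<int>"
    have "R (\<lambda>\<omega>. cis (a \<bullet> \<omega>) * hat f \<omega>)"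
      unfolding R_def using f[unfolded V_def R_def, THEN CollectD, THEN conjunct2]
    proof eventually_elim
      case (elim \<omega>)
      then obtain c where "\<forall>\<alpha>\<in>dual_lattice. hat f (\<omega> + \<alpha>) = c * hat \<phi> (\<omega> + \<alpha>)" by blast
      then show ?case using a by (intro exI[of _ "cis (a \<bullet> \<omega>) * c"]) (simp add: cis_dual_lattice)
    qed
    then show "translate (1 *\<^sub>R a) f \<in> V"
      using f by (auto simp: V_def sobolev_translate intro!: R_cong[OF has_hat_translate] sobolevD(2))
  qed
  moreover have "\<phi> \<in> V" using \<phi> by (auto simp: V_def R_def intro!: exI[of _ 1])
  ultimately have "g \<in> V" using g unfolding psi_space_def by blast
  then show ?thesis by (simp add: V_def R_def)
qed

section \<open>Approximation order and the low-frequency bound\<close>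

text \<open>The sum \<open>bracket0\<close> with the dilated weight \<open>(h + |\<cdot>|)^(2 s)\<close>.\<close>

definition alias_sum :: "real \<Rightarrow> real \<Rightarrow> (real^'d::finite \<Rightarrow> complex) \<Rightarrow> real^'d \<Rightarrow> ennreal" where
  "alias_sum h s \<Phi> \<xi> = (\<Sum>\<^sub>\<infinity>\<alpha>\<in>dual_lattice - {0}.
     ennreal ((h + norm (\<xi> + \<alpha>)) powr (2 * s)) * ennreal ((cmod (\<Phi> (\<xi> + \<alpha>)))\<^sup>2))"

lemma alias_sum_measurable [measurable]:
  assumes [measurable]: "\<Phi> \<in> borel_measurable borel"
  shows "alias_sum h s \<Phi> \<in> borel_measurable borel"
  unfolding alias_sum_def[abs_def]
  by (rule measurable_infsum_ennreal[OF countable_dual_lattice_minus]) measurable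

lemma bracket0_measurable:
  assumes "\<phi> \<in> sobolev s"
  shows "bracket0 s \<phi> \<in> borel_measurable borel"
proof -
  have [measurable]: "hat \<phi> \<in> borel_measurable borel" by (rule hat_measurable[OF assms])
  show ?thesis
    unfolding bracket0_def[abs_def]
    by (rule measurable_infsum_ennreal[OF countable_dual_lattice_minus]) measurable
qed

text \<open>A factor that covers both signs of the exponent \<open>t\<close> when two bases differ by a factor of at
  most \<open>2\<close>.\<close>

definition weight_const :: "real \<Rightarrow> real" where
  "weight_const t = 1 + 2 powr t + (1 / 2) powr t"

lemma weight_const_pos: "weight_const t > 0"
  by (simp add: weight_const_def add_pos_pos)

lemma weight_compare:
  assumes "0 < y" "y / 2 \<le> x" "x \<le> 2 * y"
  shows "x powr t \<le> weight_const t * y powr t"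
proof -
  have "x powr t \<le> ((1 / 2) powr t + 2 powr t) * y powr t"
    using assms by (intro powr_le_of_bounds) auto
  also have "\<dots> \<le> weight_const t * y powr t"
    by (intro mult_right_mono) (auto simp: weight_const_def)
  finally show ?thesis .
qed

text \<open>Near the origin all points \<open>\<xi> + \<alpha>\<close> with \<open>\<alpha> \<noteq> 0\<close> have norm at least \<open>1\<close>, so the shift by
  \<open>h \<le> 1\<close> in the weight changes their norms by a factor of at most \<open>2\<close>.\<close>

lemma
  fixes \<xi> :: "real^'d::finite"
  assumes h: "0 < h" "h \<le> 1" and \<xi>: "norm \<xi> < 1"
  shows alias_sum_le_bracket0: "alias_sum h s (hat \<phi>) \<xi> \<le> ennreal (weight_const (2 * s)) * bracket0 s \<phi> \<xi>"
    and bracket0_le_alias_sum: "bracket0 s \<phi> \<xi> \<le> ennreal (weight_const (2 * s)) * alias_sum h s (hat \<phi>) \<xi>"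
proof -
  let ?c = "weight_const (2 * s)"
  have c: "?c \<ge> 0" using weight_const_pos[of "2 * s"] by simp
  have n: "norm (\<xi> + \<alpha>) \<ge> 1" if "\<alpha> \<in> dual_lattice - {0}" for \<alpha>
    using norm_dual_lattice[of \<alpha>] that norm_diff_ineq[of \<alpha> \<xi>] \<xi> by (auto simp: add.commute)
  have le1: "(h + norm (\<xi> + \<alpha>)) powr (2 * s) \<le> ?c * norm (\<xi> + \<alpha>) powr (2 * s)"
    if "\<alpha> \<in> dual_lattice - {0}" for \<alpha>
    using n[OF that] h by (intro weight_compare) auto
  have le2: "norm (\<xi> + \<alpha>) powr (2 * s) \<le> ?c * (h + norm (\<xi> + \<alpha>)) powr (2 * s)"
    if "\<alpha> \<in> dual_lattice - {0}" for \<alpha>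
    using n[OF that] h by (intro weight_compare) auto
  show "alias_sum h s (hat \<phi>) \<xi> \<le> ennreal ?c * bracket0 s \<phi> \<xi>"
    unfolding alias_sum_def bracket0_def infsum_cmult_ennreal[OF countable_dual_lattice_minus, symmetric]
  proof (intro infsum_mono nonneg_summable_on_complete)
    fix \<alpha> :: "real^'d" assume a: "\<alpha> \<in> dual_lattice - {0}"
    have "(h + norm (\<xi> + \<alpha>)) powr (2 * s) * (cmod (hat \<phi> (\<xi> + \<alpha>)))\<^sup>2 \<le>
        ?c * norm (\<xi> + \<alpha>) powr (2 * s) * (cmod (hat \<phi> (\<xi> + \<alpha>)))\<^sup>2"
      by (intro mult_right_mono le1 a) simp
    then show "ennreal ((h + norm (\<xi> + \<alpha>)) powr (2 * s)) * ennreal ((cmod (hat \<phi> (\<xi> + \<alpha>)))\<^sup>2) \<le>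
        ennreal ?c * ennreal ((cmod (hat \<phi> (\<xi> + \<alpha>)))\<^sup>2 * norm (\<xi> + \<alpha>) powr (2 * s))"
      using c by (simp add: ennreal_mult[symmetric] mult_ac ennreal_leI)
  qed auto
  show "bracket0 s \<phi> \<xi> \<le> ennreal ?c * alias_sum h s (hat \<phi>) \<xi>"
    unfolding alias_sum_def bracket0_def infsum_cmult_ennreal[OF countable_dual_lattice_minus, symmetric]
  proof (intro infsum_mono nonneg_summable_on_complete)
    fix \<alpha> :: "real^'d" assume a: "\<alpha> \<in> dual_lattice - {0}"
    have "norm (\<xi> + \<alpha>) powr (2 * s) * (cmod (hat \<phi> (\<xi> + \<alpha>)))\<^sup>2 \<le>
        ?c * (h + norm (\<xi> + \<alpha>)) powr (2 * s) * (cmod (hat \<phi> (\<xi> + \<alpha>)))\<^sup>2"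
      by (intro mult_right_mono le2 a) simp
    then show "ennreal ((cmod (hat \<phi> (\<xi> + \<alpha>)))\<^sup>2 * norm (\<xi> + \<alpha>) powr (2 * s)) \<le>
       ennreal ?c * (ennreal ((h + norm (\<xi> + \<alpha>)) powr (2 * s)) * ennreal ((cmod (hat \<phi> (\<xi> + \<alpha>)))\<^sup>2))"
      using c by (simp add: ennreal_mult[symmetric] mult_ac ennreal_leI)
  qed auto
qed

text \<open>The multiplied-out form of a bound on the bracket quotient. The parameter \<open>h = 0\<close> is allowed
  and describes the stationary case.\<close>

definition low_frequency_bound :: "real \<Rightarrow> real \<Rightarrow> real \<Rightarrow> real \<Rightarrow> real \<Rightarrow> 'd::finite dist \<Rightarrow> bool" where
  "low_frequency_bound s k h \<epsilon> M \<phi> \<longleftrightarrow> (AE \<xi> in lborel. norm \<xi> < \<epsilon> \<longrightarrow>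
     hat \<phi> \<xi> \<noteq> 0 \<and> bracket0 s \<phi> \<xi> \<le> ennreal (M * (cmod (hat \<phi> \<xi>))\<^sup>2 * ((norm \<xi>)\<^sup>2 + h\<^sup>2) powr k))"

lemma weight_sq_compare:
  fixes h r t :: real
  assumes "h > 0" "r \<ge> 0"
  shows "(r\<^sup>2 + h\<^sup>2) powr t \<le> weight_const t * (h + r) powr (2 * t)"
    and "(h + r) powr (2 * t) \<le> weight_const t * (r\<^sup>2 + h\<^sup>2) powr t"
proof -
  have "(h + r)\<^sup>2 = (h + r) powr 2" using assms by (simp add: powr_numeral)
  then have e: "(h + r) powr (2 * t) = ((h + r)\<^sup>2) powr t" by (simp only: powr_powr)
  have hr: "h * r \<ge> 0" using assms by simp
  have "2 * (h * r) \<le> h\<^sup>2 + r\<^sup>2" using zero_le_power2[of "h - r"] by (simp add: power2_diff)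
  then have *: "(h + r)\<^sup>2 / 2 \<le> r\<^sup>2 + h\<^sup>2" "r\<^sup>2 + h\<^sup>2 \<le> (h + r)\<^sup>2"
    using hr by (simp_all add: power2_sum)
  have p: "(h + r)\<^sup>2 > 0" "r\<^sup>2 + h\<^sup>2 > 0" using assms by (auto simp: add_nonneg_pos)
  show "(r\<^sup>2 + h\<^sup>2) powr t \<le> weight_const t * (h + r) powr (2 * t)"
    unfolding e using * p by (intro weight_compare) auto
  show "(h + r) powr (2 * t) \<le> weight_const t * (r\<^sup>2 + h\<^sup>2) powr t"
    unfolding e using * p by (intro weight_compare) auto
qed

subsection \<open>Sufficiency\<close>

text \<open>The multiplier is \<open>R\<close>, continued periodically along the dual lattice by \<open>unwrap\<close>. On the
  ball of radius \<open>\<epsilon>\<close> it reproduces \<open>F\<close>. At a point outside, it is nonzero only if the point is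
  \<open>v + \<alpha>\<close> with \<open>v\<close> in the ball and \<open>\<alpha> \<noteq> 0\<close>, and then its contribution is one term of the sum
  defining \<open>alias_sum\<close> at \<open>v\<close>.\<close>

lemma periodic_error_le:
  fixes F \<Phi> :: "real^'d::finite \<Rightarrow> complex"
  assumes [measurable]: "F \<in> borel_measurable borel" "\<Phi> \<in> borel_measurable borel"
    and eps: "0 < \<epsilon>" "\<epsilon> \<le> 1" and nz: "AE \<xi> in lborel. norm \<xi> < \<epsilon> \<longrightarrow> \<Phi> \<xi> \<noteq> 0"
    and R_def: "R = (\<lambda>v. if norm v < \<epsilon> then F v / \<Phi> v else 0)"
  shows "energy h s (\<lambda>\<xi>. (if norm \<xi> < \<epsilon> then F \<xi> else 0) - R (unwrap (torus 1 \<xi>)) * \<Phi> \<xi>) \<le>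
    (\<integral>\<^sup>+\<xi>. ennreal ((cmod (R \<xi>))\<^sup>2) * alias_sum h s \<Phi> \<xi> \<partial>lborel)"
proof -
  let ?L = "dual_lattice - {0} :: (real^'d) set"
  have [measurable]: "R \<in> borel_measurable borel" unfolding R_def by measurable
  define g where "g \<alpha> \<xi> = ennreal ((cmod (R (\<xi> - \<alpha>)))\<^sup>2) *
    (ennreal ((h + norm \<xi>) powr (2 * s)) * ennreal ((cmod (\<Phi> \<xi>))\<^sup>2))" for \<alpha> \<xi>
  have gm [measurable]: "g \<alpha> \<in> borel_measurable borel" for \<alpha> unfolding g_def by measurable
  have pt: "\<bar>v $ i\<bar> < pi / 2" if "norm v < \<epsilon>" for v :: "real^'d" and i
    using component_le_norm_cart[of v i] that eps pi_gt3 by linarith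
  have "energy h s (\<lambda>\<xi>. (if norm \<xi> < \<epsilon> then F \<xi> else 0) - R (unwrap (torus 1 \<xi>)) * \<Phi> \<xi>) \<le>
      (\<integral>\<^sup>+\<xi>. (\<Sum>\<^sub>\<infinity>\<alpha>\<in>?L. g \<alpha> \<xi>) \<partial>lborel)"
    unfolding energy_def
  proof (rule nn_integral_mono_AE)
    show "AE \<xi> in lborel. ennreal ((h + norm \<xi>) powr (2 * s)) *
        ennreal ((cmod ((if norm \<xi> < \<epsilon> then F \<xi> else 0) - R (unwrap (torus 1 \<xi>)) * \<Phi> \<xi>))\<^sup>2) \<le>
        (\<Sum>\<^sub>\<infinity>\<alpha>\<in>?L. g \<alpha> \<xi>)"
      using nz
    proof eventually_elim
      case (elim \<xi>)
      define v where "v = unwrap (torus 1 \<xi>)"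
      show ?case
      proof (cases "norm \<xi> < \<epsilon>")
        case True
        then have "v = \<xi>" using unwrap_torus[of 1 \<xi>] pt[OF True] by (simp add: v_def)
        then have "(if norm \<xi> < \<epsilon> then F \<xi> else 0) - R (unwrap (torus 1 \<xi>)) * \<Phi> \<xi> = 0"
          using True elim by (simp add: v_def[symmetric] R_def)
        then show ?thesis by simp
      next
        case False
        show ?thesis
        proof (cases "norm v < \<epsilon>")
          case v: True
          have "\<xi> - v \<in> dual_lattice"
            using unwrap_torus_periodic[of \<xi>] pt[OF v] by (simp add: v_def dual_lattice_def)
          moreover have "\<xi> - v \<noteq> 0" using False v by auto
          ultimately have "g (\<xi> - v) \<xi> \<le> (\<Sum>\<^sub>\<infinity>\<alpha>\<in>?L. g \<alpha> \<xi>)"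
            by (intro infsum_ge_term_ennreal) simp
          moreover have "g (\<xi> - v) \<xi> = ennreal ((h + norm \<xi>) powr (2 * s)) *
             ennreal ((cmod ((if norm \<xi> < \<epsilon> then F \<xi> else 0) - R (unwrap (torus 1 \<xi>)) * \<Phi> \<xi>))\<^sup>2)"
            using False by (simp add: g_def v_def[symmetric] norm_mult power_mult_distrib ennreal_mult mult_ac)
          ultimately show ?thesis by simp
        next
          case v: False
          then have "R v = 0" by (simp add: R_def)
          then show ?thesis using False by (simp add: v_def[symmetric])
        qed
      qed
    qed
  qed
  also have "\<dots> = (\<Sum>\<^sub>\<infinity>\<alpha>\<in>?L. \<integral>\<^sup>+\<xi>. g \<alpha> \<xi> \<partial>lborel)"
    by (rule nn_integral_infsum[OF countable_dual_lattice_minus]) measurable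
  also have "\<dots> = (\<Sum>\<^sub>\<infinity>\<alpha>\<in>?L. \<integral>\<^sup>+\<xi>. g \<alpha> (\<xi> + \<alpha>) \<partial>lborel)"
    by (intro infsum_cong nn_integral_translate gm)
  also have "\<dots> = (\<integral>\<^sup>+\<xi>. (\<Sum>\<^sub>\<infinity>\<alpha>\<in>?L. g \<alpha> (\<xi> + \<alpha>)) \<partial>lborel)"
    by (rule nn_integral_infsum[OF countable_dual_lattice_minus, symmetric]) measurable
  also have "\<dots> = (\<integral>\<^sup>+\<xi>. ennreal ((cmod (R \<xi>))\<^sup>2) * alias_sum h s \<Phi> \<xi> \<partial>lborel)"
    unfolding alias_sum_def infsum_cmult_ennreal[OF countable_dual_lattice_minus, symmetric]
    by (simp add: g_def)
  finally show ?thesis .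
qed

lemma energy_mono_exponent:
  assumes "s \<le> k"
  shows "energy 1 s u \<le> energy 1 k u"
  unfolding energy_def
  using assms by (intro nn_integral_mono mult_right_mono ennreal_leI powr_mono) auto

lemma sobolev_antimono:
  assumes "s \<le> k" "f \<in> sobolev k"
  shows "f \<in> sobolev s"
  using sobolevD[OF assms(2)] energy_mono_exponent[OF assms(1), of "hat f"]
  by (intro sobolevI) (auto elim: le_less_trans)

text \<open>At high frequencies the weight \<open>(h + |\<xi>|)^(2 s)\<close> is smaller than \<open>(h + |\<xi>|)^(2 k)\<close> by the
  factor \<open>(h + |\<xi>|)^(2 (s - k))\<close>.\<close>

lemma energy_high_le:
  assumes F [measurable]: "F \<in> borel_measurable borel" and "s \<le> k" "0 < \<epsilon>" "0 < h"
  shows "energy h s (\<lambda>\<xi>. if norm \<xi> < \<epsilon> then 0 else F \<xi>) \<le> ennreal (\<epsilon> powr (2 * (s - k))) * energy h k F"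
proof -
  have "energy h s (\<lambda>\<xi>. if norm \<xi> < \<epsilon> then 0 else F \<xi>) \<le>
     (\<integral>\<^sup>+\<xi>. ennreal (\<epsilon> powr (2 * (s - k))) * (ennreal ((h + norm \<xi>) powr (2 * k)) * ennreal ((cmod (F \<xi>))\<^sup>2)) \<partial>lborel)"
    unfolding energy_def
  proof (rule nn_integral_mono)
    fix \<xi> :: "real^'a"
    show "ennreal ((h + norm \<xi>) powr (2 * s)) * ennreal ((cmod (if norm \<xi> < \<epsilon> then 0 else F \<xi>))\<^sup>2) \<le>
       ennreal (\<epsilon> powr (2 * (s - k))) * (ennreal ((h + norm \<xi>) powr (2 * k)) * ennreal ((cmod (F \<xi>))\<^sup>2))"
    proof (cases "norm \<xi> < \<epsilon>")
      case False
      have "(h + norm \<xi>) powr (2 * s) = (h + norm \<xi>) powr (2 * (s - k)) * (h + norm \<xi>) powr (2 * k)"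
        by (simp add: powr_add[symmetric] algebra_simps)
      also have "\<dots> \<le> \<epsilon> powr (2 * (s - k)) * (h + norm \<xi>) powr (2 * k)"
        using False assms by (intro mult_right_mono powr_mono2') auto
      finally have "ennreal ((h + norm \<xi>) powr (2 * s)) \<le> ennreal (\<epsilon> powr (2 * (s - k))) * ennreal ((h + norm \<xi>) powr (2 * k))"
        by (simp add: ennreal_mult[symmetric] ennreal_leI)
      from mult_right_mono[OF this, of "ennreal ((cmod (F \<xi>))\<^sup>2)"] show ?thesis
        using False by (simp add: mult.assoc)
    qed simp
  qed
  also have "\<dots> = ennreal (\<epsilon> powr (2 * (s - k))) * energy h k F"
    unfolding energy_def by (rule nn_integral_cmult) measurable
  finally show ?thesis .
qed

text \<open>The error splits into the high-frequency part of \<open>F\<close>, the error of the periodic multiplier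
  \<open>\<tau>\<close>, and the error of replacing \<open>\<tau>\<close> by a trigonometric polynomial. The last one is arbitrarily
  small by density in \<open>L\<^sub>2\<close> of the measure \<open>(h + |\<xi>|)^(2 s) |hat \<phi>|\<^sup>2 d\<xi>\<close>.\<close>

lemma trig_approximation:
  fixes F \<Phi> :: "real^'d::finite \<Rightarrow> complex"
  assumes F [measurable]: "F \<in> borel_measurable borel" and \<phi>: "\<phi> \<in> sobolev s" and h: "0 < h" "h \<le> 1"
    and eps: "0 < \<epsilon>" "\<epsilon> \<le> 1" and M: "M \<ge> 0" and low: "low_frequency_bound s k h \<epsilon> M \<phi>" and sk: "s \<le> k"
    and fin: "energy h s F < \<infinity>" "energy h k F < \<infinity>" and d: "d > 0"
  shows "\<exists>p\<in>trig 1. energy h s (\<lambda>\<xi>. F \<xi> - p \<xi> * hat \<phi> \<xi>) \<le>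
    ennreal (2 * \<epsilon> powr (2 * (s - k)) + 4 * (weight_const (2 * s) * M * weight_const k)) * energy h k F + ennreal d"
proof -
  let ?\<Phi> = "hat \<phi>"
  have [measurable]: "?\<Phi> \<in> borel_measurable borel" by (rule hat_measurable[OF \<phi>])
  define R where "R = (\<lambda>v. if norm v < \<epsilon> then F v / ?\<Phi> v else 0)"
  have [measurable]: "R \<in> borel_measurable borel" unfolding R_def by measurable
  define \<tau> where "\<tau> \<xi> = R (unwrap (torus 1 \<xi>))" for \<xi>
  have [measurable]: "\<tau> \<in> borel_measurable borel" unfolding \<tau>_def by measurable
  define B where "B \<xi> = (if norm \<xi> < \<epsilon> then F \<xi> else 0)" for \<xi>
  have [measurable]: "B \<in> borel_measurable borel" unfolding B_def by measurable
  define c where "c = weight_const (2 * s) * M * weight_const k"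
  have c: "c \<ge> 0" using M weight_const_pos[of "2 * s"] weight_const_pos[of k] by (simp add: c_def)
  have E2: "energy h s (\<lambda>\<xi>. B \<xi> - \<tau> \<xi> * ?\<Phi> \<xi>) \<le> ennreal c * energy h k F"
  proof -
    have "energy h s (\<lambda>\<xi>. B \<xi> - \<tau> \<xi> * ?\<Phi> \<xi>) \<le> (\<integral>\<^sup>+\<xi>. ennreal ((cmod (R \<xi>))\<^sup>2) * alias_sum h s ?\<Phi> \<xi> \<partial>lborel)"
      unfolding B_def \<tau>_def
    proof (rule periodic_error_le[OF _ _ eps _ R_def])
      show "AE \<xi> in lborel. norm \<xi> < \<epsilon> \<longrightarrow> ?\<Phi> \<xi> \<noteq> 0"
        using low unfolding low_frequency_bound_def by eventually_elim simp
    qed measurable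
    also have "\<dots> \<le> (\<integral>\<^sup>+\<xi>. ennreal c * (ennreal ((h + norm \<xi>) powr (2 * k)) * ennreal ((cmod (F \<xi>))\<^sup>2)) \<partial>lborel)"
    proof (rule nn_integral_mono_AE)
      show "AE \<xi> in lborel. ennreal ((cmod (R \<xi>))\<^sup>2) * alias_sum h s ?\<Phi> \<xi> \<le>
          ennreal c * (ennreal ((h + norm \<xi>) powr (2 * k)) * ennreal ((cmod (F \<xi>))\<^sup>2))"
        using low unfolding low_frequency_bound_def
      proof eventually_elim
        case (elim \<xi>)
        show ?case
        proof (cases "norm \<xi> < \<epsilon>")
          case True
          then have nz: "?\<Phi> \<xi> \<noteq> 0" using elim by simp
          have "alias_sum h s ?\<Phi> \<xi> \<le> ennreal (weight_const (2 * s)) * bracket0 s \<phi> \<xi>"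
            using True eps h by (intro alias_sum_le_bracket0) auto
          also have "\<dots> \<le> ennreal (weight_const (2 * s)) * ennreal (M * (cmod (?\<Phi> \<xi>))\<^sup>2 * ((norm \<xi>)\<^sup>2 + h\<^sup>2) powr k)"
            using elim True by (intro mult_left_mono) auto
          also have "\<dots> \<le> ennreal (weight_const (2 * s)) * ennreal (M * (cmod (?\<Phi> \<xi>))\<^sup>2 * (weight_const k * (h + norm \<xi>) powr (2 * k)))"
            using M h by (intro mult_left_mono ennreal_leI weight_sq_compare) auto
          also have "\<dots> = ennreal (c * (h + norm \<xi>) powr (2 * k) * (cmod (?\<Phi> \<xi>))\<^sup>2)"
            using weight_const_pos[of "2 * s"] weight_const_pos[of k] M
            by (simp add: c_def ennreal_mult[symmetric] mult_ac)
          finally have "ennreal ((cmod (R \<xi>))\<^sup>2) * alias_sum h s ?\<Phi> \<xi> \<le>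
             ennreal ((cmod (R \<xi>))\<^sup>2) * ennreal (c * (h + norm \<xi>) powr (2 * k) * (cmod (?\<Phi> \<xi>))\<^sup>2)"
            by (rule mult_left_mono) simp
          also have "\<dots> = ennreal (c * ((h + norm \<xi>) powr (2 * k) * (cmod (F \<xi>))\<^sup>2))"
            using True nz c by (simp add: R_def ennreal_mult[symmetric] norm_divide power_divide)
          also have "\<dots> = ennreal c * (ennreal ((h + norm \<xi>) powr (2 * k)) * ennreal ((cmod (F \<xi>))\<^sup>2))"
            using c by (simp add: ennreal_mult)
          finally show ?thesis .
        next
          case False
          then show ?thesis by (simp add: R_def)
        qed
      qed
    qed
    also have "\<dots> = ennreal c * energy h k F"
      unfolding energy_def by (rule nn_integral_cmult) measurable
    finally show ?thesis .
  qed
  define N where "N = density lborel (\<lambda>\<xi>. ennreal ((h + norm \<xi>) powr (2 * s)) * ennreal ((cmod (?\<Phi> \<xi>))\<^sup>2))"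
  have sN: "sets N = sets borel" by (simp add: N_def)
  have N_eq: "(\<integral>\<^sup>+\<xi>. ennreal ((cmod (u \<xi>))\<^sup>2) \<partial>N) = energy h s (\<lambda>\<xi>. u \<xi> * ?\<Phi> \<xi>)"
    if [measurable]: "u \<in> borel_measurable borel" for u
    unfolding N_def energy_def
    by (subst nn_integral_density) (auto simp: norm_mult power_mult_distrib ennreal_mult mult_ac)
  have fN: "finite_measure N"
  proof
    have "emeasure N (space N) = energy h s ?\<Phi>"
      by (simp add: N_def energy_def emeasure_density)
    also have "\<dots> \<le> ennreal (min h 1 powr (2 * s) + max h 1 powr (2 * s)) * energy 1 s ?\<Phi>"
      by (rule energy_weight_le) (use h in auto)
    also have "\<dots> < \<infinity>" using sobolevD(3)[OF \<phi>] by (simp add: ennreal_mult_less_top del: ennreal_plus)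
    finally show "emeasure N (space N) \<noteq> \<infinity>" by simp
  qed
  have "\<exists>p\<in>trig 1. (\<integral>\<^sup>+\<xi>. ennreal ((cmod (R (unwrap (torus 1 \<xi>)) - p \<xi>))\<^sup>2) \<partial>N) < ennreal (d / 4)"
  proof (rule trig_L2_dense[OF fN sN, where u = "\<lambda>z. R (unwrap z)"])
    have "energy h s B \<le> energy h s F"
      unfolding energy_def B_def by (intro nn_integral_mono) (auto simp: mult_left_mono)
    then have eB: "energy h s B < \<infinity>" using fin(1) by (rule le_less_trans)
    have e2: "energy h s (\<lambda>\<xi>. B \<xi> - \<tau> \<xi> * ?\<Phi> \<xi>) < \<infinity>"
      using E2 fin(2) by (elim le_less_trans) (simp add: ennreal_mult_less_top)
    have "energy h s (\<lambda>\<xi>. 1 * B \<xi> + (- 1) * (B \<xi> - \<tau> \<xi> * ?\<Phi> \<xi>)) < \<infinity>"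
      by (rule energy_finite_lin[OF _ _ eB e2]) measurable
    then show "(\<integral>\<^sup>+\<xi>. ennreal ((cmod (R (unwrap (torus 1 \<xi>))))\<^sup>2) \<partial>N) < \<infinity>"
      using N_eq[of \<tau>] by (simp add: \<tau>_def)
  qed (use d in \<open>auto, measurable\<close>)
  then obtain p where p: "p \<in> trig 1" "(\<integral>\<^sup>+\<xi>. ennreal ((cmod (\<tau> \<xi> - p \<xi>))\<^sup>2) \<partial>N) < ennreal (d / 4)"
    unfolding \<tau>_def by blast
  have [measurable]: "p \<in> borel_measurable borel" by (rule trig_measurable[OF p(1)])
  have E3: "energy h s (\<lambda>\<xi>. (\<tau> \<xi> - p \<xi>) * ?\<Phi> \<xi>) \<le> ennreal (d / 4)"
    using p(2) N_eq[of "\<lambda>\<xi>. \<tau> \<xi> - p \<xi>"] by simp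
  have E1: "energy h s (\<lambda>\<xi>. if norm \<xi> < \<epsilon> then 0 else F \<xi>) \<le> ennreal (\<epsilon> powr (2 * (s - k))) * energy h k F"
    by (rule energy_high_le[OF F sk eps(1) h(1)])
  have split: "F \<xi> - p \<xi> * ?\<Phi> \<xi> = (if norm \<xi> < \<epsilon> then 0 else F \<xi>) +
      ((B \<xi> - \<tau> \<xi> * ?\<Phi> \<xi>) + (\<tau> \<xi> - p \<xi>) * ?\<Phi> \<xi>)" for \<xi>
    by (simp add: B_def algebra_simps)
  have "energy h s (\<lambda>\<xi>. F \<xi> - p \<xi> * ?\<Phi> \<xi>) \<le>
      2 * energy h s (\<lambda>\<xi>. if norm \<xi> < \<epsilon> then 0 else F \<xi>) +
      2 * energy h s (\<lambda>\<xi>. (B \<xi> - \<tau> \<xi> * ?\<Phi> \<xi>) + (\<tau> \<xi> - p \<xi>) * ?\<Phi> \<xi>)"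
    unfolding split by (rule energy_add_le) measurable
  also have "\<dots> \<le> 2 * energy h s (\<lambda>\<xi>. if norm \<xi> < \<epsilon> then 0 else F \<xi>) +
      2 * (2 * energy h s (\<lambda>\<xi>. B \<xi> - \<tau> \<xi> * ?\<Phi> \<xi>) + 2 * energy h s (\<lambda>\<xi>. (\<tau> \<xi> - p \<xi>) * ?\<Phi> \<xi>))"
    by (intro add_left_mono mult_left_mono energy_add_le) auto
  also have "\<dots> \<le> 2 * (ennreal (\<epsilon> powr (2 * (s - k))) * energy h k F) +
      2 * (2 * (ennreal c * energy h k F) + 2 * ennreal (d / 4))"
    by (intro add_mono mult_left_mono E1 E2 E3) auto
  also have "\<dots> = ennreal (2 * \<epsilon> powr (2 * (s - k)) + 4 * c) * energy h k F + ennreal d"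
  proof -
    obtain e where e: "e \<ge> 0" "energy h k F = ennreal e" using fin(2) by (cases "energy h k F") auto
    have two: "2 * ennreal x = ennreal (2 * x)" if "x \<ge> 0" for x
      using that by (simp add: ennreal_mult)
    show ?thesis
      using e c d by (simp add: two ennreal_mult[symmetric] ennreal_plus[symmetric] algebra_simps del: ennreal_plus)
  qed
  finally show ?thesis using p(1) unfolding c_def by blast
qed

text \<open>For large \<open>h\<close> the zero function is a good enough approximation. For small \<open>h\<close> the dilated
  Fourier transform \<open>F\<close> of the target is approximated by \<open>p hat \<phi>\<close>; the powers of \<open>h\<close> from the
  dilation of the two norms combine to \<open>h^(2 (k - s))\<close>.\<close>

lemma order_of_low_frequency_bound:
  fixes \<phi> :: "real \<Rightarrow> 'd::finite dist"
  assumes sk: "s < k" and \<phi>: "\<And>h. h > 0 \<Longrightarrow> \<phi> h \<in> sobolev s"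
    and eps: "\<epsilon> > 0" and h0: "h\<^sub>0 > 0"
    and low: "\<And>h. 0 < h \<Longrightarrow> h < h\<^sub>0 \<Longrightarrow> low_frequency_bound s k h \<epsilon> M (\<phi> h)"
  shows "provides_approx_order s k (\<lambda>h. dilate h ` psi_space s (\<phi> h))"
proof -
  define e where "e = min \<epsilon> 1"
  define H where "H = min h\<^sub>0 1"
  define m where "m = max M 0"
  have e: "0 < e" "e \<le> 1" and H: "0 < H" "H \<le> 1" and m: "m \<ge> 0"
    using eps h0 by (auto simp: e_def H_def m_def)
  have low': "low_frequency_bound s k h e m (\<phi> h)" if "0 < h" "h < H" for h
  proof -
    have "low_frequency_bound s k h \<epsilon> M (\<phi> h)" using that low by (simp add: H_def)
    then show ?thesis
      unfolding low_frequency_bound_def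
    proof eventually_elim
      case (elim \<xi>)
      have "M * (cmod (hat (\<phi> h) \<xi>))\<^sup>2 * ((norm \<xi>)\<^sup>2 + h\<^sup>2) powr k \<le>
          m * (cmod (hat (\<phi> h) \<xi>))\<^sup>2 * ((norm \<xi>)\<^sup>2 + h\<^sup>2) powr k"
        by (intro mult_right_mono) (auto simp: m_def)
      then show ?case using elim by (auto simp: e_def intro: order_trans ennreal_leI)
    qed
  qed
  define K where "K = 2 * e powr (2 * (s - k)) + 4 * (weight_const (2 * s) * m * weight_const k)"
  have K: "K \<ge> 0"
    using m weight_const_pos[of "2 * s"] weight_const_pos[of k] by (simp add: K_def)
  let ?S = "\<lambda>h. dilate h ` psi_space s (\<phi> h)"
  have bdd: "bdd_below (sobolev_dist s f ` ?S h)" for f h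
    by (rule bdd_belowI2[where m = 0]) (rule sobolev_dist_nonneg)
  have zero: "(\<lambda>_. 0) \<in> ?S h" if "h > 0" for h
    using dilate_closed_subspace[OF psi_space_props(1)[OF \<phi>[OF that]] that] by (simp add: closed_subspace_def)
  have bound: "(INF g\<in>?S h. sobolev_dist s f g) \<le> (sqrt K + H powr (s - k)) * h powr (k - s) * sobolev_norm k f"
    if f: "f \<in> sobolev k" and h: "h > 0" for f h
  proof (cases "h < H")
    case True
    have fs: "f \<in> sobolev s" by (rule sobolev_antimono[OF _ f]) (use sk in simp)
    define u where "u = hat f"
    have u: "has_hat f u" unfolding u_def by (rule sobolevD(2)[OF f])
    have [measurable]: "u \<in> borel_measurable borel" by (rule has_hat_measurable[OF u])
    have [measurable]: "hat (\<phi> h) \<in> borel_measurable borel" by (rule hat_measurable[OF \<phi>[OF h]])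
    define F where "F \<xi> = u ((1 / h) *\<^sub>R \<xi>) / complex_of_real h ^ CARD('d)" for \<xi>
    have F [measurable]: "F \<in> borel_measurable borel" unfolding F_def by measurable
    have uF: "u \<omega> = complex_of_real h ^ CARD('d) * F (h *\<^sub>R \<omega>)" for \<omega>
      using h by (simp add: F_def)
    have norm_t: "ennreal ((sobolev_norm t f)\<^sup>2) = ennreal (h powr (real CARD('d) - 2 * t)) * energy h t F"
      if "f \<in> sobolev t" for t
      unfolding sobolev_norm_sq[OF that u] uF by (rule energy_scaled[OF F h])
    have cancel: "ennreal (h powr (2 * t - real CARD('d))) * (ennreal (h powr (real CARD('d) - 2 * t)) * x) = x" for t x
      using h by (simp add: mult.assoc[symmetric] ennreal_mult[symmetric] powr_add[symmetric])
    have eF: "energy h t F = ennreal (h powr (2 * t - real CARD('d)) * (sobolev_norm t f)\<^sup>2)"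
      if "f \<in> sobolev t" for t
      using cancel[of t "energy h t F"] norm_t[OF that] by (simp add: ennreal_mult)
    define X where "X = h powr (k - s) * sobolev_norm k f"
    have X: "X \<ge> 0" using sobolev_norm_nonneg[of k f] by (simp add: X_def)
    define I where "I = (INF g\<in>?S h. sobolev_dist s f g)"
    have I0: "I \<ge> 0"
      unfolding I_def using zero[OF h] by (intro cINF_greatest sobolev_dist_nonneg) blast
    have "I\<^sup>2 \<le> K * X\<^sup>2 + d" if d: "d > 0" for d
    proof -
      have d': "d * h powr (2 * s - real CARD('d)) > 0" using d h by simp
      obtain p where p: "p \<in> trig 1" "energy h s (\<lambda>\<xi>. F \<xi> - p \<xi> * hat (\<phi> h) \<xi>) \<le>
          ennreal K * energy h k F + ennreal (d * h powr (2 * s - real CARD('d)))"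
        using trig_approximation[OF F \<phi>[OF h] h _ e m low'[OF h True] _ _ _ d'] True H sk eF[OF fs] eF[OF f]
        unfolding K_def by auto
      have [measurable]: "p \<in> borel_measurable borel" by (rule trig_measurable[OF p(1)])
      note psi = psi_space_props[OF \<phi>[OF h]]
      obtain g where g: "g \<in> psi_space s (\<phi> h)" "has_hat g (\<lambda>\<omega>. p \<omega> * hat (\<phi> h) \<omega>)"
        using trig_mult_closed[OF psi(1,2) p(1) psi(3) sobolevD(2)[OF \<phi>[OF h]]] by blast
      have gs: "g \<in> sobolev s" by (rule psi_space_sobolev[OF \<phi>[OF h] g(1)])
      have "I \<le> sobolev_dist s f (dilate h g)"
        unfolding I_def using g(1) by (intro cINF_lower bdd) blast
      then have "ennreal (I\<^sup>2) \<le> ennreal ((sobolev_dist s f (dilate h g))\<^sup>2)"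
        using I0 by (intro ennreal_leI power_mono)
      also have "\<dots> = energy 1 s (\<lambda>\<omega>. u \<omega> - complex_of_real h ^ CARD('d) * (p (h *\<^sub>R \<omega>) * hat (\<phi> h) (h *\<^sub>R \<omega>)))"
        by (rule sobolev_dist_sq[OF fs sobolev_dilate[OF gs h] u has_hat_dilate[OF sobolevD(1)[OF gs] g(2) h]])
      also have "\<dots> = energy 1 s (\<lambda>\<omega>. complex_of_real h ^ CARD('d) * (\<lambda>\<xi>. F \<xi> - p \<xi> * hat (\<phi> h) \<xi>) (h *\<^sub>R \<omega>))"
        unfolding uF right_diff_distrib ..
      also have "\<dots> = ennreal (h powr (real CARD('d) - 2 * s)) * energy h s (\<lambda>\<xi>. F \<xi> - p \<xi> * hat (\<phi> h) \<xi>)"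
        by (rule energy_scaled[OF _ h]) measurable
      also have "\<dots> \<le> ennreal (h powr (real CARD('d) - 2 * s)) *
          (ennreal K * energy h k F + ennreal (d * h powr (2 * s - real CARD('d))))"
        by (intro mult_left_mono p) simp
      also have "\<dots> = ennreal (h powr (real CARD('d) - 2 * s) *
          (K * (h powr (2 * k - real CARD('d)) * (sobolev_norm k f)\<^sup>2) + d * h powr (2 * s - real CARD('d))))"
        using K d unfolding eF[OF f] by (simp add: ennreal_mult[symmetric] ennreal_plus[symmetric] del: ennreal_plus)
      also have "h powr (real CARD('d) - 2 * s) *
          (K * (h powr (2 * k - real CARD('d)) * (sobolev_norm k f)\<^sup>2) + d * h powr (2 * s - real CARD('d))) = K * X\<^sup>2 + d"
      proof -
        have "h powr (real CARD('d) - 2 * s) * h powr (2 * s - real CARD('d)) = 1"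
          using h by (simp add: powr_add[symmetric])
        moreover have "h powr (real CARD('d) - 2 * s) * h powr (2 * k - real CARD('d)) = (h powr (k - s))\<^sup>2"
          using h by (simp add: powr_add[symmetric] power2_eq_square algebra_simps)
        ultimately show ?thesis unfolding X_def power_mult_distrib by algebra
      qed
      finally show ?thesis using K d by (subst (asm) ennreal_le_iff) auto
    qed
    then have "I\<^sup>2 \<le> K * X\<^sup>2" by (rule field_le_epsilon)
    also have "\<dots> = (sqrt K * X)\<^sup>2" using K by (simp add: power_mult_distrib)
    finally have "I \<le> sqrt K * X" by (rule power2_le_imp_le) (use K X in simp)
    also have "\<dots> \<le> (sqrt K + H powr (s - k)) * X" using X by (intro mult_right_mono) auto
    finally show ?thesis by (simp add: I_def X_def mult.assoc)
  next
    case False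
    have fs: "f \<in> sobolev s" by (rule sobolev_antimono[OF _ f]) (use sk in simp)
    have "(INF g\<in>?S h. sobolev_dist s f g) \<le> sobolev_dist s f (\<lambda>_. 0)"
      by (intro cINF_lower bdd zero h)
    also have "\<dots> = sobolev_norm s f" by (simp add: sobolev_dist_def)
    also have "\<dots> \<le> sobolev_norm k f"
    proof -
      have "ennreal ((sobolev_norm s f)\<^sup>2) \<le> ennreal ((sobolev_norm k f)\<^sup>2)"
        unfolding sobolev_norm_sq[OF fs sobolevD(2)[OF f]] sobolev_norm_sq[OF f sobolevD(2)[OF f]]
        using sk by (intro energy_mono_exponent) simp
      then have "(sobolev_norm s f)\<^sup>2 \<le> (sobolev_norm k f)\<^sup>2" by (simp add: ennreal_le_iff)
      then show ?thesis by (rule power2_le_imp_le) (rule sobolev_norm_nonneg)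
    qed
    also have "\<dots> = 1 * sobolev_norm k f" by simp
    also have "\<dots> \<le> ((sqrt K + H powr (s - k)) * h powr (k - s)) * sobolev_norm k f"
    proof (intro mult_right_mono sobolev_norm_nonneg)
      have "1 = H powr (s - k) * H powr (k - s)" using H by (simp add: powr_add[symmetric])
      also have "\<dots> \<le> (sqrt K + H powr (s - k)) * h powr (k - s)"
        using False H K sk by (intro mult_mono powr_mono2) auto
      finally show "1 \<le> (sqrt K + H powr (s - k)) * h powr (k - s)" .
    qed
    finally show ?thesis .
  qed
  show ?thesis
    unfolding provides_approx_order_def
  proof (intro conjI exI ballI allI impI)
    show "ladder s ?S" by (rule ladder_psi) (rule \<phi>)
  qed (rule bound)
qed

subsection \<open>Necessity\<close>

text \<open>The error on a single fibre, if the target has the entry \<open>1\<close> at the lattice point \<open>0\<close> and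
  \<open>c\<close> times the fibre of \<open>hat \<phi>\<close> is used: either \<open>c \<Phi>\<close> is far from \<open>1\<close>, or \<open>c\<close> is so large
  that the other entries of the fibre, of total weight \<open>b\<close>, cause the error.\<close>

lemma fibre_error_lower_bound:
  fixes \<Phi> c :: complex
  assumes m: "m > 0" and q: "q \<ge> 0" and w: "4 * m * q \<le> w"
    and bad: "\<not> (\<Phi> \<noteq> 0 \<and> b \<le> ennreal (4 * m * q * (cmod \<Phi>)\<^sup>2))"
  shows "ennreal (m * q) \<le> ennreal w * ennreal ((cmod (1 - c * \<Phi>))\<^sup>2) + ennreal ((cmod c)\<^sup>2) * b"
proof (cases "cmod (1 - c * \<Phi>) \<ge> 1 / 2")
  case True
  have "0 \<le> 4 * m * q" using m q by simp
  then have w0: "w \<ge> 0" using w by linarith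
  have "m * q \<le> w * (1 / 2)\<^sup>2" using w by (simp add: power2_eq_square)
  also have "\<dots> \<le> w * (cmod (1 - c * \<Phi>))\<^sup>2"
    using True w0 by (intro mult_left_mono power_mono) auto
  finally have "ennreal (m * q) \<le> ennreal w * ennreal ((cmod (1 - c * \<Phi>))\<^sup>2)"
    using w0 by (simp add: ennreal_mult[symmetric] ennreal_leI)
  then show ?thesis by (simp add: add_increasing2)
next
  case False
  have "1 \<le> cmod (1 - c * \<Phi>) + cmod (c * \<Phi>)"
    using norm_triangle_ineq[of "1 - c * \<Phi>" "c * \<Phi>"] by simp
  then have half: "1 / 2 \<le> cmod (c * \<Phi>)" using False by linarith
  then have "\<Phi> \<noteq> 0" by auto
  then have b: "ennreal (4 * m * q * (cmod \<Phi>)\<^sup>2) \<le> b" using bad by auto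
  have "(1 / 2)\<^sup>2 \<le> (cmod (c * \<Phi>))\<^sup>2" using half by (intro power_mono) auto
  then have "(4 * m * q) * (1 / 4) \<le> (4 * m * q) * (cmod (c * \<Phi>))\<^sup>2"
    using m q by (intro mult_left_mono) (auto simp: power2_eq_square)
  also have "\<dots> = (cmod c)\<^sup>2 * (4 * m * q * (cmod \<Phi>)\<^sup>2)"
    by (simp add: norm_mult power_mult_distrib)
  finally have "ennreal (m * q) \<le> ennreal ((cmod c)\<^sup>2) * ennreal (4 * m * q * (cmod \<Phi>)\<^sup>2)"
    using m q by (simp add: ennreal_mult[symmetric] ennreal_leI)
  also have "\<dots> \<le> ennreal ((cmod c)\<^sup>2) * b" by (intro mult_left_mono b) simp
  finally show ?thesis by (simp add: add_increasing)
qed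

text \<open>The translates of \<open>A\<close> along the dual lattice are disjoint, so the energy is at least the
  integral over \<open>A\<close> of the fibrewise errors.\<close>

lemma energy_psi_lower_bound:
  fixes A :: "(real^'d::finite) set"
  assumes A [measurable]: "A \<in> sets borel" and small: "\<And>\<xi>. \<xi> \<in> A \<Longrightarrow> norm \<xi> < 1"
    and [measurable]: "\<Phi> \<in> borel_measurable borel" "G \<in> borel_measurable borel"
    and fibre: "AE \<xi> in lborel. \<exists>c. \<forall>\<alpha>\<in>dual_lattice. G (\<xi> + \<alpha>) = c * \<Phi> (\<xi> + \<alpha>)"
    and m: "m \<ge> 0"
    and lower: "\<And>\<xi> c. \<xi> \<in> A \<Longrightarrow> ennreal (m * (h + norm \<xi>) powr (2 * k)) \<le>
      ennreal ((h + norm \<xi>) powr (2 * s)) * ennreal ((cmod (1 - c * \<Phi> \<xi>))\<^sup>2) + ennreal ((cmod c)\<^sup>2) * alias_sum h s \<Phi> \<xi>"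
  shows "ennreal m * energy h k (indicator A) \<le> energy h s (\<lambda>\<xi>. indicator A \<xi> - G \<xi>)"
proof -
  let ?L = "dual_lattice :: (real^'d) set"
  define T where "T \<xi> = ennreal ((h + norm \<xi>) powr (2 * s)) * ennreal ((cmod (indicator A \<xi> - G \<xi>))\<^sup>2)" for \<xi>
  have [measurable]: "T \<in> borel_measurable borel" unfolding T_def by measurable
  have "ennreal m * energy h k (indicator A) =
      (\<integral>\<^sup>+\<xi>. ennreal m * (ennreal ((h + norm \<xi>) powr (2 * k)) * ennreal ((cmod (indicator A \<xi>))\<^sup>2)) \<partial>lborel)"
    unfolding energy_def by (rule nn_integral_cmult[symmetric]) measurable
  also have "\<dots> = (\<integral>\<^sup>+\<xi>. indicator A \<xi> * ennreal (m * (h + norm \<xi>) powr (2 * k)) \<partial>lborel)"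
    using m by (intro nn_integral_cong) (auto simp: indicator_def ennreal_mult)
  also have "\<dots> \<le> (\<integral>\<^sup>+\<xi>. (\<Sum>\<^sub>\<infinity>\<alpha>\<in>?L. indicator A \<xi> * T (\<xi> + \<alpha>)) \<partial>lborel)"
  proof (rule nn_integral_mono_AE)
    show "AE \<xi> in lborel. indicator A \<xi> * ennreal (m * (h + norm \<xi>) powr (2 * k)) \<le>
        (\<Sum>\<^sub>\<infinity>\<alpha>\<in>?L. indicator A \<xi> * T (\<xi> + \<alpha>))"
      using fibre
    proof eventually_elim
      case (elim \<xi>)
      then obtain c where c: "\<And>\<alpha>. \<alpha> \<in> ?L \<Longrightarrow> G (\<xi> + \<alpha>) = c * \<Phi> (\<xi> + \<alpha>)" by blast
      show ?case
      proof (cases "\<xi> \<in> A")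
        case True
        have out: "\<xi> + \<alpha> \<notin> A" if "\<alpha> \<in> ?L - {0}" for \<alpha>
        proof
          assume "\<xi> + \<alpha> \<in> A"
          then have "norm (\<xi> + \<alpha>) < 1" "norm \<xi> < 1" using small True by auto
          moreover have "6 \<le> norm \<alpha>" using norm_dual_lattice that by blast
          moreover have "norm \<alpha> \<le> norm (\<xi> + \<alpha>) + norm \<xi>"
            using norm_triangle_ineq4[of "\<xi> + \<alpha>" \<xi>] by simp
          ultimately show False by linarith
        qed
        have "ennreal (m * (h + norm \<xi>) powr (2 * k)) \<le>
            ennreal ((h + norm \<xi>) powr (2 * s)) * ennreal ((cmod (1 - c * \<Phi> \<xi>))\<^sup>2) + ennreal ((cmod c)\<^sup>2) * alias_sum h s \<Phi> \<xi>"
          by (rule lower[OF True])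
        also have "ennreal ((h + norm \<xi>) powr (2 * s)) * ennreal ((cmod (1 - c * \<Phi> \<xi>))\<^sup>2) = T (\<xi> + 0)"
          using c[of 0] True by (simp add: T_def)
        also have "ennreal ((cmod c)\<^sup>2) * alias_sum h s \<Phi> \<xi> = (\<Sum>\<^sub>\<infinity>\<alpha>\<in>?L - {0}. T (\<xi> + \<alpha>))"
          unfolding alias_sum_def infsum_cmult_ennreal[OF countable_dual_lattice_minus, symmetric]
          using out c by (intro infsum_cong) (simp add: T_def norm_mult power_mult_distrib ennreal_mult mult_ac)
        also have "T (\<xi> + 0) + (\<Sum>\<^sub>\<infinity>\<alpha>\<in>?L - {0}. T (\<xi> + \<alpha>)) = (\<Sum>\<^sub>\<infinity>\<alpha>\<in>insert 0 (?L - {0}). T (\<xi> + \<alpha>))"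
          by (rule infsum_insert[symmetric]) (auto intro: nonneg_summable_on_complete)
        also have "insert 0 (?L - {0}) = ?L" by auto
        finally show ?thesis using True by simp
      qed simp
    qed
  qed
  also have "\<dots> = (\<Sum>\<^sub>\<infinity>\<alpha>\<in>?L. \<integral>\<^sup>+\<xi>. indicator A \<xi> * T (\<xi> + \<alpha>) \<partial>lborel)"
    by (rule nn_integral_infsum[OF countable_dual_lattice]) measurable
  also have "\<dots> = (\<Sum>\<^sub>\<infinity>\<alpha>\<in>?L. \<integral>\<^sup>+\<xi>. indicator A (\<xi> - \<alpha>) * T \<xi> \<partial>lborel)"
  proof (rule infsum_cong)
    fix \<alpha>
    have "(\<integral>\<^sup>+\<xi>. indicator A (\<xi> - \<alpha>) * T \<xi> \<partial>lborel) = (\<integral>\<^sup>+\<xi>. indicator A (\<xi> + \<alpha> - \<alpha>) * T (\<xi> + \<alpha>) \<partial>lborel)"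
      by (rule nn_integral_translate) measurable
    then show "(\<integral>\<^sup>+\<xi>. indicator A \<xi> * T (\<xi> + \<alpha>) \<partial>lborel) = (\<integral>\<^sup>+\<xi>. indicator A (\<xi> - \<alpha>) * T \<xi> \<partial>lborel)"
      by simp
  qed
  also have "\<dots> = (\<integral>\<^sup>+\<xi>. (\<Sum>\<^sub>\<infinity>\<alpha>\<in>?L. indicator A (\<xi> - \<alpha>) * T \<xi>) \<partial>lborel)"
    by (rule nn_integral_infsum[OF countable_dual_lattice, symmetric]) measurable
  also have "\<dots> \<le> (\<integral>\<^sup>+\<xi>. T \<xi> \<partial>lborel)"
  proof (rule nn_integral_mono)
    fix \<xi>
    show "(\<Sum>\<^sub>\<infinity>\<alpha>\<in>?L. indicator A (\<xi> - \<alpha>) * T \<xi>) \<le> T \<xi>"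
    proof (cases "\<exists>\<beta>\<in>?L. \<xi> - \<beta> \<in> A")
      case True
      then obtain \<beta> where \<beta>: "\<beta> \<in> ?L" "\<xi> - \<beta> \<in> A" by blast
      have "\<xi> - \<alpha> \<notin> A" if "\<alpha> \<in> ?L" "\<alpha> \<noteq> \<beta>" for \<alpha>
      proof
        assume "\<xi> - \<alpha> \<in> A"
        then have "norm (\<xi> - \<alpha>) < 1" "norm (\<xi> - \<beta>) < 1" using small \<beta> by auto
        moreover have "6 \<le> norm (\<alpha> - \<beta>)" using norm_dual_lattice[OF dual_lattice_diff[OF that(1) \<beta>(1)]] that by simp
        moreover have "norm (\<alpha> - \<beta>) \<le> norm (\<xi> - \<beta>) + norm (\<xi> - \<alpha>)"
          using norm_triangle_ineq4[of "\<xi> - \<beta>" "\<xi> - \<alpha>"] by simp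
        ultimately show False by linarith
      qed
      then have "(\<Sum>\<^sub>\<infinity>\<alpha>\<in>?L. indicator A (\<xi> - \<alpha>) * T \<xi>) = (\<Sum>\<^sub>\<infinity>\<alpha>\<in>{\<beta>}. T \<xi>)"
        using \<beta> by (intro infsum_cong_neutral) (auto simp: indicator_def)
      then show ?thesis by simp
    next
      case False
      then have "(\<Sum>\<^sub>\<infinity>\<alpha>\<in>?L. indicator A (\<xi> - \<alpha>) * T \<xi>) = (\<Sum>\<^sub>\<infinity>\<alpha>\<in>?L. 0)"
        by (intro infsum_cong) (auto simp: indicator_def)
      then show ?thesis by simp
    qed
  qed
  finally show ?thesis by (simp add: T_def energy_def)
qed

text \<open>The bound is shown with \<open>alias_sum\<close> and the constant \<open>4 m\<close>, where \<open>m\<close> exceeds the square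
  of the constant of the approximation order. The set \<open>A\<close> where it fails depends on \<open>h\<close>, and so
  does the test function \<open>f\<close>, whose Fourier transform is a multiple of the dilated indicator of \<open>A\<close>.
  The square of its distance to the space is at least \<open>m\<close> times the energy of order \<open>k\<close> of the indicator, up to the same
  power of \<open>h\<close> with which the approximation order bounds it by \<open>C\<^sup>2\<close> times this energy. So the
  energy is zero. The radius \<open>\<epsilon>\<close> is chosen such that \<open>4 m (h + |\<xi>|)^(2 (k - s)) \<le> 1\<close>, which is what
  \<open>fibre_error_lower_bound\<close> needs.\<close>

lemma low_frequency_bound_of_order:
  fixes \<phi> :: "real \<Rightarrow> 'd::finite dist"
  assumes sk: "s < k" and \<phi>: "\<And>h. h > 0 \<Longrightarrow> \<phi> h \<in> sobolev s"
    and order: "provides_approx_order s k (\<lambda>h. dilate h ` psi_space s (\<phi> h))"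
  shows "\<exists>\<epsilon>>0. \<exists>M\<ge>0. \<forall>h. 0 < h \<and> h < \<epsilon> \<longrightarrow> low_frequency_bound s k h \<epsilon> M (\<phi> h)"
proof -
  let ?S = "\<lambda>h. dilate h ` psi_space s (\<phi> h)"
  obtain C where C: "\<And>f h. f \<in> sobolev k \<Longrightarrow> h > 0 \<Longrightarrow>
      (INF g\<in>?S h. sobolev_dist s f g) \<le> C * h powr (k - s) * sobolev_norm k f"
    using order unfolding provides_approx_order_def by blast
  define m where "m = C\<^sup>2 + 1"
  have m: "m > 0" by (simp add: m_def add_nonneg_pos)
  define \<epsilon> where "\<epsilon> = min (1 / 2) ((1 / (4 * m)) powr (1 / (2 * (k - s))) / 2)"
  have eps: "0 < \<epsilon>" "\<epsilon> \<le> 1 / 2" using m by (auto simp: \<epsilon>_def)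
  define M where "M = weight_const (2 * s) * (4 * m * weight_const k)"
  have M: "M \<ge> 0" using m weight_const_pos[of "2 * s"] weight_const_pos[of k] by (simp add: M_def)
  have "low_frequency_bound s k h \<epsilon> M (\<phi> h)" if h: "0 < h" "h < \<epsilon>" for h
  proof -
    let ?\<Phi> = "hat (\<phi> h)"
    have [measurable]: "?\<Phi> \<in> borel_measurable borel" by (rule hat_measurable[OF \<phi>[OF h(1)]])
    define q where "q \<xi> = (h + norm \<xi>) powr (2 * k)" for \<xi> :: "real^'d"
    have weights: "4 * m * q \<xi> \<le> (h + norm \<xi>) powr (2 * s)" if "norm \<xi> < \<epsilon>" for \<xi>
    proof -
      have "h + norm \<xi> \<le> (1 / (4 * m)) powr (1 / (2 * (k - s)))"
        using that h by (simp add: \<epsilon>_def min_def split: if_splits)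
      then have "(h + norm \<xi>) powr (2 * (k - s)) \<le> ((1 / (4 * m)) powr (1 / (2 * (k - s)))) powr (2 * (k - s))"
        using sk h by (intro powr_mono2) auto
      also have "\<dots> = 1 / (4 * m)" using sk m by (simp add: powr_powr)
      finally have "4 * m * (h + norm \<xi>) powr (2 * (k - s)) \<le> 1" using m by (simp add: field_simps)
      then have "4 * m * (h + norm \<xi>) powr (2 * (k - s)) * (h + norm \<xi>) powr (2 * s) \<le> 1 * (h + norm \<xi>) powr (2 * s)"
        by (rule mult_right_mono) simp
      moreover have "q \<xi> = (h + norm \<xi>) powr (2 * (k - s)) * (h + norm \<xi>) powr (2 * s)"
        unfolding q_def powr_add[symmetric] by (simp add: algebra_simps)
      ultimately show ?thesis by simp
    qed
    define A where "A = {\<xi>. norm \<xi> < \<epsilon> \<and> \<not> (?\<Phi> \<xi> \<noteq> 0 \<and> alias_sum h s ?\<Phi> \<xi> \<le> ennreal (4 * m * q \<xi> * (cmod (?\<Phi> \<xi>))\<^sup>2))}"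
    have [measurable]: "q \<in> borel_measurable borel" unfolding q_def by measurable
    have A [measurable]: "A \<in> sets borel" unfolding A_def by measurable
    have A_small: "norm \<xi> < \<epsilon>" "norm \<xi> < 1" if "\<xi> \<in> A" for \<xi> using that eps by (auto simp: A_def)
    have A_fin: "emeasure lborel A < \<infinity>"
    proof -
      have "emeasure lborel A \<le> emeasure lborel (cball (0 :: real^'d) 1)"
        using less_imp_le[OF A_small(2)] by (intro emeasure_mono) auto
      also have "\<dots> < \<infinity>" by (rule emeasure_compact_finite) simp
      finally show ?thesis .
    qed
    define \<kappa> where "\<kappa> = (indicator A :: real^'d \<Rightarrow> complex)"
    have \<kappa> [measurable]: "\<kappa> \<in> borel_measurable borel" unfolding \<kappa>_def by measurable
    have e_fin: "energy h t \<kappa> < \<infinity>" for t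
    proof -
      have "energy h t \<kappa> \<le> (\<integral>\<^sup>+\<xi>. ennreal (h powr (2 * t) + 1) * indicator A \<xi> \<partial>lborel)"
        unfolding energy_def
      proof (rule nn_integral_mono)
        fix \<xi>
        show "ennreal ((h + norm \<xi>) powr (2 * t)) * ennreal ((cmod (\<kappa> \<xi>))\<^sup>2) \<le>
            ennreal (h powr (2 * t) + 1) * indicator A \<xi>"
        proof (cases "\<xi> \<in> A")
          case True
          have "h + norm \<xi> \<le> 1" using A_small(1)[OF True] h eps by linarith
          then have "(h + norm \<xi>) powr (2 * t) \<le> (h powr (2 * t) + 1 powr (2 * t)) * 1 powr (2 * t)"
            using h by (intro powr_le_of_bounds) auto
          then have "ennreal ((h + norm \<xi>) powr (2 * t)) \<le> ennreal (h powr (2 * t) + 1)"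
            by (intro ennreal_leI) simp
          then show ?thesis using True by (simp add: \<kappa>_def del: ennreal_plus)
        qed (simp add: \<kappa>_def)
      qed
      also have "\<dots> = ennreal (h powr (2 * t) + 1) * emeasure lborel A"
        by (simp add: nn_integral_cmult del: ennreal_plus)
      also have "\<dots> < \<infinity>" using A_fin by (simp add: ennreal_mult_less_top del: ennreal_plus)
      finally show ?thesis .
    qed
    define u where "u \<omega> = complex_of_real h ^ CARD('d) * \<kappa> (h *\<^sub>R \<omega>)" for \<omega>
    have "integrable lborel (\<lambda>\<xi>. complex_of_real (indicator A \<xi>))"
      using A_fin by (intro integrable_of_real integrable_real_indicator) auto
    then have "integrable lborel \<kappa>"
      by (rule Bochner_Integration.integrable_bound) (auto simp: \<kappa>_def indicator_def)
    from integrable_lborel_affine[OF this, of h 0] h have ui: "integrable lborel u"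
      unfolding u_def by (intro integrable_mult_right) simp
    have "locally_L2 \<kappa>"
      unfolding locally_L2_def
    proof (intro conjI allI impI \<kappa>)
      fix K :: "(real^'d) set" assume K: "compact K"
      then have [measurable]: "K \<in> sets borel" by (simp add: borel_compact)
      have "(\<integral>\<^sup>+\<omega>\<in>K. ennreal ((cmod (\<kappa> \<omega>))\<^sup>2) \<partial>lborel) \<le> (\<integral>\<^sup>+\<omega>. indicator K \<omega> \<partial>lborel)"
        by (intro nn_integral_mono) (auto simp: \<kappa>_def indicator_def)
      also have "\<dots> < \<infinity>" using emeasure_compact_finite[OF K] by simp
      finally show "(\<integral>\<^sup>+\<omega>\<in>K. ennreal ((cmod (\<kappa> \<omega>))\<^sup>2) \<partial>lborel) < \<infinity>" .
    qed
    from locally_L2_dilate[OF this, of h] h have l: "locally_L2 (\<lambda>\<omega>. \<kappa> (h *\<^sub>R \<omega>))" by simp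
    have uL: "locally_L2 u" using locally_L2_lin[OF l l, of "complex_of_real h ^ CARD('d)" 0] by (simp add: u_def[abs_def])
    obtain f where f: "f \<in> tempered" "has_hat f u" using has_hat_surj[OF uL ui] by blast
    have eu: "energy 1 t u = ennreal (h powr (real CARD('d) - 2 * t)) * energy h t \<kappa>" for t
      unfolding u_def by (rule energy_scaled[OF \<kappa> h(1)])
    have fS: "f \<in> sobolev t" for t
      using e_fin[of t] by (intro sobolevI[OF f]) (simp add: eu ennreal_mult_less_top)
    define E where "E = enn2real (energy h k \<kappa>)"
    have E: "energy h k \<kappa> = ennreal E" "E \<ge> 0" using e_fin[of k] by (auto simp: E_def)
    have "ennreal ((sobolev_norm k f)\<^sup>2) = ennreal (h powr (real CARD('d) - 2 * k) * E)"
      unfolding sobolev_norm_sq[OF fS f(2)] eu E using E(2) by (simp add: ennreal_mult)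
    then have nk: "(sobolev_norm k f)\<^sup>2 = h powr (real CARD('d) - 2 * k) * E" using E(2) by simp
    have dist: "sqrt (h powr (real CARD('d) - 2 * s) * (m * E)) \<le> sobolev_dist s f g'" if "g' \<in> ?S h" for g'
    proof -
      obtain g where g: "g \<in> psi_space s (\<phi> h)" "g' = dilate h g" using \<open>g' \<in> ?S h\<close> by auto
      have gs: "g \<in> sobolev s" by (rule psi_space_sobolev[OF \<phi>[OF h(1)] g(1)])
      have [measurable]: "hat g \<in> borel_measurable borel" by (rule hat_measurable[OF gs])
      have "ennreal m * energy h k (indicator A) \<le> energy h s (\<lambda>\<xi>. indicator A \<xi> - hat g \<xi>)"
      proof (rule energy_psi_lower_bound[OF A A_small(2) _ _ psi_space_fibre[OF \<phi>[OF h(1)] g(1)]])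
        fix \<xi> c assume \<xi>: "\<xi> \<in> A"
        show "ennreal (m * (h + norm \<xi>) powr (2 * k)) \<le>
          ennreal ((h + norm \<xi>) powr (2 * s)) * ennreal ((cmod (1 - c * ?\<Phi> \<xi>))\<^sup>2) + ennreal ((cmod c)\<^sup>2) * alias_sum h s ?\<Phi> \<xi>"
          using \<xi> weights[OF A_small(1)[OF \<xi>]] m
          by (intro fibre_error_lower_bound) (auto simp: A_def q_def)
      qed (use m in auto)
      then have "ennreal (h powr (real CARD('d) - 2 * s)) * (ennreal m * ennreal E) \<le>
          ennreal (h powr (real CARD('d) - 2 * s)) * energy h s (\<lambda>\<xi>. \<kappa> \<xi> - hat g \<xi>)"
        unfolding E(1)[symmetric] \<kappa>_def by (rule mult_left_mono) simp
      also have "\<dots> = energy 1 s (\<lambda>\<omega>. complex_of_real h ^ CARD('d) * (\<lambda>\<xi>. \<kappa> \<xi> - hat g \<xi>) (h *\<^sub>R \<omega>))"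
        by (rule energy_scaled[OF _ h(1), symmetric]) measurable
      also have "\<dots> = energy 1 s (\<lambda>\<omega>. u \<omega> - complex_of_real h ^ CARD('d) * hat g (h *\<^sub>R \<omega>))"
        unfolding u_def right_diff_distrib ..
      also have "\<dots> = ennreal ((sobolev_dist s f g')\<^sup>2)"
        unfolding g(2)
        by (rule sobolev_dist_sq[OF fS sobolev_dilate[OF gs h(1)] f(2) has_hat_dilate[OF sobolevD(1,2)[OF gs] h(1)], symmetric])
      finally have "h powr (real CARD('d) - 2 * s) * (m * E) \<le> (sobolev_dist s f g')\<^sup>2"
        using m E(2) by (simp add: ennreal_mult[symmetric] ennreal_le_iff)
      then show ?thesis by (intro real_le_lsqrt sobolev_dist_nonneg)
    qed
    have "E = 0"
    proof -
      have "sqrt (h powr (real CARD('d) - 2 * s) * (m * E)) \<le> (INF g\<in>?S h. sobolev_dist s f g)"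
        using psi_space_props(3)[OF \<phi>[OF h(1)]] by (intro cINF_greatest dist) blast
      also have "\<dots> \<le> C * h powr (k - s) * sobolev_norm k f" by (rule C[OF fS h(1)])
      finally have "(sqrt (h powr (real CARD('d) - 2 * s) * (m * E)))\<^sup>2 \<le> (C * h powr (k - s) * sobolev_norm k f)\<^sup>2"
        using m E(2) by (intro power_mono) auto
      then have "h powr (real CARD('d) - 2 * s) * (m * E) \<le> C\<^sup>2 * (h powr (k - s))\<^sup>2 * (h powr (real CARD('d) - 2 * k) * E)"
        using m E(2) by (simp add: power_mult_distrib nk)
      also have "\<dots> = ((h powr (k - s))\<^sup>2 * h powr (real CARD('d) - 2 * k)) * (C\<^sup>2 * E)" by (simp only: mult_ac)
      also have "(h powr (k - s))\<^sup>2 * h powr (real CARD('d) - 2 * k) = h powr (real CARD('d) - 2 * s)"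
        using h by (simp add: power2_eq_square powr_add[symmetric])
      finally have "m * E \<le> C\<^sup>2 * E" using h by simp
      then show ?thesis using E(2) by (simp add: m_def distrib_right)
    qed
    then have "energy h k \<kappa> = 0" using E by simp
    then have "AE \<xi> in lborel. ennreal ((h + norm \<xi>) powr (2 * k)) * ennreal ((cmod (\<kappa> \<xi>))\<^sup>2) = 0"
      unfolding energy_def by (subst (asm) nn_integral_0_iff_AE) auto
    then have "AE \<xi> in lborel. \<xi> \<notin> A"
    proof eventually_elim
      case (elim \<xi>)
      have "h + norm \<xi> > 0" using h by (simp add: add_pos_nonneg)
      then show ?case using elim by (auto simp: \<kappa>_def)
    qed
    then show ?thesis
      unfolding low_frequency_bound_def
    proof eventually_elim
      case (elim \<xi>)
      show ?case
      proof
        assume n: "norm \<xi> < \<epsilon>"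
        then have good: "?\<Phi> \<xi> \<noteq> 0" "alias_sum h s ?\<Phi> \<xi> \<le> ennreal (4 * m * q \<xi> * (cmod (?\<Phi> \<xi>))\<^sup>2)"
          using elim by (auto simp: A_def)
        have "bracket0 s (\<phi> h) \<xi> \<le> ennreal (weight_const (2 * s)) * alias_sum h s ?\<Phi> \<xi>"
          using h n eps by (intro bracket0_le_alias_sum) auto
        also have "\<dots> \<le> ennreal (weight_const (2 * s)) * ennreal (4 * m * q \<xi> * (cmod (?\<Phi> \<xi>))\<^sup>2)"
          by (intro mult_left_mono good) simp
        also have "\<dots> = ennreal (weight_const (2 * s) * (4 * m * q \<xi> * (cmod (?\<Phi> \<xi>))\<^sup>2))"
          using weight_const_pos[of "2 * s"] m by (simp add: ennreal_mult q_def)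
        also have "\<dots> \<le> ennreal (weight_const (2 * s) * (4 * m * (weight_const k * ((norm \<xi>)\<^sup>2 + h\<^sup>2) powr k) * (cmod (?\<Phi> \<xi>))\<^sup>2))"
          unfolding q_def using weight_const_pos[of "2 * s"] m h
          by (intro ennreal_leI mult_left_mono mult_right_mono weight_sq_compare) auto
        also have "\<dots> = ennreal (M * (cmod (?\<Phi> \<xi>))\<^sup>2 * ((norm \<xi>)\<^sup>2 + h\<^sup>2) powr k)"
          by (simp add: M_def mult_ac)
        finally show "?\<Phi> \<xi> \<noteq> 0 \<and> bracket0 s (\<phi> h) \<xi> \<le> ennreal (M * (cmod (?\<Phi> \<xi>))\<^sup>2 * ((norm \<xi>)\<^sup>2 + h\<^sup>2) powr k)"
          using good by simp
      qed
    qed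
  qed
  then show ?thesis using eps M by blast
qed

section \<open>The bracket quotients\<close>

text \<open>Measurability of \<open>F\<close> excludes the default value of \<open>esssup\<close>.\<close>

lemma Linfty_norm_le_iff:
  fixes F :: "real^'d::finite \<Rightarrow> ennreal"
  assumes F: "F \<in> borel_measurable borel" and \<Omega>: "open \<Omega>"
  shows "Linfty_norm \<Omega> F \<le> C \<longleftrightarrow> (AE \<omega> in lborel. \<omega> \<in> \<Omega> \<longrightarrow> F \<omega> \<le> C)"
proof -
  have S: "\<Omega> \<in> sets lebesgue" using \<Omega> by (simp add: borel_open)
  have m: "F \<in> borel_measurable (lebesgue_on \<Omega>)"
    using F by (intro measurable_restrict_space1 measurable_completion) simp
  have AE: "(AE \<omega> in lebesgue_on \<Omega>. F \<omega> \<le> C) \<longleftrightarrow> (AE \<omega> in lborel. \<omega> \<in> \<Omega> \<longrightarrow> F \<omega> \<le> C)"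
    using S by (simp add: AE_restrict_space_iff AE_completion_iff)
  show ?thesis
    unfolding Linfty_norm_def AE[symmetric]
  proof
    assume le: "esssup (lebesgue_on \<Omega>) F \<le> C"
    show "AE \<omega> in lebesgue_on \<Omega>. F \<omega> \<le> C"
      using esssup_AE[of F "lebesgue_on \<Omega>"] by eventually_elim (use le in auto)
  qed (rule esssup_I[OF m])
qed

lemma bracket_eq_bracket_h: "bracket s \<phi> \<omega> = bracket_h s 0 \<phi> \<omega>"
proof -
  have "bracket s \<phi> \<omega> = (\<Sum>\<^sub>\<infinity>\<alpha>\<in>insert 0 (dual_lattice - {0}).
      ennreal ((cmod (hat \<phi> (\<omega> + \<alpha>)))\<^sup>2 * norm (\<omega> + \<alpha>) powr (2 * s)))"
    unfolding bracket_def by (intro arg_cong[where f = "infsum _"]) auto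
  also have "\<dots> = ennreal ((cmod (hat \<phi> (\<omega> + 0)))\<^sup>2 * norm (\<omega> + 0) powr (2 * s)) + bracket0 s \<phi> \<omega>"
    unfolding bracket0_def by (rule infsum_insert) (auto intro: nonneg_summable_on_complete)
  also have "norm (\<omega> + 0) powr (2 * s) = ((norm \<omega>)\<^sup>2 + 0\<^sup>2) powr s"
    by (simp add: powr_powr[symmetric] powr_numeral)
  finally show ?thesis by (simp add: bracket_h_def add.commute)
qed

lemma bracket_h_measurable:
  assumes "\<phi> \<in> sobolev s"
  shows "bracket_h s h \<phi> \<in> borel_measurable borel"
proof -
  have [measurable]: "hat \<phi> \<in> borel_measurable borel" "bracket0 s \<phi> \<in> borel_measurable borel"
    by (rule hat_measurable[OF assms] bracket0_measurable[OF assms])+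
  show ?thesis unfolding bracket_h_def[abs_def] by measurable
qed

abbreviation bracket_quotient :: "real \<Rightarrow> real \<Rightarrow> real \<Rightarrow> 'd::finite dist \<Rightarrow> real^'d \<Rightarrow> ennreal" where
  "bracket_quotient s k h \<phi> \<equiv> (\<lambda>\<omega>. bracket_ratio (bracket0 s \<phi> \<omega>) (bracket_h s h \<phi> \<omega>) *
    ennreal (1 / ((norm \<omega>)\<^sup>2 + h\<^sup>2) powr (k - s)))"

lemma quotient_measurable:
  assumes "\<phi> \<in> sobolev s"
  shows "bracket_quotient s k h \<phi> \<in> borel_measurable borel"
proof -
  have [measurable]: "bracket_h s h \<phi> \<in> borel_measurable borel" "bracket0 s \<phi> \<in> borel_measurable borel"
    by (rule bracket_h_measurable[OF assms] bracket0_measurable[OF assms])+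
  show ?thesis unfolding bracket_ratio_def by measurable
qed

text \<open>The smallness of \<open>M y\<close> allows to absorb the numerator \<open>b\<close>, which also occurs in the
  denominator. The value \<open>\<infinity>\<close> of \<open>bracket_ratio\<close> for vanishing denominators yields \<open>p \<noteq> 0\<close>.\<close>

lemma quotient_le_imp:
  fixes p y M :: real
  assumes p: "p \<ge> 0" and y: "y > 0" and M: "M \<ge> 0" "M * y \<le> 1 / 2"
    and le: "bracket_ratio b (b + ennreal p) * ennreal (1 / y) \<le> ennreal M"
  shows "p \<noteq> 0 \<and> b \<le> ennreal (2 * M * y * p)"
proof -
  have nt: "b + ennreal p \<noteq> 0" "b + ennreal p \<noteq> \<infinity>"
    using le y by (auto simp: bracket_ratio_def ennreal_top_mult top_unique split: if_splits)
  obtain r where r: "r \<ge> 0" "b = ennreal r" using nt(2) by (cases b) auto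
  have rp: "r + p > 0" using nt(1) r p by (auto simp: ennreal_plus[symmetric] simp del: ennreal_plus intro: le_neq_trans)
  have "ennreal (r / (r + p) * (1 / y)) \<le> ennreal M"
    using le nt r p rp y
    by (simp add: bracket_ratio_def divide_ennreal ennreal_mult[symmetric] ennreal_plus[symmetric] del: ennreal_plus)
  then have "r / (r + p) * (1 / y) \<le> M" using M by (simp add: ennreal_le_iff)
  then have "r / (r + p) \<le> M * y" using pos_divide_le_eq[OF y, of "r / (r + p)" M] by simp
  then have "r \<le> (M * y) * (r + p)" by (simp only: pos_divide_le_eq[OF rp])
  also have "\<dots> = (M * y) * r + (M * y) * p" by (simp add: distrib_left)
  also have "(M * y) * r \<le> (1 / 2) * r" using M r by (intro mult_right_mono)
  finally have r2: "r \<le> 2 * M * y * p" by simp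
  moreover have "p \<noteq> 0" using r2 rp r(1) by auto
  ultimately show ?thesis using r by (simp add: ennreal_leI)
qed

lemma quotient_le:
  fixes p y M :: real
  assumes p: "p > 0" and y: "y > 0" and M: "M \<ge> 0" and b: "b \<le> ennreal (M * y * p)"
  shows "bracket_ratio b (b + ennreal p) * ennreal (1 / y) \<le> ennreal M"
proof -
  obtain r where r: "r \<ge> 0" "b = ennreal r" "r \<le> M * y * p"
    using b M y p by (cases b) (auto simp: ennreal_le_iff top_unique)
  have rp: "r + p > 0" using p r by linarith
  have "M * y * p \<le> M * y * (r + p)" using M y r by (intro mult_left_mono) auto
  then have "r \<le> M * y * (r + p)" using r by linarith
  then have "r / (r + p) \<le> M * y" by (simp only: pos_divide_le_eq[OF rp])
  then have "r / (r + p) * (1 / y) \<le> M" using pos_divide_le_eq[OF y, of "r / (r + p)" M] by simp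
  then show ?thesis
    using r p rp y by (simp add: bracket_ratio_def divide_ennreal ennreal_mult[symmetric] ennreal_plus[symmetric] ennreal_leI del: ennreal_plus)
qed

lemma powr_split_exponent:
  "(x :: real) powr (k - s) * (c * x powr s) = c * x powr k"
  by (simp add: powr_add[symmetric] mult.left_commute)

lemma ennreal_finite_real:
  assumes "(x :: ennreal) < \<infinity>"
  obtains M where "M \<ge> 0" "x = ennreal M"
  using assms by (cases x) auto

lemma low_frequency_bound_of_quotient:
  assumes \<phi>: "\<phi> \<in> sobolev s" and M: "M \<ge> 0"
    and \<Omega>: "open \<Omega>" "ball 0 \<epsilon> \<subseteq> \<Omega>"
    and small: "\<And>r. 0 \<le> r \<Longrightarrow> r < \<epsilon> \<Longrightarrow> M * (r\<^sup>2 + h\<^sup>2) powr (k - s) \<le> 1 / 2"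
    and le: "Linfty_norm \<Omega> (bracket_quotient s k h \<phi>) \<le> ennreal M"
  shows "low_frequency_bound s k h \<epsilon> (2 * M) \<phi>"
  using le[unfolded Linfty_norm_le_iff[OF quotient_measurable[OF \<phi>] \<Omega>(1)]] AE_lborel_singleton[of 0]
  unfolding low_frequency_bound_def
proof eventually_elim
  case (elim \<xi>)
  show ?case
  proof
    assume n: "norm \<xi> < \<epsilon>"
    define x where "x = (norm \<xi>)\<^sup>2 + h\<^sup>2"
    have x: "x > 0" using elim by (simp add: x_def add_pos_nonneg)
    have "\<xi> \<in> \<Omega>" using n \<Omega>(2) by (auto simp: dist_norm)
    then have le: "bracket_ratio (bracket0 s \<phi> \<xi>) (bracket0 s \<phi> \<xi> + ennreal ((cmod (hat \<phi> \<xi>))\<^sup>2 * x powr s)) *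
        ennreal (1 / x powr (k - s)) \<le> ennreal M"
      using elim by (simp add: bracket_h_def x_def)
    have "(cmod (hat \<phi> \<xi>))\<^sup>2 * x powr s \<noteq> 0 \<and>
        bracket0 s \<phi> \<xi> \<le> ennreal (2 * M * x powr (k - s) * ((cmod (hat \<phi> \<xi>))\<^sup>2 * x powr s))"
    proof (rule quotient_le_imp[OF _ _ M _ le])
      show "M * x powr (k - s) \<le> 1 / 2" unfolding x_def by (rule small[OF norm_ge_zero n])
    qed (use x in auto)
    moreover have "2 * M * x powr (k - s) * ((cmod (hat \<phi> \<xi>))\<^sup>2 * x powr s) = 2 * M * (cmod (hat \<phi> \<xi>))\<^sup>2 * x powr k"
      by (simp add: mult.assoc powr_split_exponent)
    ultimately show "hat \<phi> \<xi> \<noteq> 0 \<and> bracket0 s \<phi> \<xi> \<le> ennreal (2 * M * (cmod (hat \<phi> \<xi>))\<^sup>2 * ((norm \<xi>)\<^sup>2 + h\<^sup>2) powr k)"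
      unfolding x_def[symmetric] by (simp only:) simp
  qed
qed

lemma quotient_of_low_frequency_bound:
  assumes \<phi>: "\<phi> \<in> sobolev s" and M: "M \<ge> 0"
    and low: "low_frequency_bound s k h \<epsilon> M \<phi>"
  shows "Linfty_norm (ball 0 \<epsilon>) (bracket_quotient s k h \<phi>) \<le> ennreal M"
  unfolding Linfty_norm_le_iff[OF quotient_measurable[OF \<phi>] open_ball]
  using low[unfolded low_frequency_bound_def] AE_lborel_singleton[of 0]
proof eventually_elim
  case (elim \<xi>)
  show ?case
  proof
    assume "\<xi> \<in> ball 0 \<epsilon>"
    then have n: "norm \<xi> < \<epsilon>" by (simp add: dist_norm)
    define x where "x = (norm \<xi>)\<^sup>2 + h\<^sup>2"
    have x: "x > 0" using elim by (simp add: x_def add_pos_nonneg)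
    have b: "bracket0 s \<phi> \<xi> \<le> ennreal (M * x powr (k - s) * ((cmod (hat \<phi> \<xi>))\<^sup>2 * x powr s))"
      using elim n by (simp add: x_def mult.assoc powr_split_exponent)
    have "bracket_ratio (bracket0 s \<phi> \<xi>) (bracket0 s \<phi> \<xi> + ennreal ((cmod (hat \<phi> \<xi>))\<^sup>2 * x powr s)) *
        ennreal (1 / x powr (k - s)) \<le> ennreal M"
      using elim n x by (intro quotient_le[OF _ _ M b]) auto
    then show "bracket_ratio (bracket0 s \<phi> \<xi>) (bracket_h s h \<phi> \<xi>) *
       ennreal (1 / ((norm \<xi>)\<^sup>2 + h\<^sup>2) powr (k - s)) \<le> ennreal M"
      by (simp add: bracket_h_def x_def)
  qed
qed

lemma small_radius:
  fixes M t :: real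
  assumes "M \<ge> 0" "t > 0"
  obtains \<delta> where "\<delta> > 0" "\<And>r h. 0 \<le> r \<Longrightarrow> r < \<delta> \<Longrightarrow> 0 \<le> h \<Longrightarrow> h < \<delta> \<Longrightarrow> M * (r\<^sup>2 + h\<^sup>2) powr t \<le> 1 / 2"
proof -
  define y where "y = (1 / (2 * (M + 1))) powr (1 / t)"
  have y: "y > 0" using assms by (simp add: y_def)
  \<comment> \<open>\<open>\<delta> \<le> 1\<close> gives \<open>z\<^sup>2 \<le> \<delta>\<close> for \<open>0 \<le> z < \<delta>\<close>\<close>
  define \<delta> where "\<delta> = min 1 (y / 2)"
  have d: "\<delta> > 0" "\<delta> \<le> 1" "2 * \<delta> \<le> y" using y by (auto simp: \<delta>_def)
  have "M * (r\<^sup>2 + h\<^sup>2) powr t \<le> 1 / 2" if "0 \<le> r" "r < \<delta>" "0 \<le> h" "h < \<delta>" for r h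
  proof -
    have sq: "z\<^sup>2 \<le> \<delta>" if "0 \<le> z" "z < \<delta>" for z :: real
    proof -
      have "z * z \<le> \<delta> * 1" using that d by (intro mult_mono) auto
      then show ?thesis by (simp add: power2_eq_square)
    qed
    have "r\<^sup>2 + h\<^sup>2 \<le> y" using sq[of r] sq[of h] that d by linarith
    then have "(r\<^sup>2 + h\<^sup>2) powr t \<le> y powr t" using assms by (intro powr_mono2) auto
    also have "\<dots> = 1 / (2 * (M + 1))" using assms by (simp add: y_def powr_powr)
    finally have "M * (r\<^sup>2 + h\<^sup>2) powr t \<le> M * (1 / (2 * (M + 1)))" using assms by (intro mult_left_mono)
    also have "\<dots> \<le> 1 / 2" using assms by (simp add: field_simps)
    finally show ?thesis .
  qed
  then show ?thesis using that d(1) by blast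
qed

lemma nonstationary_order_iff:
  fixes \<phi> :: "real \<Rightarrow> 'd::finite dist"
  assumes sk: "s < k" and \<phi>: "\<And>h. h > 0 \<Longrightarrow> \<phi> h \<in> sobolev s"
  shows "provides_approx_order s k (\<lambda>h. dilate h ` psi_space s (\<phi> h)) \<longleftrightarrow>
    (\<exists>\<epsilon>>0. \<exists>M\<ge>0. \<forall>h. 0 < h \<and> h < \<epsilon> \<longrightarrow> low_frequency_bound s k h \<epsilon> M (\<phi> h))"
proof
  assume order: "provides_approx_order s k (\<lambda>h. dilate h ` psi_space s (\<phi> h))"
  show "\<exists>\<epsilon>>0. \<exists>M\<ge>0. \<forall>h. 0 < h \<and> h < \<epsilon> \<longrightarrow> low_frequency_bound s k h \<epsilon> M (\<phi> h)"
    by (rule low_frequency_bound_of_order[OF sk _ order]) (rule \<phi>)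
next
  assume "\<exists>\<epsilon>>0. \<exists>M\<ge>0. \<forall>h. 0 < h \<and> h < \<epsilon> \<longrightarrow> low_frequency_bound s k h \<epsilon> M (\<phi> h)"
  then obtain \<epsilon> M where e: "\<epsilon> > 0" and low: "\<And>h. 0 < h \<Longrightarrow> h < \<epsilon> \<Longrightarrow> low_frequency_bound s k h \<epsilon> M (\<phi> h)"
    by blast
  show "provides_approx_order s k (\<lambda>h. dilate h ` psi_space s (\<phi> h))"
    by (rule order_of_low_frequency_bound[of s k \<phi>, OF sk \<phi> e e low])
qed

text \<open>Countably many null sets are collected along a sequence of parameters that tends to zero.\<close>

lemma stationary_bound_iff:
  assumes k: "k \<ge> 0"
  shows "(\<exists>\<epsilon>>0. \<exists>M\<ge>0. \<forall>h. 0 < h \<and> h < \<epsilon> \<longrightarrow> low_frequency_bound s k h \<epsilon> M \<phi>) \<longleftrightarrow>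
    (\<exists>\<epsilon>>0. \<exists>M\<ge>0. low_frequency_bound s k 0 \<epsilon> M \<phi>)"
proof
  assume "\<exists>\<epsilon>>0. \<exists>M\<ge>0. \<forall>h. 0 < h \<and> h < \<epsilon> \<longrightarrow> low_frequency_bound s k h \<epsilon> M \<phi>"
  then obtain \<epsilon> M where e: "\<epsilon> > 0" "M \<ge> 0" and low: "\<And>h. 0 < h \<Longrightarrow> h < \<epsilon> \<Longrightarrow> low_frequency_bound s k h \<epsilon> M \<phi>"
    by blast
  define h where "h n = \<epsilon> / (real n + 2)" for n
  have h: "0 < h n" "h n < \<epsilon>" for n
    using e divide_strict_left_mono[of 1 "real n + 2" \<epsilon>] by (auto simp: h_def)
  have lim: "h \<longlonglongrightarrow> 0"
    using LIMSEQ_ignore_initial_segment[OF lim_const_over_n[of \<epsilon>], of 2]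
    by (simp add: h_def[abs_def] add.commute)
  have "AE \<xi> in lborel. \<forall>n. norm \<xi> < \<epsilon> \<longrightarrow> hat \<phi> \<xi> \<noteq> 0 \<and>
      bracket0 s \<phi> \<xi> \<le> ennreal (M * (cmod (hat \<phi> \<xi>))\<^sup>2 * ((norm \<xi>)\<^sup>2 + (h n)\<^sup>2) powr k)"
    unfolding AE_all_countable using low[OF h] by (simp add: low_frequency_bound_def)
  then have "low_frequency_bound s k 0 \<epsilon> M \<phi>"
    using AE_lborel_singleton[of 0] unfolding low_frequency_bound_def
  proof eventually_elim
    case (elim \<xi>)
    have "(\<lambda>n. M * (cmod (hat \<phi> \<xi>))\<^sup>2 * ((norm \<xi>)\<^sup>2 + (h n)\<^sup>2) powr k) \<longlonglongrightarrow>
        M * (cmod (hat \<phi> \<xi>))\<^sup>2 * ((norm \<xi>)\<^sup>2 + 0\<^sup>2) powr k"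
      using elim by (intro tendsto_intros lim) auto
    then have "(\<lambda>n. ennreal (M * (cmod (hat \<phi> \<xi>))\<^sup>2 * ((norm \<xi>)\<^sup>2 + (h n)\<^sup>2) powr k)) \<longlonglongrightarrow>
        ennreal (M * (cmod (hat \<phi> \<xi>))\<^sup>2 * ((norm \<xi>)\<^sup>2 + 0\<^sup>2) powr k)"
      by (rule tendsto_ennrealI)
    then show ?case using elim by (auto intro: LIMSEQ_le_const)
  qed
  then show "\<exists>\<epsilon>>0. \<exists>M\<ge>0. low_frequency_bound s k 0 \<epsilon> M \<phi>" using e by blast
next
  assume "\<exists>\<epsilon>>0. \<exists>M\<ge>0. low_frequency_bound s k 0 \<epsilon> M \<phi>"
  then obtain \<epsilon> M where e: "\<epsilon> > 0" "M \<ge> 0" and low: "low_frequency_bound s k 0 \<epsilon> M \<phi>" by blast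
  have "low_frequency_bound s k h \<epsilon> M \<phi>" for h
    using low unfolding low_frequency_bound_def
  proof eventually_elim
    case (elim \<xi>)
    have "M * (cmod (hat \<phi> \<xi>))\<^sup>2 * ((norm \<xi>)\<^sup>2 + 0\<^sup>2) powr k \<le> M * (cmod (hat \<phi> \<xi>))\<^sup>2 * ((norm \<xi>)\<^sup>2 + h\<^sup>2) powr k"
      using e k by (intro mult_left_mono powr_mono2) auto
    then show ?case using elim by (auto intro: order_trans ennreal_leI)
  qed
  then show "\<exists>\<epsilon>>0. \<exists>M\<ge>0. \<forall>h. 0 < h \<and> h < \<epsilon> \<longrightarrow> low_frequency_bound s k h \<epsilon> M \<phi>" using e by blast
qed

lemma stationary_quotient_iff:
  assumes \<phi>: "\<phi> \<in> sobolev s" and sk: "s < k"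
  shows "(\<exists>\<epsilon>>0. \<exists>M\<ge>0. low_frequency_bound s k 0 \<epsilon> M \<phi>) \<longleftrightarrow>
    (\<exists>\<Omega>. open \<Omega> \<and> 0 \<in> \<Omega> \<and>
      Linfty_norm \<Omega> (\<lambda>\<omega>. bracket_ratio (bracket0 s \<phi> \<omega>) (bracket s \<phi> \<omega>)
        * ennreal (1 / norm \<omega> powr (2 * k - 2 * s))) < \<infinity>)"
proof -
  have "norm \<omega> powr (2 * k - 2 * s) = ((norm \<omega>)\<^sup>2 + 0\<^sup>2) powr (k - s)" for \<omega> :: "real^'a"
  proof -
    have "norm \<omega> powr (2 * k - 2 * s) = norm \<omega> powr (2 * (k - s))" by (simp add: algebra_simps)
    also have "\<dots> = (norm \<omega> powr 2) powr (k - s)" by (simp only: powr_powr)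
    finally show ?thesis by (simp add: powr_numeral)
  qed
  then have eq: "(\<lambda>\<omega>. bracket_ratio (bracket0 s \<phi> \<omega>) (bracket s \<phi> \<omega>) * ennreal (1 / norm \<omega> powr (2 * k - 2 * s))) =
     (bracket_quotient s k 0 \<phi>)"
    by (simp add: bracket_eq_bracket_h)
  show ?thesis
    unfolding eq
  proof
    assume "\<exists>\<epsilon>>0. \<exists>M\<ge>0. low_frequency_bound s k 0 \<epsilon> M \<phi>"
    then obtain \<epsilon> M where "\<epsilon> > 0" "M \<ge> 0" "low_frequency_bound s k 0 \<epsilon> M \<phi>" by blast
    from quotient_of_low_frequency_bound[OF \<phi> this(2) this(3)] this(1)
    show "\<exists>\<Omega>. open \<Omega> \<and> 0 \<in> \<Omega> \<and> Linfty_norm \<Omega> (bracket_quotient s k 0 \<phi>) < \<infinity>"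
      by (intro exI[of _ "ball 0 \<epsilon>"]) (auto elim: le_less_trans)
  next
    assume "\<exists>\<Omega>. open \<Omega> \<and> 0 \<in> \<Omega> \<and> Linfty_norm \<Omega> (bracket_quotient s k 0 \<phi>) < \<infinity>"
    then obtain \<Omega> where \<Omega>: "open \<Omega>" "0 \<in> \<Omega>" and fin: "Linfty_norm \<Omega> (bracket_quotient s k 0 \<phi>) < \<infinity>" by blast
    from fin obtain M where M: "M \<ge> 0" "Linfty_norm \<Omega> (bracket_quotient s k 0 \<phi>) = ennreal M"
      by (rule ennreal_finite_real)
    obtain e where e: "e > 0" "ball 0 e \<subseteq> \<Omega>" using \<Omega> openE by blast
    obtain \<delta> where d: "\<delta> > 0" "\<And>r h. 0 \<le> r \<Longrightarrow> r < \<delta> \<Longrightarrow> 0 \<le> h \<Longrightarrow> h < \<delta> \<Longrightarrow> M * (r\<^sup>2 + h\<^sup>2) powr (k - s) \<le> 1 / 2"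
      using small_radius[OF M(1), of "k - s"] sk by auto
    have "low_frequency_bound s k 0 (min e \<delta>) (2 * M) \<phi>"
    proof (rule low_frequency_bound_of_quotient[OF \<phi> M(1) \<Omega>(1)])
      show "ball 0 (min e \<delta>) \<subseteq> \<Omega>" using e(2) by auto
      show "M * (r\<^sup>2 + 0\<^sup>2) powr (k - s) \<le> 1 / 2" if "0 \<le> r" "r < min e \<delta>" for r
        using d(2)[of r 0] that d(1) by simp
    qed (simp only: M(2))
    then show "\<exists>\<epsilon>>0. \<exists>M\<ge>0. low_frequency_bound s k 0 \<epsilon> M \<phi>"
      using e d M(1) by (intro exI[of _ "min e \<delta>"] conjI exI[of _ "2 * M"]) auto
  qed
qed

text \<open>A bound on the quotients makes them at most \<open>1/2\<close> once the radius and the range of \<open>h\<close>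
  are small enough, and can then be multiplied out.\<close>

lemma nonstationary_quotient_iff:
  fixes \<phi> :: "real \<Rightarrow> 'd::finite dist"
  assumes \<phi>: "\<And>h. h > 0 \<Longrightarrow> \<phi> h \<in> sobolev s" and sk: "s < k"
  shows "(\<exists>\<epsilon>>0. \<exists>M\<ge>0. \<forall>h. 0 < h \<and> h < \<epsilon> \<longrightarrow> low_frequency_bound s k h \<epsilon> M (\<phi> h)) \<longleftrightarrow>
    (\<exists>h\<^sub>0>0. \<exists>\<Omega>. open \<Omega> \<and> 0 \<in> \<Omega> \<and> (\<exists>C<\<infinity>. \<forall>h. 0 < h \<and> h < h\<^sub>0 \<longrightarrow>
       Linfty_norm \<Omega> (bracket_quotient s k h (\<phi> h)) \<le> C))"
proof
  assume "\<exists>\<epsilon>>0. \<exists>M\<ge>0. \<forall>h. 0 < h \<and> h < \<epsilon> \<longrightarrow> low_frequency_bound s k h \<epsilon> M (\<phi> h)"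
  then obtain \<epsilon> M where e: "\<epsilon> > 0" "M \<ge> 0" and low: "\<And>h. 0 < h \<Longrightarrow> h < \<epsilon> \<Longrightarrow> low_frequency_bound s k h \<epsilon> M (\<phi> h)"
    by blast
  have "Linfty_norm (ball 0 \<epsilon>) (bracket_quotient s k h (\<phi> h)) \<le> ennreal M" if "0 < h" "h < \<epsilon>" for h
    using that by (intro quotient_of_low_frequency_bound \<phi> e low) auto
  then show "\<exists>h\<^sub>0>0. \<exists>\<Omega>. open \<Omega> \<and> 0 \<in> \<Omega> \<and> (\<exists>C<\<infinity>. \<forall>h. 0 < h \<and> h < h\<^sub>0 \<longrightarrow>
       Linfty_norm \<Omega> (bracket_quotient s k h (\<phi> h)) \<le> C)"
    using e by (intro exI[of _ \<epsilon>] conjI exI[of _ "ball 0 \<epsilon>"] exI[of _ "ennreal M"]) auto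
next
  assume "\<exists>h\<^sub>0>0. \<exists>\<Omega>. open \<Omega> \<and> 0 \<in> \<Omega> \<and> (\<exists>C<\<infinity>. \<forall>h. 0 < h \<and> h < h\<^sub>0 \<longrightarrow>
       Linfty_norm \<Omega> (bracket_quotient s k h (\<phi> h)) \<le> C)"
  then obtain h0 \<Omega> C where h0: "h0 > 0" and \<Omega>: "open \<Omega>" "0 \<in> \<Omega>" and C: "C < \<infinity>"
    and le: "\<And>h. 0 < h \<Longrightarrow> h < h0 \<Longrightarrow> Linfty_norm \<Omega> (bracket_quotient s k h (\<phi> h)) \<le> C" by blast
  from C obtain M where M: "M \<ge> 0" "C = ennreal M" by (rule ennreal_finite_real)
  obtain e where e: "e > 0" "ball 0 e \<subseteq> \<Omega>" using \<Omega> openE by blast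
  obtain \<delta> where d: "\<delta> > 0" "\<And>r h. 0 \<le> r \<Longrightarrow> r < \<delta> \<Longrightarrow> 0 \<le> h \<Longrightarrow> h < \<delta> \<Longrightarrow> M * (r\<^sup>2 + h\<^sup>2) powr (k - s) \<le> 1 / 2"
    using small_radius[OF M(1), of "k - s"] sk by auto
  define \<epsilon> where "\<epsilon> = min h0 (min e \<delta>)"
  have "low_frequency_bound s k h \<epsilon> (2 * M) (\<phi> h)" if h: "0 < h" "h < \<epsilon>" for h
  proof (rule low_frequency_bound_of_quotient[OF \<phi>[OF h(1)] M(1) \<Omega>(1)])
    show "ball 0 \<epsilon> \<subseteq> \<Omega>" using e(2) by (auto simp: \<epsilon>_def)
  qed (use h d(2) le[of h] M(2) in \<open>auto simp: \<epsilon>_def\<close>)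
  then show "\<exists>\<epsilon>>0. \<exists>M\<ge>0. \<forall>h. 0 < h \<and> h < \<epsilon> \<longrightarrow> low_frequency_bound s k h \<epsilon> M (\<phi> h)"
    using h0 e d M(1) by (intro exI[of _ \<epsilon>] conjI exI[of _ "2 * M"]) (auto simp: \<epsilon>_def)
qed

theorem theorem7:
  fixes s k :: real
  assumes "k > s" and "k \<ge> 0"
  shows "(\<forall>\<phi> :: 'd::finite dist. \<phi> \<in> sobolev s \<longrightarrow>
      (provides_approx_order s k (\<lambda>h. dilate h ` psi_space s \<phi>) \<longleftrightarrow>
       (\<exists>\<Omega>. open \<Omega> \<and> 0 \<in> \<Omega> \<and>
          Linfty_norm \<Omega> (\<lambda>\<omega>. bracket_ratio (bracket0 s \<phi> \<omega>) (bracket s \<phi> \<omega>)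
                              * ennreal (1 / norm \<omega> powr (2 * k - 2 * s))) < \<infinity>)))
    \<and> (\<forall>\<phi> :: real \<Rightarrow> 'd dist. (\<forall>h>0. \<phi> h \<in> sobolev s) \<longrightarrow>
      (provides_approx_order s k (\<lambda>h. dilate h ` psi_space s (\<phi> h)) \<longleftrightarrow>
       (\<exists>h\<^sub>0>0. \<exists>\<Omega>. open \<Omega> \<and> 0 \<in> \<Omega> \<and>
          (\<exists>C<\<infinity>. \<forall>h. 0 < h \<and> h < h\<^sub>0 \<longrightarrow>
             Linfty_norm \<Omega> (\<lambda>\<omega>. bracket_ratio (bracket0 s (\<phi> h) \<omega>) (bracket_h s h (\<phi> h) \<omega>)
                                 * ennreal (1 / ((norm \<omega>)\<^sup>2 + h\<^sup>2) powr (k - s))) \<le> C))))"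
proof (intro conjI allI impI)
  fix \<phi> :: "'d dist" assume \<phi>: "\<phi> \<in> sobolev s"
  show "provides_approx_order s k (\<lambda>h. dilate h ` psi_space s \<phi>) \<longleftrightarrow>
       (\<exists>\<Omega>. open \<Omega> \<and> 0 \<in> \<Omega> \<and>
          Linfty_norm \<Omega> (\<lambda>\<omega>. bracket_ratio (bracket0 s \<phi> \<omega>) (bracket s \<phi> \<omega>)
                              * ennreal (1 / norm \<omega> powr (2 * k - 2 * s))) < \<infinity>)"
    using nonstationary_order_iff[OF assms(1), of "\<lambda>_. \<phi>"] stationary_bound_iff[OF assms(2), of s \<phi>]
      stationary_quotient_iff[OF \<phi> assms(1)] \<phi> by simp
next
  fix \<phi> :: "real \<Rightarrow> 'd dist" assume "\<forall>h>0. \<phi> h \<in> sobolev s"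
  then have \<phi>: "\<And>h. h > 0 \<Longrightarrow> \<phi> h \<in> sobolev s" by blast
  show "provides_approx_order s k (\<lambda>h. dilate h ` psi_space s (\<phi> h)) \<longleftrightarrow>
       (\<exists>h\<^sub>0>0. \<exists>\<Omega>. open \<Omega> \<and> 0 \<in> \<Omega> \<and>
          (\<exists>C<\<infinity>. \<forall>h. 0 < h \<and> h < h\<^sub>0 \<longrightarrow>
             Linfty_norm \<Omega> (\<lambda>\<omega>. bracket_ratio (bracket0 s (\<phi> h) \<omega>) (bracket_h s h (\<phi> h) \<omega>)
                                 * ennreal (1 / ((norm \<omega>)\<^sup>2 + h\<^sup>2) powr (k - s))) \<le> C))"
    by (rule trans[OF nonstationary_order_iff[of s k \<phi>, OF assms(1) \<phi>] nonstationary_quotient_iff[of \<phi> s k, OF \<phi> assms(1)]])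
qed

end
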